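(* Let $0\le k<g$ and let $f_k$ be a $k$-semiroot of $f$. Put $T_k=\{\alpha:\alpha\in\mathbb{N}^*\setminus\Lambda_k\}\,\dot\cup\,\{-\alpha:\alpha\in\mathbb{N}\setminus\Gamma_k\}$. Then the three sets $$e_kL_k^1,\qquad \Big\{\sum_{i=k+1}^{g}s_iv_i+r \;:\; r\in\rho_k(L_k^2)\Big\},\qquad \Big\{\sum_{i=k+1}^{g}s_iv_i+v_{k+1}-e_k\delta \;:\; \delta\in T_k\Big\},$$ where in the last two sets $(s_{k+1},\dots,s_g)$ ranges over all integer tuples with $0\le s_{k+1}\le n_{k+1}-2$ and $0\le s_i<n_i$ for $i=k+2,\dots,g$, are pairwise disjoint, and their (disjoint) union is contained in $\Lambda_f\setminus\Gamma_f$.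
   Context: Notation: $\mathbb{N}=\{0,1,2,\dots\}$, $\mathbb{N}^*=\mathbb{N}\setminus\{0\}$. Throughout $f=y^n+\sum_{i=1}^n c_i(x)y^{n-i}\in\mathbb{C}\{x\}[y]$ is an irreducible Weierstrass polynomial whose degree $n=\deg_y f$ equals its multiplicity, $n>1$, and $n\nmid m:=\mathrm{ord}_x(c_n)$ (so $m>n$); $C_f$ is the plane branch $f=0$. It has a primitive Puiseux parametrization $(t^n,\varphi(t))$, $\varphi=\sum_{i\ge m}a_it^i\in\mathbb{C}\{t\}$. Put $\beta_0=e_0=n$, $n_0=1$, and for $i\ge1$: $\beta_i=\min\{l: a_l\ne0,\ e_{i-1}\nmid l\}$, $e_i=\gcd(e_{i-1},\beta_i)$, $n_i=e_{i-1}/e_i$; $g$ is the index with $e_g=1$. For $h\in\mathbb{C}\{x,y\}$, $\nu_f(h)=\mathrm{ord}_t\,h(t^n,\varphi(t))$ ($=\infty$ iff $f\mid h$). $\Gamma_f=\{\nu_f(h): h\notin\langle f\rangle\}=\langle v_0,\dots,v_g\rangle$ is the value semigroup, with minimal generators $v_0=n$, $v_{i+1}=n_iv_i+\beta_{i+1}-\beta_i$ for $0\le i<g$; $e_i=\gcd(v_0,\dots,v_i)$. Set $v_{g+1}=\infty$. Let $\Omega^1=\mathbb{C}\{x,y\}dx+\mathbb{C}\{x,y\}dy$. For $\omega=A\,dx+B\,dy\in\Omega^1$ and a parametrization $(x(t),y(t))=(t^n,\varphi(t))$ of $C_f$, $\nu_f(\omega)=\mathrm{ord}_t\big(t(A(x(t),y(t))x'(t)+B(x(t),y(t))y'(t))\big)$,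 and $\Lambda_f$ is the set of all finite values $\nu_f(\omega)$, $\omega\in\Omega^1$. One has $\Gamma_f\setminus\{0\}\subseteq\Lambda_f$. A $k$-semiroot of $f$ is a monic polynomial $f_k\in\mathbb{C}\{x\}[y]$ with $\deg_y f_k=n_0n_1\cdots n_k=n/e_k$ and $\nu_f(f_k)=v_{k+1}$; it is irreducible and defines a branch $C_k$ with semigroup $\Gamma_k=\langle v_0/e_k,\dots,v_k/e_k\rangle$. Write $\nu_k=\nu_{f_k}$, $\Lambda_k=\Lambda_{f_k}$ (values of differentials on $C_k$). For $\delta\in\Lambda_k$ let $\Theta_k(\delta)=\max\{\nu_k(B): \delta=\nu_k(A\,dx-B\,dy)\}\in\Gamma_k\cup\{\infty\}$, the maximum over all $A,B\in\mathbb{C}\{x,y\}$ with $\nu_k(A\,dx-B\,dy)=\delta$. Let $L_k^1=\{\delta\in\Lambda_k\setminus\Gamma_k: e_k(\delta-\Theta_k(\delta))<\beta_{k+1}\}$ and $L_k^2=\{\delta\in\Lambda_k\setminus\Gamma_k: e_k(\delta-\Theta_k(\delta))>\beta_{k+1}\}$, and define $\rho_k$ on $\Lambda_k\setminus\Gamma_k$ by $\rho_k(\delta)=e_k\delta$ if $\delta\in L_k^1$ and $\rho_k(\delta)=\beta_{k+1}+e_k\Theta_k(\delta)$ if $\delta\in L_k^2$. (Here $e_kL=\{e_k\delta:\delta\in L\}$.) *)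

theory Defs
  imports "HOL-Analysis.Analysis" "HOL-Computational_Algebra.Computational_Algebra"
begin

text \<open>
  A power series in \<open>x, y\<close> is an element of \<^typ>\<open>complex fps fps\<close>: the outer variable is \<open>y\<close>,
  the inner one \<open>x\<close>, so that \<open>fps_nth (fps_nth h j) i\<close> is the coefficient of \<open>x\<^sup>i y\<^sup>j\<close>.
  This matches \<^const>\<open>fps_of_poly\<close>, which embeds \<open>\<complex>[[x]][y]\<close> (type \<^typ>\<open>complex fps poly\<close>).
\<close>

definition conv1 :: "complex fps set" where
  "conv1 = {c. fps_conv_radius c > 0}"

definition conv1_poly :: "complex fps poly set" where
  "conv1_poly = {p. \<forall>j. coeff p j \<in> conv1}"

text \<open>\<open>\<complex>{x,y}\<close>: absolute convergence on some closed polydisc around the origin.\<close>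

definition conv2 :: "complex fps fps set" where
  "conv2 = {h. \<exists>r::real. r > 0 \<and>
     (\<lambda>(i, j). norm (fps_nth (fps_nth h j) i) * r ^ (i + j)) summable_on (UNIV :: (nat \<times> nat) set)}"

text \<open>The library's \<^const>\<open>irreducible\<close>, relative to a subring \<open>R\<close> of the ambient ring.\<close>

definition irreducible_in :: "'a::comm_ring_1 set \<Rightarrow> 'a \<Rightarrow> bool" where
  "irreducible_in R p \<longleftrightarrow> p \<in> R \<and> p \<noteq> 0 \<and> \<not> (\<exists>u\<in>R. p * u = 1) \<and>
     (\<forall>a\<in>R. \<forall>b\<in>R. p = a * b \<longrightarrow> (\<exists>u\<in>R. a * u = 1) \<or> (\<exists>u\<in>R. b * u = 1))"

definition weierstrass_poly :: "complex fps poly \<Rightarrow> bool" where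
  "weierstrass_poly f \<longleftrightarrow> f \<in> conv1_poly \<and> lead_coeff f = 1 \<and>
     (\<forall>j < degree f. fps_nth (coeff f j) 0 = 0)"

definition multiplicity2 :: "complex fps fps \<Rightarrow> nat" where
  "multiplicity2 h = (LEAST d. \<exists>i j. i + j = d \<and> fps_nth (fps_nth h j) i \<noteq> 0)"

definition ord_t :: "complex fps \<Rightarrow> enat" where
  "ord_t h = (if h = 0 then \<infinity> else enat (subdegree h))"

text \<open>
  The series \<open>h(X(t), Y(t))\<close> for \<open>X\<close>, \<open>Y\<close> without constant term. As \<open>Y\<^sup>j\<close> has order at least \<open>j\<close>,
  only the terms with \<open>j \<le> N\<close> contribute to the coefficient of \<open>t\<^sup>N\<close>.
\<close>

definition subst2 :: "complex fps fps \<Rightarrow> complex fps \<Rightarrow> complex fps \<Rightarrow> complex fps" where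
  "subst2 h X Y = Abs_fps (\<lambda>N. \<Sum>j\<le>N. fps_nth (fps_compose (fps_nth h j) X * Y ^ j) N)"

section \<open>Branches, values of functions and of differentials\<close>

text \<open>
  \<open>(t\<^sup>n, \<phi>(t))\<close>, with \<open>n = deg\<^sub>y f\<close>, is a primitive parametrization of \<open>f = 0\<close>; primitive means that
  it is not a pair of series in \<open>t\<^sup>d\<close> with \<open>d > 1\<close>.
\<close>

definition puiseux_param :: "complex fps poly \<Rightarrow> complex fps \<Rightarrow> bool" where
  "puiseux_param f \<phi> \<longleftrightarrow> \<phi> \<in> conv1 \<and> fps_nth \<phi> 0 = 0 \<and>
     subst2 (fps_of_poly f) (fps_X ^ degree f) \<phi> = 0 \<and>
     Gcd (insert (degree f) {i. fps_nth \<phi> i \<noteq> 0}) = 1"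

text \<open>Below, a branch is given by a pair \<open>f\<close>, \<open>\<phi>\<close> with \<open>puiseux_param f \<phi>\<close>.\<close>

definition nu :: "complex fps poly \<Rightarrow> complex fps \<Rightarrow> complex fps fps \<Rightarrow> enat" where
  "nu f \<phi> h = ord_t (subst2 h (fps_X ^ degree f) \<phi>)"

definition nu_diff ::
  "complex fps poly \<Rightarrow> complex fps \<Rightarrow> complex fps fps \<Rightarrow> complex fps fps \<Rightarrow> enat" where
  "nu_diff f \<phi> A B = ord_t (fps_X *
     (subst2 A (fps_X ^ degree f) \<phi> * fps_deriv (fps_X ^ degree f) +
      subst2 B (fps_X ^ degree f) \<phi> * fps_deriv \<phi>))"

definition ideal2 :: "complex fps poly \<Rightarrow> complex fps fps set" where
  "ideal2 f = {q * fps_of_poly f | q. q \<in> conv2}"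

definition Gamma_set :: "complex fps poly \<Rightarrow> complex fps \<Rightarrow> nat set" where
  "Gamma_set f \<phi> = {d. \<exists>h \<in> conv2. h \<notin> ideal2 f \<and> nu f \<phi> h = enat d}"

definition Lambda_set :: "complex fps poly \<Rightarrow> complex fps \<Rightarrow> nat set" where
  "Lambda_set f \<phi> = {d. \<exists>A \<in> conv2. \<exists>B \<in> conv2. nu_diff f \<phi> A B = enat d}"

section \<open>Characteristic exponents and semiroots\<close>

text \<open>
  \<open>char_beta f \<phi> i\<close> is \<open>\<beta>\<^sub>i\<close> and \<open>char_e f \<phi> i\<close> is \<open>e\<^sub>i\<close>. The former is meaningful only for
  \<open>i \<le> genus f \<phi>\<close>: afterwards \<open>e\<^sub>i = 1\<close> and the minimum is over the empty set.
\<close>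

fun char_beta :: "complex fps poly \<Rightarrow> complex fps \<Rightarrow> nat \<Rightarrow> nat"
  and char_e :: "complex fps poly \<Rightarrow> complex fps \<Rightarrow> nat \<Rightarrow> nat" where
  "char_beta f \<phi> 0 = degree f"
| "char_beta f \<phi> (Suc i) = (LEAST l. fps_nth \<phi> l \<noteq> 0 \<and> \<not> char_e f \<phi> i dvd l)"
| "char_e f \<phi> 0 = degree f"
| "char_e f \<phi> (Suc i) = gcd (char_e f \<phi> i) (char_beta f \<phi> (Suc i))"

definition genus :: "complex fps poly \<Rightarrow> complex fps \<Rightarrow> nat" where
  "genus f \<phi> = (LEAST i. char_e f \<phi> i = 1)"

definition char_n :: "complex fps poly \<Rightarrow> complex fps \<Rightarrow> nat \<Rightarrow> nat" where
  "char_n f \<phi> i = (if i = 0 then 1 else char_e f \<phi> (i - 1) div char_e f \<phi> i)"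

text \<open>
  The generators \<open>v\<^sub>i\<close> of the value semigroup, for \<open>i \<le> genus f \<phi>\<close>. The subtraction does not
  truncate, since \<open>\<beta>\<^sub>i < \<beta>\<^sub>i\<^sub>+\<^sub>1\<close>.
\<close>

primrec gen_v :: "complex fps poly \<Rightarrow> complex fps \<Rightarrow> nat \<Rightarrow> nat" where
  "gen_v f \<phi> 0 = degree f"
| "gen_v f \<phi> (Suc i) =
     char_n f \<phi> i * gen_v f \<phi> i + char_beta f \<phi> (Suc i) - char_beta f \<phi> i"

definition semiroot :: "complex fps poly \<Rightarrow> complex fps \<Rightarrow> nat \<Rightarrow> complex fps poly \<Rightarrow> bool" where
  "semiroot f \<phi> k fk \<longleftrightarrow> fk \<in> conv1_poly \<and> lead_coeff fk = 1 \<and>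
     degree fk = (\<Prod>i\<le>k. char_n f \<phi> i) \<and>
     nu f \<phi> (fps_of_poly fk) = (if k < genus f \<phi> then enat (gen_v f \<phi> (k + 1)) else \<infinity>)"

section \<open>The sets attached to a semiroot\<close>

text \<open>
  For \<open>\<delta> \<in> Lambda_set f \<phi>\<close> the maximum is attained (it may be \<open>\<infinity>\<close>): if \<open>B\<close> can have arbitrarily
  large value, take \<open>B\<close> with \<open>nu_diff f \<phi> 0 B > enat \<delta>\<close>; then \<open>A dx\<close> already has value \<open>\<delta>\<close>, and
  \<open>B = 0\<close> has value \<open>\<infinity>\<close>.
\<close>

definition Theta :: "complex fps poly \<Rightarrow> complex fps \<Rightarrow> nat \<Rightarrow> enat" where
  "Theta f \<phi> \<delta> = (GREATEST b. \<exists>A \<in> conv2. \<exists>B \<in> conv2.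
     b = nu f \<phi> B \<and> nu_diff f \<phi> A (- B) = enat \<delta>)"

text \<open>
  In the sets \<open>L\<^sup>1\<close>, \<open>L\<^sup>2\<close> and the map \<open>\<rho>\<close>, the pair \<open>f\<close>, \<open>\<phi>\<close> is the ambient branch and \<open>fk\<close>, \<open>\<phi>k\<close>
  that of its \<open>k\<close>-semiroot. In the conditions \<open>e\<^sub>k (\<delta> - \<Theta>) < \<beta>\<^sub>k\<^sub>+\<^sub>1\<close> and \<open>e\<^sub>k (\<delta> - \<Theta>) > \<beta>\<^sub>k\<^sub>+\<^sub>1\<close> the term
  \<open>e\<^sub>k \<Theta>\<close> is moved to the other side, as \<open>\<Theta>\<close> is an extended number.
\<close>

definition L1 :: "complex fps poly \<Rightarrow> complex fps \<Rightarrow> nat \<Rightarrow> complex fps poly \<Rightarrow> complex fps \<Rightarrow> nat set"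
  where "L1 f \<phi> k fk \<phi>k = {\<delta> \<in> Lambda_set fk \<phi>k - Gamma_set fk \<phi>k.
     enat (char_e f \<phi> k * \<delta>) < enat (char_beta f \<phi> (k + 1)) + enat (char_e f \<phi> k) * Theta fk \<phi>k \<delta>}"

definition L2 :: "complex fps poly \<Rightarrow> complex fps \<Rightarrow> nat \<Rightarrow> complex fps poly \<Rightarrow> complex fps \<Rightarrow> nat set"
  where "L2 f \<phi> k fk \<phi>k = {\<delta> \<in> Lambda_set fk \<phi>k - Gamma_set fk \<phi>k.
     enat (char_e f \<phi> k * \<delta>) > enat (char_beta f \<phi> (k + 1)) + enat (char_e f \<phi> k) * Theta fk \<phi>k \<delta>}"

text \<open>On \<open>L\<^sup>2\<close> the value \<open>\<Theta>\<close> is finite, so \<^const>\<open>the_enat\<close> is harmless there.\<close>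

definition rho ::
  "complex fps poly \<Rightarrow> complex fps \<Rightarrow> nat \<Rightarrow> complex fps poly \<Rightarrow> complex fps \<Rightarrow> nat \<Rightarrow> nat" where
  "rho f \<phi> k fk \<phi>k \<delta> = (if \<delta> \<in> L1 f \<phi> k fk \<phi>k then char_e f \<phi> k * \<delta>
     else char_beta f \<phi> (k + 1) + char_e f \<phi> k * the_enat (Theta fk \<phi>k \<delta>))"

definition Tset :: "complex fps poly \<Rightarrow> complex fps \<Rightarrow> int set" where
  "Tset f \<phi> = {int \<alpha> | \<alpha>. \<alpha> > 0 \<and> \<alpha> \<notin> Lambda_set f \<phi>} \<union> {- int \<alpha> | \<alpha>. \<alpha> \<notin> Gamma_set f \<phi>}"

text \<open>Only the entries of \<open>s\<close> with index in \<open>{k + 1..genus f \<phi>}\<close> matter.\<close>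

definition tuples :: "complex fps poly \<Rightarrow> complex fps \<Rightarrow> nat \<Rightarrow> (nat \<Rightarrow> int) set" where
  "tuples f \<phi> k = {s. 0 \<le> s (k + 1) \<and> s (k + 1) \<le> int (char_n f \<phi> (k + 1)) - 2 \<and>
     (\<forall>i \<in> {k + 2..genus f \<phi>}. 0 \<le> s i \<and> s i < int (char_n f \<phi> i))}"

end

theory Submission
  imports Defs
begin

text \<open>
  Write \<open>e = e\<^sub>k\<close>, \<open>N = n/e = deg f\<^sub>k\<close>, \<open>\<beta> = \<beta>\<^sub>k\<^sub>+\<^sub>1\<close>, and let \<open>D\<close> be the value of \<open>\<partial>f\<^sub>k/\<partial>y\<close> on \<open>C\<^sub>k\<close>. A
  differential \<open>A dx - B dy\<close> enters only through the series \<open>A n t\<^sup>n - B t\<phi>'\<close>, its pullback divided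
  by \<open>dt/t\<close> (\<open>euler_form\<close> below). Values that are finite depend on finitely many coefficients, and
  \<open>f\<^sub>k\<close> is monic in \<open>y\<close>; hence power series in two variables may be replaced by polynomials in \<open>y\<close>
  of degree below \<open>N\<close> with coefficients in \<open>\<complex>[[x]]\<close>, and questions of convergence disappear.

  First, \<open>C\<^sub>k\<close> is close to \<open>C\<^sub>f\<close>. The value \<open>\<nu>\<^sub>f(f\<^sub>k) = v\<^sub>k\<^sub>+\<^sub>1\<close> is a sum, over the \<open>N\<close>-th roots of unity
  \<open>\<zeta>\<close>, of the orders of \<open>\<phi>(t) - \<phi>\<^sub>k(\<zeta>t\<^sup>e)\<close>. Counting the conjugates by the level sets of this order
  shows that the largest order is \<open>\<beta>\<close>. After rotating \<open>\<phi>\<^sub>k\<close> the series \<open>\<phi>(t)\<close> and \<open>\<phi>\<^sub>k(t\<^sup>e)\<close>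
  therefore agree up to order \<open>\<beta>\<close> exactly (\<open>contact_of_semiroot\<close>), and moreover \<open>v\<^sub>k\<^sub>+\<^sub>1 = \<beta> + e D\<close>.

  Values on the two branches can then be compared. A polynomial of degree below \<open>N\<close> is determined
  by its values at the \<open>N\<close> conjugates of \<open>\<phi>\<^sub>k(t\<^sup>e)\<close>. Lagrange interpolation writes the value of a
  differential on \<open>C\<^sub>f\<close> as one sum of order \<open>e\<nu>\<^sub>k(\<omega>)\<close> and another one of order \<open>\<beta> + e\<nu>\<^sub>k(B)\<close>. So
  \<open>\<nu>\<^sub>f(\<omega>)\<close> is the smaller of the two numbers when they differ (\<open>form_value_small\<close>,
  \<open>form_value_large\<close>). The point is that the leading coefficient of the second sum does not
  vanish: up to a factor it is \<open>\<beta> + \<Sum> o(\<zeta>)\<zeta>\<^sup>w\<close>, with \<open>o(\<zeta>) < \<beta>\<close> the orders of the differences of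
  conjugates. As the sets \<open>o(\<zeta>) \<ge> j\<close> are groups, sums of a character over them are nonnegative,
  and the sum over \<open>\<zeta>\<close> is at least \<open>1 - \<beta>\<close>.

  Forms with prescribed values come from duality. For every integer \<open>\<delta>\<close> that is not the value of a
  differential on \<open>C\<^sub>k\<close> there is an \<open>A dx - B dy\<close> which vanishes on \<open>C\<^sub>k\<close> and has \<open>\<nu>\<^sub>k(B) = D - \<delta>\<close>
  (\<open>dual_form\<close>). This is the self-duality of the ring of \<open>C\<^sub>k\<close> under the residue pairing, made
  explicit with Euler's formula for the traces of \<open>y\<^sup>i/(\<partial>f\<^sub>k/\<partial>y)\<close>.

  To combine these facts, recall that every integer is in exactly one way \<open>\<Sum> s\<^sub>i v\<^sub>i + e z\<close> with
  \<open>0 \<le> s\<^sub>i < n\<^sub>i\<close> for \<open>i > k\<close>, and it lies in \<open>\<Gamma>\<^sub>f\<close> only if \<open>z\<close> lies in \<open>\<Gamma>\<^sub>k\<close>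
  (\<open>representation_unique\<close>, \<open>value_expansion\<close>). In these coordinates the first set has \<open>s = 0\<close> and
  \<open>z = \<delta>\<close>, while in the other two \<open>s\<^sub>k\<^sub>+\<^sub>1\<close> grows by one and \<open>z\<close> is \<open>\<Theta>\<^sub>k(\<delta>) - D\<close> and \<open>-\<delta>\<close>
  respectively. The comparison of values, the forms given by duality, and products with powers of
  semiroots realize all these numbers as values of differentials. The first and the third set
  avoid \<open>\<Gamma>\<^sub>f\<close> since \<open>z\<close> is not in \<open>\<Gamma>\<^sub>k\<close>. The second set avoids \<open>\<Gamma>\<^sub>f\<close> and the third set because
  otherwise duality would give a form vanishing on \<open>C\<^sub>k\<close> with \<open>\<nu>\<^sub>k(B) = \<Theta>\<^sub>k(\<delta>)\<close>, and subtracting a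
  multiple of it would increase \<open>\<Theta>\<^sub>k(\<delta>)\<close> (\<open>Theta_not_annihilating\<close>).
\<close>

unbundle no vec_syntax

section \<open>Evaluation along a parametrized branch\<close>

definition subst_coeffs :: "complex fps \<Rightarrow> complex fps poly \<Rightarrow> complex fps poly" where
  "subst_coeffs \<sigma> p = map_poly (\<lambda>c. c oo \<sigma>) p"

lemma coeff_subst_coeffs [simp]: "coeff (subst_coeffs \<sigma> p) i = coeff p i oo \<sigma>"
  by (simp add: subst_coeffs_def coeff_map_poly)

lemma subst_coeffs_0 [simp]: "subst_coeffs \<sigma> 0 = 0"
  by (simp add: poly_eq_iff)

lemma subst_coeffs_1 [simp]: "subst_coeffs \<sigma> 1 = 1"
  by (simp add: poly_eq_iff)

lemma subst_coeffs_pCons [simp]: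
  "subst_coeffs \<sigma> (pCons a p) = pCons (a oo \<sigma>) (subst_coeffs \<sigma> p)"
  by (simp add: subst_coeffs_def map_poly_pCons)

lemma subst_coeffs_add: "subst_coeffs \<sigma> (p + q) = subst_coeffs \<sigma> p + subst_coeffs \<sigma> q"
  by (simp add: poly_eq_iff fps_compose_add_distrib)

lemma subst_coeffs_diff: "subst_coeffs \<sigma> (p - q) = subst_coeffs \<sigma> p - subst_coeffs \<sigma> q"
  by (simp add: poly_eq_iff fps_compose_sub_distrib)

lemma subst_coeffs_smult:
  "\<sigma> $ 0 = 0 \<Longrightarrow> subst_coeffs \<sigma> (smult c p) = smult (c oo \<sigma>) (subst_coeffs \<sigma> p)"
  by (simp add: poly_eq_iff fps_compose_mult_distrib)

lemma subst_coeffs_mult: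
  assumes "\<sigma> $ 0 = 0"
  shows "subst_coeffs \<sigma> (p * q) = subst_coeffs \<sigma> p * subst_coeffs \<sigma> q"
  by (induction p) (simp_all add: subst_coeffs_add subst_coeffs_smult[OF assms])

lemma subst_coeffs_pderiv: 
  assumes "\<sigma> $ 0 = 0"
  shows "subst_coeffs \<sigma> (pderiv p) = pderiv (subst_coeffs \<sigma> p)"
proof -
  have "of_nat m oo \<sigma> = of_nat m" for m
    by (metis fps_const_compose fps_of_nat)
  thus ?thesis
    by (simp add: poly_eq_iff coeff_pderiv fps_compose_mult_distrib[OF assms] fps_compose_add_distrib
      del: of_nat_Suc)
qed

lemma degree_subst_coeffs_le: "degree (subst_coeffs \<sigma> p) \<le> degree p"
  by (intro degree_le) (simp add: coeff_eq_0)

lemma degree_subst_coeffs_monic: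
  assumes "lead_coeff p = 1"
  shows "degree (subst_coeffs \<sigma> p) = degree p" "lead_coeff (subst_coeffs \<sigma> p) = 1"
proof -
  have "coeff (subst_coeffs \<sigma> p) (degree p) = 1"
    using assms by simp
  then show "degree (subst_coeffs \<sigma> p) = degree p"
    by (metis degree_subst_coeffs_le le_antisym le_degree one_neq_zero)
  then show "lead_coeff (subst_coeffs \<sigma> p) = 1"
    using assms by simp
qed

text \<open>
  Reparametrization: replacing \<open>t\<close> by \<open>\<sigma>(t)\<close> in the value of a polynomial at \<open>(\<tau>, y)\<close>.
\<close>

lemma poly_subst_coeffs_compose:
  assumes "\<sigma> $ 0 = 0" "\<tau> $ 0 = 0"
  shows "poly (subst_coeffs \<tau> p) y oo \<sigma> = poly (subst_coeffs (\<tau> oo \<sigma>) p) (y oo \<sigma>)"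
  by (induction p)
     (simp_all add: fps_compose_add_distrib fps_compose_mult_distrib assms fps_compose_assoc)

text \<open>
  The series \<open>p(t\<^sup>n, \<phi>(t))\<close> for a polynomial \<open>p\<close> in \<open>y\<close> over \<open>\<complex>[[x]]\<close>.
\<close>

definition on_branch :: "nat \<Rightarrow> complex fps \<Rightarrow> complex fps poly \<Rightarrow> complex fps" where
  "on_branch n \<phi> p = poly (subst_coeffs (fps_X ^ n) p) \<phi>"

lemma on_branch_0 [simp]: "on_branch n \<phi> 0 = 0" and on_branch_1 [simp]: "on_branch n \<phi> 1 = 1"
  by (simp_all add: on_branch_def)

lemma on_branch_add: "on_branch n \<phi> (p + q) = on_branch n \<phi> p + on_branch n \<phi> q"
  by (simp add: on_branch_def subst_coeffs_add)

lemma on_branch_diff: "on_branch n \<phi> (p - q) = on_branch n \<phi> p - on_branch n \<phi> q"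
  by (simp add: on_branch_def subst_coeffs_diff)

lemma on_branch_mult: "n > 0 \<Longrightarrow> on_branch n \<phi> (p * q) = on_branch n \<phi> p * on_branch n \<phi> q"
  by (simp add: on_branch_def subst_coeffs_mult)

lemma on_branch_power: "n > 0 \<Longrightarrow> on_branch n \<phi> (p ^ k) = on_branch n \<phi> p ^ k"
  by (induction k) (simp_all add: on_branch_mult)

lemma on_branch_prod: "n > 0 \<Longrightarrow> on_branch n \<phi> (prod p S) = (\<Prod>i\<in>S. on_branch n \<phi> (p i))"
  by (induction S rule: infinite_finite_induct) (simp_all add: on_branch_mult)

lemma on_branch_smult: "n > 0 \<Longrightarrow> on_branch n \<phi> (smult c p) = (c oo fps_X ^ n) * on_branch n \<phi> p"
  by (simp add: on_branch_def subst_coeffs_smult)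

lemma division_by_monic:
  fixes p f :: "'a::idom poly"
  assumes "lead_coeff f = 1" "degree f > 0"
  obtains q r where "p = q * f + r" "degree r < degree f"
proof -
  obtain q r where qr: "pseudo_divmod p f = (q, r)" by force
  have "f \<noteq> 0" using assms by auto
  from pseudo_divmod[OF this qr] assms have "p = f * q + r" "r = 0 \<or> degree r < degree f"
    by simp_all
  thus ?thesis using that[of q r] assms(2) by (auto simp: mult.commute)
qed

text \<open>
  The differential \<open>A dx - B dy\<close> pulled back to the branch and divided by \<open>dt/t\<close>. The minus sign
  is the one in the definition of \<open>\<Theta>\<close>.
\<close>

definition euler_form ::
  "nat \<Rightarrow> complex fps \<Rightarrow> complex fps poly \<Rightarrow> complex fps poly \<Rightarrow> complex fps" where
  "euler_form n \<phi> A B =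
     fps_const (of_nat n) * fps_X ^ n * on_branch n \<phi> A - on_branch n \<phi> B * (fps_X * fps_deriv \<phi>)"

section \<open>Reduction of power series to polynomials\<close>

lemma power_mult_nth_eq_0:
  fixes Y :: "complex fps"
  assumes "Y $ 0 = 0" "N < j"
  shows "(a * Y ^ j) $ N = 0"
  using assms startsby_zero_power_prefix[of Y j]
  by (auto simp: fps_mult_nth intro!: sum.neutral)

lemma subst2_nth:
  assumes "Y $ 0 = 0" "N \<le> K"
  shows "subst2 h X Y $ N = (\<Sum>j\<le>K. ((h $ j oo X) * Y ^ j) $ N)"
proof -
  have "(\<Sum>j\<le>N. ((h $ j oo X) * Y ^ j) $ N) = (\<Sum>j\<le>K. ((h $ j oo X) * Y ^ j) $ N)"
    using assms by (intro sum.mono_neutral_left) (auto intro!: power_mult_nth_eq_0)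
  thus ?thesis by (simp add: subst2_def)
qed

text \<open>
  Since \<open>x\<close> and \<open>y\<close> have positive order on the branch, the terms of \<open>h(X(t), Y(t))\<close> up to order
  \<open>K\<close> only see the coefficients of \<open>h\<close> with both indices at most \<open>K\<close>. This is what permits to
  truncate.
\<close>

lemma subst2_cong_upto:
  assumes "X $ 0 = 0" "Y $ 0 = 0"
    and "\<And>j i. j \<le> K \<Longrightarrow> i \<le> K \<Longrightarrow> h $ j $ i = g $ j $ i" and "N \<le> K"
  shows "subst2 h X Y $ N = subst2 g X Y $ N"
proof -
  have "((h $ j oo X) * Y ^ j) $ N = ((g $ j oo X) * Y ^ j) $ N" if "j \<le> K" for j
    using that assms(3,4) by (simp add: fps_mult_nth fps_compose_nth)
  thus ?thesis using assms by (simp add: subst2_nth[OF assms(2,4)])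
qed

lemma subst2_fps_of_poly:
  assumes "\<phi> $ 0 = 0"
  shows "subst2 (fps_of_poly p) (fps_X ^ n) \<phi> = on_branch n \<phi> p"
proof (rule fps_ext)
  fix N
  define K where "K = max N (degree p)"
  have "on_branch n \<phi> p = (\<Sum>j\<le>K. coeff (subst_coeffs (fps_X ^ n) p) j * \<phi> ^ j)"
    unfolding on_branch_def poly_altdef using degree_subst_coeffs_le[of "fps_X ^ n" p]
    by (intro sum.mono_neutral_left) (auto simp: K_def coeff_eq_0 simp del: coeff_subst_coeffs)
  thus "subst2 (fps_of_poly p) (fps_X ^ n) \<phi> $ N = on_branch n \<phi> p $ N"
    by (subst subst2_nth[OF assms, of _ K]) (simp_all add: K_def fps_sum_nth)
qed

definition truncate_poly :: "nat \<Rightarrow> complex fps fps \<Rightarrow> complex fps poly" where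
  "truncate_poly K h = (\<Sum>j\<le>K. monom (fps_cutoff (Suc K) (h $ j)) j)"

lemma coeff_truncate_poly:
  "coeff (truncate_poly K h) j = (if j \<le> K then fps_cutoff (Suc K) (h $ j) else 0)"
  by (auto simp: truncate_poly_def coeff_sum sum.delta)

lemma truncate_poly_zero [simp]: "truncate_poly K 0 = 0"
  by (simp add: poly_eq_iff coeff_truncate_poly fps_eq_iff)

lemma truncate_poly_conv2: "fps_of_poly (truncate_poly K h) \<in> conv2"
proof -
  have "(\<lambda>(i, j). norm (fps_of_poly (truncate_poly K h) $ j $ i) * 1 ^ (i + j)) summable_on UNIV"
    by (rule summable_on_cong_neutral[THEN iffD1, OF _ _ _ summable_on_finite[of "{..K} \<times> {..K}"]])
       (auto simp: coeff_truncate_poly split: if_splits)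
  thus ?thesis unfolding conv2_def by (auto intro!: exI[of _ 1])
qed

lemma subst2_truncate:
  assumes "\<phi> $ 0 = 0" "n > 0" "N \<le> K"
  shows "on_branch n \<phi> (truncate_poly K h) $ N = subst2 h (fps_X ^ n) \<phi> $ N"
  unfolding subst2_fps_of_poly[OF assms(1), symmetric] using assms
  by (intro subst2_cong_upto[of _ _ K]) (simp_all add: coeff_truncate_poly)

text \<open>
  Multiplicativity is inherited, one coefficient at a time, from the truncations, which are
  polynomials.
\<close>

lemma subst2_mult:
  assumes "\<phi> $ 0 = 0" "n > 0"
  shows "subst2 (h * g) (fps_X ^ n) \<phi> = subst2 h (fps_X ^ n) \<phi> * subst2 g (fps_X ^ n) \<phi>"
proof (rule fps_ext)
  fix N
  let ?T = "truncate_poly N"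
  have "subst2 (h * g) (fps_X ^ n) \<phi> $ N
      = subst2 (fps_of_poly (?T h * ?T g)) (fps_X ^ n) \<phi> $ N"
  proof (intro subst2_cong_upto[of _ _ N])
    fix j i assume "j \<le> N" "i \<le> N"
    thus "(h * g) $ j $ i = fps_of_poly (?T h * ?T g) $ j $ i"
      by (auto simp: fps_of_poly_mult fps_mult_nth fps_sum_nth coeff_truncate_poly
          intro!: sum.cong)
  qed (use assms in auto)
  also have "\<dots> = (on_branch n \<phi> (?T h) * on_branch n \<phi> (?T g)) $ N"
    using assms by (simp add: subst2_fps_of_poly on_branch_mult)
  also have "\<dots> = (subst2 h (fps_X ^ n) \<phi> * subst2 g (fps_X ^ n) \<phi>) $ N"
    using assms by (simp add: fps_mult_nth subst2_truncate)
  finally show "subst2 (h * g) (fps_X ^ n) \<phi> $ N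
      = (subst2 h (fps_X ^ n) \<phi> * subst2 g (fps_X ^ n) \<phi>) $ N" .
qed

lemma ord_t_eq_enat: "ord_t a = enat d \<longleftrightarrow> a \<noteq> 0 \<and> subdegree a = d"
  by (auto simp: ord_t_def)

lemma ord_t_cong_upto:
  assumes "ord_t a = enat d" "\<And>i. i \<le> d \<Longrightarrow> b $ i = a $ i"
  shows "ord_t b = enat d"
proof -
  have "a $ d \<noteq> 0" "\<And>i. i < d \<Longrightarrow> a $ i = 0"
    using assms(1) by (auto simp: ord_t_eq_enat)
  thus ?thesis unfolding ord_t_eq_enat using assms(2)
    by (intro conjI subdegreeI) (auto intro: fps_nonzeroI)
qed

lemma nu_diff_eq:
  assumes "degree f > 0"
  shows "nu_diff f \<phi> A B = ord_t (fps_const (of_nat (degree f)) * fps_X ^ degree f *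
     subst2 A (fps_X ^ degree f) \<phi> + subst2 B (fps_X ^ degree f) \<phi> * (fps_X * fps_deriv \<phi>))"
proof -
  have "fps_X * fps_deriv (fps_X ^ degree f) =
      fps_const (of_nat (degree f)) * (fps_X ^ degree f :: complex fps)"
  proof -
    obtain d where d: "degree f = Suc d" using assms gr0_conv_Suc by blast
    have "fps_deriv (fps_X ^ Suc d) = fps_const (of_nat (Suc d)) * (fps_X ^ d :: complex fps)"
      using fps_deriv_power[of fps_X "Suc d"] by (simp only: fps_deriv_fps_X diff_Suc_1 mult_1_right)
    thus ?thesis
      using mult.left_commute[of fps_X "fps_const (of_nat (Suc d))" "fps_X ^ d :: complex fps"]
      unfolding d power_Suc by simp
  qed
  moreover have "fps_X * (a * D + b * p) = (fps_X * D) * a + b * (fps_X * p)"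
    for a b p D :: "complex fps"
    by (simp add: algebra_simps)
  ultimately show ?thesis unfolding nu_diff_def by (simp only:)
qed

lemma subst2_uminus: "subst2 (- B) X Y = - subst2 B X Y"
  by (rule fps_ext) (simp add: subst2_def fps_compose_uminus sum_negf)

lemma nu_fps_of_poly: "\<phi> $ 0 = 0 \<Longrightarrow> nu f \<phi> (fps_of_poly p) = ord_t (on_branch (degree f) \<phi> p)"
  by (simp add: nu_def subst2_fps_of_poly)

lemma nu_diff_fps_of_poly:
  assumes "\<phi> $ 0 = 0" "degree f > 0"
  shows "nu_diff f \<phi> (fps_of_poly A) (- fps_of_poly B) = ord_t (euler_form (degree f) \<phi> A B)"
  by (simp add: nu_diff_eq[OF assms(2)] subst2_uminus subst2_fps_of_poly[OF assms(1)] euler_form_def)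

lemma euler_form_truncate:
  assumes "\<phi> $ 0 = 0" "degree f > 0" "nu_diff f \<phi> A (- B) = enat d" "d \<le> K" "d \<le> L"
  shows "ord_t (euler_form (degree f) \<phi> (truncate_poly K A) (truncate_poly L B)) = enat d"
proof (rule ord_t_cong_upto)
  show "ord_t (fps_const (of_nat (degree f)) * fps_X ^ degree f * subst2 A (fps_X ^ degree f) \<phi> -
          subst2 B (fps_X ^ degree f) \<phi> * (fps_X * fps_deriv \<phi>)) = enat d"
    using assms(3) by (simp add: nu_diff_eq[OF assms(2)] subst2_uminus)
  fix i assume "i \<le> d"
  thus "euler_form (degree f) \<phi> (truncate_poly K A) (truncate_poly L B) $ i =
     (fps_const (of_nat (degree f)) * fps_X ^ degree f * subst2 A (fps_X ^ degree f) \<phi> -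
          subst2 B (fps_X ^ degree f) \<phi> * (fps_X * fps_deriv \<phi>)) $ i"
    using assms unfolding euler_form_def
    by (simp add: fps_mult_nth[of "_ * _"] fps_mult_nth[of "on_branch _ _ _"] fps_mult_nth[of "subst2 _ _ _"] subst2_truncate)
qed

lemma nu_truncate:
  assumes "\<phi> $ 0 = 0" "degree f > 0" "nu f \<phi> B = enat d" "d \<le> K"
  shows "ord_t (on_branch (degree f) \<phi> (truncate_poly K B)) = enat d"
  using assms by (intro ord_t_cong_upto[OF assms(3)[unfolded nu_def]]) (simp add: subst2_truncate)

lemma on_branch_mod: "n > 0 \<Longrightarrow> on_branch n \<phi> f = 0 \<Longrightarrow> on_branch n \<phi> (q * f + r) = on_branch n \<phi> r"
  by (simp add: on_branch_add on_branch_mult)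

lemma reduced_representative:
  assumes "lead_coeff f = 1" "degree f > 0" "on_branch (degree f) \<phi> f = 0"
  obtains r where "degree r < degree f" "on_branch (degree f) \<phi> r = on_branch (degree f) \<phi> p"
  using division_by_monic[OF assms(1,2), of p] on_branch_mod[OF assms(2,3)] by metis

text \<open>
  Truncation keeps a finite value; reduction modulo \<open>f\<close> changes nothing on the branch. When \<open>B\<close>
  vanishes on the branch its truncations need not, so then \<open>B\<close> is replaced by zero.
\<close>

lemma diff_pair_to_poly:
  assumes "lead_coeff f = 1" "degree f > 0" "on_branch (degree f) \<phi> f = 0" "\<phi> $ 0 = 0"
    and "nu_diff f \<phi> A (- B) = enat d"
  obtains P Q where "degree P < degree f" "degree Q < degree f"
    "ord_t (euler_form (degree f) \<phi> P Q) = enat d" "ord_t (on_branch (degree f) \<phi> Q) = nu f \<phi> B"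
proof -
  have "\<exists>P Q. ord_t (euler_form (degree f) \<phi> P Q) = enat d \<and> ord_t (on_branch (degree f) \<phi> Q) = nu f \<phi> B"
  proof (cases "nu f \<phi> B")
    case (enat b)
    thus ?thesis
      using euler_form_truncate[OF assms(4,2,5), of d "max d b"] nu_truncate[OF assms(4,2) enat, of "max d b"]
      by auto
  next
    case infinity
    hence "subst2 B (fps_X ^ degree f) \<phi> = 0"
      by (simp add: nu_def ord_t_def split: if_splits)
    moreover have "subst2 0 (fps_X ^ degree f) \<phi> = 0"
      by (rule fps_ext) (simp add: subst2_def)
    ultimately have "nu_diff f \<phi> A (- 0) = enat d"
      using assms(5) by (simp add: nu_diff_eq[OF assms(2)] subst2_uminus)
    from euler_form_truncate[OF assms(4,2) this order_refl order_refl] infinity show ?thesis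
      by (intro exI[of _ "truncate_poly d A"] exI[of _ 0]) (simp add: truncate_poly_zero ord_t_def[of 0])
  qed
  then obtain P Q where PQ: "ord_t (euler_form (degree f) \<phi> P Q) = enat d"
    "ord_t (on_branch (degree f) \<phi> Q) = nu f \<phi> B" by blast
  obtain P' where P': "degree P' < degree f" "on_branch (degree f) \<phi> P' = on_branch (degree f) \<phi> P"
    using reduced_representative[OF assms(1-3)] by blast
  obtain Q' where Q': "degree Q' < degree f" "on_branch (degree f) \<phi> Q' = on_branch (degree f) \<phi> Q"
    using reduced_representative[OF assms(1-3)] by blast
  show ?thesis using that[OF P'(1) Q'(1)] PQ P' Q' by (simp add: euler_form_def)
qed

text \<open>
  The converse: the polynomials may have divergent coefficients, so they are truncated as well.
\<close>

lemma diff_pair_of_poly: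
  assumes "degree f > 0" "\<phi> $ 0 = 0" "ord_t (euler_form (degree f) \<phi> P Q) = enat d"
  obtains A B where "A \<in> conv2" "B \<in> conv2" "nu_diff f \<phi> A (- B) = enat d"
    "nu f \<phi> B = ord_t (on_branch (degree f) \<phi> Q)"
proof (cases "ord_t (on_branch (degree f) \<phi> Q)")
  case (enat b)
  let ?A = "truncate_poly d (fps_of_poly P)" and ?B = "truncate_poly (max d b) (fps_of_poly Q)"
  have "ord_t (euler_form (degree f) \<phi> ?A ?B) = enat d"
    using assms by (intro euler_form_truncate) (simp_all add: nu_diff_fps_of_poly)
  moreover have "ord_t (on_branch (degree f) \<phi> ?B) = enat b"
    using assms enat by (intro nu_truncate) (simp_all add: nu_fps_of_poly)
  ultimately show ?thesis
    using that[of "fps_of_poly ?A" "fps_of_poly ?B"] assms enat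
    by (simp add: nu_diff_fps_of_poly nu_fps_of_poly truncate_poly_conv2)
next
  case infinity
  hence Q0: "on_branch (degree f) \<phi> Q = 0" by (simp add: ord_t_def split: if_splits)
  let ?A = "truncate_poly d (fps_of_poly P)"
  have "ord_t (euler_form (degree f) \<phi> P 0) = enat d"
    using assms(3) Q0 by (simp add: euler_form_def)
  hence "ord_t (euler_form (degree f) \<phi> ?A (truncate_poly d (fps_of_poly 0))) = enat d"
    using assms nu_diff_fps_of_poly[of \<phi> f P 0] by (intro euler_form_truncate) simp_all
  also have "truncate_poly d (fps_of_poly 0) = 0"
    by (simp add: truncate_poly_zero)
  finally show ?thesis
    using that[of "fps_of_poly ?A" "fps_of_poly 0"] assms infinity truncate_poly_conv2[of d]
      truncate_poly_conv2[of d 0]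
    by (simp only: nu_diff_fps_of_poly nu_fps_of_poly truncate_poly_zero on_branch_0 ord_t_def simp_thms if_True)
qed

lemma Lambda_set_of_poly:
  assumes "degree f > 0" "\<phi> $ 0 = 0" 
    and "euler_form (degree f) \<phi> P Q \<noteq> 0"
  shows "subdegree (euler_form (degree f) \<phi> P Q) \<in> Lambda_set f \<phi>"
proof -
  from assms(3) have "ord_t (euler_form (degree f) \<phi> P Q) = enat (subdegree (euler_form (degree f) \<phi> P Q))"
    by (simp add: ord_t_def)
  from diff_pair_of_poly[OF assms(1,2) this] obtain A B where "A \<in> conv2" "B \<in> conv2"
    "nu_diff f \<phi> A (- B) = enat (subdegree (euler_form (degree f) \<phi> P Q))"
    by metis
  moreover have "- B \<in> conv2" using \<open>B \<in> conv2\<close> by (simp add: conv2_def)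
  ultimately show ?thesis by (auto simp: Lambda_set_def)
qed

lemma Gamma_set_of_poly:
  assumes "degree f > 0" "\<phi> $ 0 = 0" "on_branch (degree f) \<phi> f = 0" 
    and "on_branch (degree f) \<phi> p \<noteq> 0"
  shows "subdegree (on_branch (degree f) \<phi> p) \<in> Gamma_set f \<phi>"
proof -
  let ?d = "subdegree (on_branch (degree f) \<phi> p)"
  let ?h = "fps_of_poly (truncate_poly ?d (fps_of_poly p))"
  have "ord_t (on_branch (degree f) \<phi> (truncate_poly ?d (fps_of_poly p))) = enat ?d"
    using assms by (intro nu_truncate) (simp_all add: nu_fps_of_poly ord_t_def)
  hence *: "nu f \<phi> ?h = enat ?d"
    by (simp add: nu_fps_of_poly assms)
  have "?h \<notin> ideal2 f"
  proof
    assume "?h \<in> ideal2 f"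
    then obtain q where "?h = q * fps_of_poly f" by (auto simp: ideal2_def)
    hence "subst2 ?h (fps_X ^ degree f) \<phi> = 0"
      using assms by (simp add: subst2_mult subst2_fps_of_poly)
    thus False using * by (simp add: nu_def ord_t_def)
  qed
  thus ?thesis using * truncate_poly_conv2 by (auto simp: Gamma_set_def)
qed

lemma Gamma_set_to_poly:
  assumes "lead_coeff f = 1" "degree f > 0" "on_branch (degree f) \<phi> f = 0" "\<phi> $ 0 = 0"
    and "d \<in> Gamma_set f \<phi>"
  obtains p where "degree p < degree f" "on_branch (degree f) \<phi> p \<noteq> 0" "subdegree (on_branch (degree f) \<phi> p) = d"
proof -
  from assms(5) obtain h where "nu f \<phi> h = enat d" by (auto simp: Gamma_set_def)
  from nu_truncate[OF assms(4,2) this order_refl]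
  have "ord_t (on_branch (degree f) \<phi> (truncate_poly d h)) = enat d" .
  moreover obtain r where "degree r < degree f"
    "on_branch (degree f) \<phi> r = on_branch (degree f) \<phi> (truncate_poly d h)"
    using reduced_representative[OF assms(1-3)] by blast
  ultimately show ?thesis using that[of r] by (auto simp: ord_t_eq_enat)
qed

section \<open>Roots of unity and conjugate parametrizations\<close>

definition mu :: "nat \<Rightarrow> complex set" where
  "mu N = {z. z ^ N = 1}"

lemma finite_mu [simp]: "N > 0 \<Longrightarrow> finite (mu N)"
  by (simp add: mu_def finite_roots_unity)

lemma card_mu [simp]: "N > 0 \<Longrightarrow> card (mu N) = N"
  by (simp add: mu_def card_roots_unity_eq)

lemma one_in_mu [simp]: "1 \<in> mu N"
  by (simp add: mu_def)

lemma mu_nonzero: "z \<in> mu N \<Longrightarrow> N > 0 \<Longrightarrow> z \<noteq> 0"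
  by (auto simp: mu_def power_0_left)

text \<open>
  The exponents that kill \<open>z\<close> are the multiples of its order.
\<close>

lemma power_Gcd_eq_1_iff:
  fixes z :: complex
  assumes "N > 0"
  shows "z ^ Gcd (insert N S) = 1 \<longleftrightarrow> z ^ N = 1 \<and> (\<forall>i\<in>S. z ^ i = 1)"
proof
  assume z: "z ^ Gcd (insert N S) = 1"
  have "z ^ i = 1" if "i \<in> insert N S" for i
    using Gcd_dvd_nat[OF that] z by (auto simp: power_mult elim!: dvdE)
  thus "z ^ N = 1 \<and> (\<forall>i\<in>S. z ^ i = 1)" by auto
next
  assume z: "z ^ N = 1 \<and> (\<forall>i\<in>S. z ^ i = 1)"
  \<comment> \<open>The order of \<open>z\<close>.\<close>
  define d where "d = (LEAST d. d > 0 \<and> z ^ d = 1)"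
  have d: "d > 0" "z ^ d = 1"
    using LeastI[of "\<lambda>d. d > 0 \<and> z ^ d = 1" N] assms z by (auto simp: d_def)
  have "d dvd i" if "z ^ i = 1" for i
  proof -
    have "z ^ i = (z ^ d) ^ (i div d) * z ^ (i mod d)"
      by (simp flip: power_mult power_add)
    hence "z ^ (i mod d) = 1" using that d by simp
    moreover have "i mod d < d" using d by simp
    ultimately have "i mod d = 0"
      using not_less_Least[of "i mod d" "\<lambda>d. d > 0 \<and> z ^ d = 1"] unfolding d_def by (metis gr0I)
    thus ?thesis by auto
  qed
  hence "d dvd Gcd (insert N S)" using z by (intro Gcd_greatest) auto
  then obtain k where "Gcd (insert N S) = d * k" by (elim dvdE)
  thus "z ^ Gcd (insert N S) = 1" using d by (simp only: power_mult power_one)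
qed

text \<open>
  Multiplication by an element of \<open>G\<close> on which \<open>\<chi>\<close> is not trivial permutes \<open>G\<close> and multiplies the
  sum by a factor different from one.
\<close>

lemma character_sum:
  fixes G :: "complex set" and \<chi> :: "complex \<Rightarrow> complex"
  assumes "finite G" "0 \<notin> G" "\<And>a b. a \<in> G \<Longrightarrow> b \<in> G \<Longrightarrow> a * b \<in> G"
    and "\<And>a b. a \<in> G \<Longrightarrow> b \<in> G \<Longrightarrow> \<chi> (a * b) = \<chi> a * \<chi> b"
  shows "(\<Sum>z\<in>G. \<chi> z) = (if \<forall>g\<in>G. \<chi> g = 1 then of_nat (card G) else 0)"
proof (cases "\<forall>g\<in>G. \<chi> g = 1")
  case False
  then obtain g where g: "g \<in> G" "\<chi> g \<noteq> 1" by blast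
  have inj: "inj_on ((*) g) G" using g assms(2) by (auto simp: inj_on_def)
  \<comment> \<open>Multiplication by \<open>g\<close> is injective on the finite set \<open>G\<close>.\<close>
  have "(*) g ` G = G"
    using assms g inj by (intro card_subset_eq) (auto simp: card_image)
  hence "(\<Sum>z\<in>G. \<chi> z) = (\<Sum>z\<in>G. \<chi> (g * z))"
    using sum.reindex[OF inj, of \<chi>] by (simp add: o_def)
  also have "\<dots> = \<chi> g * (\<Sum>z\<in>G. \<chi> z)"
    using assms(4) g by (simp add: sum_distrib_left)
  finally have "(\<Sum>z\<in>G. \<chi> z) = 0" using g by simp
  thus ?thesis using False by (simp only: if_False)
qed simp

text \<open>
  The substitution \<open>t \<mapsto> \<zeta>t\<^sup>e\<close>. It carries a parametrization of \<open>C\<^sub>k\<close> to the common parameter \<open>t\<close> of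
  \<open>C\<^sub>f\<close> and, as \<open>\<zeta>\<close> runs through the \<open>N\<close>-th roots of unity, to all its conjugates.
\<close>

definition twist :: "complex \<Rightarrow> nat \<Rightarrow> complex fps" where
  "twist \<zeta> e = fps_const \<zeta> * fps_X ^ e"

lemma twist_nth_0 [simp]: "e > 0 \<Longrightarrow> twist \<zeta> e $ 0 = 0"
  by (simp add: twist_def)

lemma nth_compose_twist:
  assumes "e > 0"
  shows "(a oo twist \<zeta> e) $ l = (if e dvd l then \<zeta> ^ (l div e) * a $ (l div e) else 0)"
proof -
  have "twist \<zeta> e = (fps_const \<zeta> * fps_X) oo fps_X ^ e"
    using assms by (simp add: twist_def fps_compose_mult_distrib)
  moreover have "a oo ((fps_const \<zeta> * fps_X) oo fps_X ^ e) = (a oo (fps_const \<zeta> * fps_X)) oo fps_X ^ e"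
    using assms by (subst fps_compose_assoc) simp_all
  ultimately show ?thesis
    by (simp add: fps_nth_compose_X_power fps_compose_linear)
qed

lemma compose_twist_mult:
  assumes "e > 0"
  shows "(a oo twist \<zeta> 1) oo twist \<eta> e = a oo twist (\<zeta> * \<eta>) e"
  by (rule fps_ext) (auto simp: nth_compose_twist assms power_mult_distrib)

lemma compose_twist_eq_0_iff [simp]:
  assumes "e > 0" "\<zeta> \<noteq> 0"
  shows "a oo twist \<zeta> e = 0 \<longleftrightarrow> a = 0"
proof
  assume "a oo twist \<zeta> e = 0"
  hence "(a oo twist \<zeta> e) $ (e * i) = 0" for i by simp
  thus "a = 0" using assms by (intro fps_ext) (simp add: nth_compose_twist)
qed simp

lemma subdegree_compose_twist:
  assumes "e > 0" "\<zeta> \<noteq> 0"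
  shows "subdegree (a oo twist \<zeta> e) = e * subdegree a"
proof (cases "a = 0")
  case False
  show ?thesis
  proof (rule subdegreeI)
    show "(a oo twist \<zeta> e) $ (e * subdegree a) \<noteq> 0"
      using False assms by (simp add: nth_compose_twist)
    show "(a oo twist \<zeta> e) $ i = 0" if "i < e * subdegree a" for i
    proof (cases "e dvd i")
      case True
      then obtain j where j: "i = e * j" by blast
      hence "a $ j = 0" using that assms by (intro nth_less_subdegree_zero) simp
      thus ?thesis using j assms by (simp add: nth_compose_twist)
    qed (simp add: nth_compose_twist assms)
  qed
qed simp

lemma X_power_compose_twist:
  assumes "e > 0" "\<zeta> \<in> mu N"
  shows "fps_X ^ N oo twist \<zeta> e = fps_X ^ (e * N)"
proof -
  have "fps_X ^ N oo twist \<zeta> e = twist \<zeta> e ^ N"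
    using assms by (simp add: fps_compose_power[symmetric])
  also have "\<dots> = fps_const (\<zeta> ^ N) * fps_X ^ (e * N)"
    by (simp add: twist_def power_mult_distrib fps_const_power power_mult)
  finally show ?thesis using assms by (simp add: mu_def)
qed

lemma on_branch_compose_twist:
  assumes "e > 0" "N > 0" "\<zeta> \<in> mu N"
  shows "on_branch N \<psi> p oo twist \<zeta> e = on_branch (e * N) (\<psi> oo twist \<zeta> e) p"
  using assms by (simp add: on_branch_def poly_subst_coeffs_compose X_power_compose_twist)

lemma euler_compose_twist:
  assumes "e > 0"
  shows "fps_X * fps_deriv (\<psi> oo twist \<zeta> e) = fps_const (of_nat e) * ((fps_X * fps_deriv \<psi>) oo twist \<zeta> e)"
proof (rule fps_ext)
  have *: "(fps_X * fps_deriv f) $ i = of_nat i * f $ i" for f :: "complex fps" and i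
    by (cases i) simp_all
  show "(fps_X * fps_deriv (\<psi> oo twist \<zeta> e)) $ l =
    (fps_const (of_nat e) * ((fps_X * fps_deriv \<psi>) oo twist \<zeta> e)) $ l" for l
    unfolding fps_mult_left_const_nth nth_compose_twist[OF assms] *
    by (auto elim!: dvdE simp: assms)
qed

lemma euler_form_compose_twist:
  assumes "e > 0" "N > 0" "\<zeta> \<in> mu N"
  shows "euler_form (e * N) (\<psi> oo twist \<zeta> e) P Q
       = fps_const (of_nat e) * (euler_form N \<psi> P Q oo twist \<zeta> e)"
proof -
  have "fps_const (of_nat (e * N)) = fps_const (of_nat e) * (fps_const (of_nat N) :: complex fps)"
    by simp
  moreover have "euler_form N \<psi> P Q oo twist \<zeta> e =
      fps_const (of_nat N) * fps_X ^ (e * N) * on_branch (e * N) (\<psi> oo twist \<zeta> e) P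
      - on_branch (e * N) (\<psi> oo twist \<zeta> e) Q * ((fps_X * fps_deriv \<psi>) oo twist \<zeta> e)"
    unfolding euler_form_def fps_compose_sub_distrib fps_compose_mult_distrib[OF twist_nth_0[OF assms(1)]]
      on_branch_compose_twist[OF assms] X_power_compose_twist[OF assms(1,3)] fps_const_compose ..
  ultimately show ?thesis
    unfolding euler_form_def euler_compose_twist[OF assms(1)] by (simp only: right_diff_distrib mult_ac)
qed

definition primitive_series :: "nat \<Rightarrow> complex fps \<Rightarrow> bool" where
  "primitive_series N \<psi> \<longleftrightarrow> Gcd (insert N {i. \<psi> $ i \<noteq> 0}) = 1"

text \<open>
  If \<open>a\<close> and \<open>b\<close> give the same conjugate then \<open>a/b\<close> is killed by \<open>N\<close> and by all exponents of \<open>\<psi>\<close>,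
  hence by their greatest common divisor.
\<close>

lemma inj_on_conjugates:
  assumes "primitive_series N \<psi>" "N > 0" "e > 0"
  shows "inj_on (\<lambda>\<zeta>. \<psi> oo twist \<zeta> e) (mu N)"
proof (rule inj_onI)
  fix a b assume ab: "a \<in> mu N" "b \<in> mu N" "\<psi> oo twist a e = \<psi> oo twist b e"
  have nz: "a \<noteq> 0" "b \<noteq> 0" using mu_nonzero ab assms by auto
  have "(a / b) ^ i = 1" if "\<psi> $ i \<noteq> 0" for i
  proof -
    have "(\<psi> oo twist a e) $ (e * i) = (\<psi> oo twist b e) $ (e * i)" using ab by simp
    thus ?thesis using that assms nz by (simp add: nth_compose_twist power_divide)
  qed
  moreover have "(a / b) ^ N = 1" using ab by (simp add: mu_def power_divide)
  ultimately have "(a / b) ^ Gcd (insert N {i. \<psi> $ i \<noteq> 0}) = 1"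
    by (subst power_Gcd_eq_1_iff[OF assms(2)]) auto
  thus "a = b" using assms(1) nz by (simp add: primitive_series_def)
qed

lemma monic_eq_prod_roots:
  fixes p :: "'a::idom poly"
  assumes "lead_coeff p = 1" "finite Z" "card Z = degree p" "\<And>z. z \<in> Z \<Longrightarrow> poly p z = 0"
  shows "p = (\<Prod>z\<in>Z. [:-z, 1:])"
proof (rule ccontr)
  let ?q = "\<Prod>z\<in>Z. [:-z, 1:]"
  assume "p \<noteq> ?q"
  have dq: "degree ?q = degree p" using assms by (subst degree_prod_eq_sum_degree) auto
  have lq: "lead_coeff ?q = 1" by (simp add: lead_coeff_prod)
  have "coeff (p - ?q) i = 0" if "i \<ge> degree p" for i
    using that dq lq assms by (cases "i = degree p") (auto simp: coeff_eq_0)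
  moreover have "p - ?q \<noteq> 0" using \<open>p \<noteq> ?q\<close> by simp
  ultimately have "degree (p - ?q) < degree p"
    by (meson leading_coeff_0_iff not_le)
  moreover have "Z \<subseteq> {x. poly (p - ?q) x = 0}"
    using assms by (auto simp: poly_prod intro!: prod_zero)
  hence "card Z \<le> card {x. poly (p - ?q) x = 0}"
    using \<open>p \<noteq> ?q\<close> by (intro card_mono poly_roots_finite) auto
  hence "card Z \<le> degree (p - ?q)"
    using card_poly_roots_bound[of "p - ?q"] \<open>p \<noteq> ?q\<close> by simp
  ultimately show False using assms by simp
qed

text \<open>
  The polynomial in \<open>Y\<close> whose roots are the conjugates \<open>\<psi>(\<zeta>t\<^sup>e)\<close>. For a monic \<open>F\<close> of degree \<open>N\<close>
  with primitive parametrization \<open>(t\<^sup>N, \<psi>)\<close> it is \<open>F(t\<^sup>e\<^sup>N, Y)\<close>.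
\<close>

definition conjugate_prod :: "nat \<Rightarrow> nat \<Rightarrow> complex fps \<Rightarrow> complex fps poly" where
  "conjugate_prod N e \<psi> = (\<Prod>\<zeta>\<in>mu N. [:- (\<psi> oo twist \<zeta> e), 1:])"

lemma subst_coeffs_eq_conjugate_prod:
  assumes "primitive_series N \<psi>" "N > 0" "e > 0" "lead_coeff F = 1" "degree F = N" "on_branch N \<psi> F = 0"
  shows "subst_coeffs (fps_X ^ (e * N)) F = conjugate_prod N e \<psi>"
proof -
  let ?y = "\<lambda>\<zeta>. \<psi> oo twist \<zeta> e"
  note inj = inj_on_conjugates[OF assms(1-3)]
  have "subst_coeffs (fps_X ^ (e * N)) F = (\<Prod>z\<in>?y ` mu N. [:-z, 1:])"
  proof (rule monic_eq_prod_roots)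
    show "card (?y ` mu N) = degree (subst_coeffs (fps_X ^ (e * N)) F)"
      using assms inj by (simp add: card_image degree_subst_coeffs_monic)
    fix z assume "z \<in> ?y ` mu N"
    then obtain \<zeta> where "\<zeta> \<in> mu N" "z = ?y \<zeta>" by blast
    thus "poly (subst_coeffs (fps_X ^ (e * N)) F) z = 0"
      using on_branch_compose_twist[of e N \<zeta> \<psi> F] assms by (simp add: on_branch_def)
  qed (use assms in \<open>simp_all add: degree_subst_coeffs_monic\<close>)
  thus ?thesis by (simp add: conjugate_prod_def prod.reindex[OF inj])
qed

section \<open>Leading terms of Laurent series\<close>

text \<open>
  Here \<open>x = c t\<^sup>d + \<dots>\<close>, where \<open>c = 0\<close> is allowed. In this form the property is stable under sums of
  the same order without a case distinction on cancellation.
\<close>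

definition lead :: "complex fls \<Rightarrow> int \<Rightarrow> complex \<Rightarrow> bool" where
  "lead x d c \<longleftrightarrow> (\<forall>i<d. fls_nth x i = 0) \<and> fls_nth x d = c"

lemma lead_iff: "lead x d c \<longleftrightarrow> (\<exists>y. x = fls_shift (- d) (fps_to_fls y) \<and> y $ 0 = c)"
proof
  assume l: "lead x d c"
  have "x = fls_shift (- d) (fps_to_fls (fls_regpart (fls_shift d x)))"
    using l by (intro fls_eqI) (auto simp: lead_def)
  thus "\<exists>y. x = fls_shift (- d) (fps_to_fls y) \<and> y $ 0 = c"
    using l by (intro exI[of _ "fls_regpart (fls_shift d x)"]) (auto simp: lead_def)
qed (auto simp: lead_def)

lemma lead_add: "lead x d a \<Longrightarrow> lead y d b \<Longrightarrow> lead (x + y) d (a + b)"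
  by (simp add: lead_def)

lemma lead_uminus: "lead x d a \<Longrightarrow> lead (- x) d (- a)"
  by (simp add: lead_def)

lemma lead_sum: "(\<And>i. i \<in> S \<Longrightarrow> lead (x i) d (c i)) \<Longrightarrow> lead (\<Sum>i\<in>S. x i) d (\<Sum>i\<in>S. c i)"
  by (induction S rule: infinite_finite_induct) (simp_all add: lead_add, simp_all add: lead_def)

lemma lead_mult: "lead x d a \<Longrightarrow> lead y e b \<Longrightarrow> lead (x * y) (d + e) (a * b)"
proof -
  assume "lead x d a" "lead y e b"
  then obtain u v where "x = fls_shift (- d) (fps_to_fls u)" "u $ 0 = a"
    "y = fls_shift (- e) (fps_to_fls v)" "v $ 0 = b"
    unfolding lead_iff by blast
  thus ?thesis unfolding lead_iff
    by (intro exI[of _ "u * v"])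
       (simp add: fls_shifted_times_simps add.commute flip: fls_times_fps_to_fls)
qed

lemma lead_prod:
  "(\<And>i. i \<in> S \<Longrightarrow> lead (x i) (d i) (c i)) \<Longrightarrow> lead (\<Prod>i\<in>S. x i) (\<Sum>i\<in>S. d i) (\<Prod>i\<in>S. c i)"
  by (induction S rule: infinite_finite_induct) (simp_all add: lead_mult, simp_all add: lead_def)

lemma lead_inverse:
  assumes "lead x d c" "c \<noteq> 0"
  shows "lead (inverse x) (- d) (inverse c)"
proof -
  obtain y where y: "x = fls_shift (- d) (fps_to_fls y)" "y $ 0 = c"
    using assms by (auto simp: lead_iff)
  have "y * inverse y = 1" using y(2) assms(2) by (intro inverse_mult_eq_1') blast
  hence "x * fls_shift d (fps_to_fls (inverse y)) = 1"
    unfolding y by (simp add: fls_shifted_times_simps flip: fls_times_fps_to_fls)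
  hence "inverse x = fls_shift (- (- d)) (fps_to_fls (inverse y))"
    by (simp add: inverse_unique)
  thus ?thesis unfolding lead_iff using y by auto
qed

lemma lead_divide:
  "lead x d a \<Longrightarrow> lead y e b \<Longrightarrow> b \<noteq> 0 \<Longrightarrow> lead (x / y) (d - e) (a / b)"
  using lead_mult[of x d a "inverse y" "- e" "inverse b"] lead_inverse[of y e b]
  by (simp add: divide_inverse)

lemma lead_weaken: "lead x d c \<Longrightarrow> d' < d \<Longrightarrow> lead x d' 0"
  by (simp add: lead_def)

lemma lead_fps_iff: "lead (fps_to_fls a) (int d) c \<longleftrightarrow> (\<forall>i<d. a $ i = 0) \<and> a $ d = c"
proof -
  have *: "(\<forall>i<int d. fls_nth (fps_to_fls a) i = 0) \<longleftrightarrow> (\<forall>i<d. a $ i = 0)"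
  proof safe
    fix i assume *: "\<forall>i<int d. fls_nth (fps_to_fls a) i = 0" "i < d"
    from *(1)[rule_format, of "int i"] *(2) show "a $ i = 0" by simp
  next
    fix i assume *: "\<forall>i<d. a $ i = 0" "i < int d"
    show "fls_nth (fps_to_fls a) i = 0"
    proof (cases "i < 0")
      case False
      hence "nat i < d" using *(2) by linarith
      thus ?thesis using *(1) by simp
    qed simp
  qed
  moreover have "fls_nth (fps_to_fls a) (int d) = a $ d" by simp
  ultimately show ?thesis unfolding lead_def by metis
qed

lemma lead_fps: "lead (fps_to_fls a) (int (subdegree a)) (a $ subdegree a)"
  unfolding lead_fps_iff using nth_less_subdegree_zero by blast

lemma lead_fps_subdegree:
  assumes "lead (fps_to_fls a) (int d) c" "c \<noteq> 0"
  shows "a \<noteq> 0" "subdegree a = d"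
proof -
  have "a $ d \<noteq> 0" "\<forall>i<d. a $ i = 0" using assms unfolding lead_fps_iff by auto
  thus "a \<noteq> 0" "subdegree a = d" by (auto intro: fps_nonzeroI subdegreeI)
qed

text \<open>
  The operator \<open>t d/dt\<close> multiplies a leading coefficient by the order.
\<close>

lemma lead_euler:
  assumes "lead (fps_to_fls a) (int d) c"
  shows "lead (fps_to_fls (fps_X * fps_deriv a)) (int d) (of_nat d * c)"
proof -
  have *: "(fps_X * fps_deriv a) $ i = of_nat i * a $ i" for i
    by (cases i) simp_all
  from assms have "\<And>i. i < d \<Longrightarrow> a $ i = 0" "a $ d = c" unfolding lead_fps_iff by blast+
  thus ?thesis unfolding lead_fps_iff * by auto
qed

lemma lead_compose_twist:
  assumes "e > 0" "\<zeta> \<noteq> 0"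
  shows "lead (fps_to_fls (a oo twist \<zeta> e)) (int (e * subdegree a)) (\<zeta> ^ subdegree a * a $ subdegree a)"
proof -
  have "(a oo twist \<zeta> e) $ (e * subdegree a) = \<zeta> ^ subdegree a * a $ subdegree a"
    using assms(1) by (simp add: nth_compose_twist)
  thus ?thesis
    using lead_fps[of "a oo twist \<zeta> e"] unfolding subdegree_compose_twist[OF assms] by (simp only:)
qed

section \<open>Lagrange interpolation\<close>

lemma lagrange_interpolation:
  fixes y :: "'i \<Rightarrow> 'a::field"
  assumes "finite S" "inj_on y S" "degree p < card S"
  shows "poly p x = (\<Sum>i\<in>S. poly p (y i) * (\<Prod>j\<in>S - {i}. (x - y j) / (y i - y j)))"
proof -
  define q where "q = (\<Sum>i\<in>S. smult (poly p (y i)) (\<Prod>j\<in>S - {i}. [:- y j / (y i - y j), 1 / (y i - y j):]))"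
  have pq: "poly q x = (\<Sum>i\<in>S. poly p (y i) * (\<Prod>j\<in>S - {i}. (x - y j) / (y i - y j)))" for x
    by (simp add: q_def poly_sum poly_prod diff_divide_distrib)
  have "degree q < card S"
  proof -
    have "degree (\<Prod>j\<in>S - {i}. [:- y j / (y i - y j), 1 / (y i - y j):]) < card S" if "i \<in> S" for i
    proof -
      have "degree (\<Prod>j\<in>S - {i}. [:- y j / (y i - y j), 1 / (y i - y j):])
          \<le> (\<Sum>j\<in>S - {i}. degree [:- y j / (y i - y j), 1 / (y i - y j):])"
        by (rule order_trans[OF degree_prod_sum_le]) (use assms(1) in \<open>simp_all add: o_def\<close>)
      also have "\<dots> \<le> (\<Sum>j\<in>S - {i}. 1)" by (intro sum_mono) simp
      also have "\<dots> = card (S - {i})" by simp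
      also have "\<dots> < card S" using that assms(1) by (meson card_Diff1_less)
      finally show ?thesis .
    qed
    moreover have "card S > 0" using assms(3) by linarith
    ultimately show ?thesis unfolding q_def
      by (intro degree_sum_less) (auto intro: le_less_trans[OF degree_smult_le])
  qed
  moreover have "poly q (y k) = poly p (y k)" if "k \<in> S" for k
  proof -
    have *: "(\<Prod>j\<in>S - {i}. (y k - y j) / (y i - y j)) = (if i = k then 1 else 0)" if "i \<in> S" for i
    proof (cases "i = k")
      case True
      have "y k - y j \<noteq> 0" if "j \<in> S - {k}" for j
        using that \<open>k \<in> S\<close> assms(2) by (auto simp: inj_on_def)
      thus ?thesis using True by (simp add: prod.neutral)
    next
      case False
      hence "k \<in> S - {i}" using \<open>k \<in> S\<close> by simp
      thus ?thesis using False assms(1) by (auto intro!: prod_zero)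
    qed
    have "poly q (y k) = (\<Sum>i\<in>S. if i = k then poly p (y i) else 0)"
      unfolding pq by (intro sum.cong refl) (simp only: *, simp)
    also have "\<dots> = poly p (y k)" using that assms(1) by simp
    finally show ?thesis .
  qed
  ultimately have "p = q"
  proof -
    assume q: "degree q < card S" "\<And>k. k \<in> S \<Longrightarrow> poly q (y k) = poly p (y k)"
    show "p = q"
    proof (rule ccontr)
      assume "p \<noteq> q"
      hence nz: "p - q \<noteq> 0" by simp
      have "card S = card (y ` S)" using assms by (simp add: card_image)
      also have "\<dots> \<le> card {x. poly (p - q) x = 0}"
        using q nz by (intro card_mono poly_roots_finite) auto
      also have "\<dots> \<le> degree (p - q)" using nz by (rule card_poly_roots_bound)
      also have "\<dots> < card S" using assms(3) q by (simp add: degree_diff_less)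
      finally show False by simp
    qed
  qed
  hence "poly p x = poly q x" by (rule arg_cong)
  also note pq
  finally show ?thesis .
qed

lemma poly_map_fps_to_fls:
  "poly (map_poly fps_to_fls q) (fps_to_fls x) = fps_to_fls (poly q x :: complex fps)"
  by (induction q) (simp_all add: map_poly_pCons fls_times_fps_to_fls)

lemma poly_pderiv_prod_linear:
  fixes y :: "'i \<Rightarrow> 'a::idom"
  assumes "finite S" "k \<in> S"
  shows "poly (pderiv (\<Prod>i\<in>S. [:- y i, 1:])) (y k) = (\<Prod>i\<in>S - {k}. y k - y i)"
  using assms by (simp add: prod.remove[of S k] pderiv_mult pderiv_pCons poly_prod del: mult_pCons_left mult_pCons_right)

section \<open>Values of differentials on two branches in contact\<close>

text \<open>
  A branch \<open>F = 0\<close> with primitive parametrization \<open>(t\<^sup>N, \<psi>(t))\<close>. It plays the role of \<open>C\<^sub>k\<close>.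
\<close>

locale branch =
  fixes N :: nat and \<psi> :: "complex fps" and F :: "complex fps poly"
  assumes N_pos: "N > 0" and monic: "lead_coeff F = 1" and degree_F: "degree F = N"
    and root: "on_branch N \<psi> F = 0" and primitive: "primitive_series N \<psi>"
begin

text \<open>
  The different of the element \<open>y\<close> over \<open>\<complex>((x))\<close> in the classical sense, that is \<open>\<partial>F/\<partial>y\<close> on the
  branch.
\<close>

definition different :: "complex fps" where
  "different = on_branch N \<psi> (pderiv F)"

lemma mu_ne_0: "\<zeta> \<in> mu N \<Longrightarrow> \<zeta> \<noteq> 0"
  using mu_nonzero N_pos by blast

lemma different_ne_0: "different \<noteq> 0"
proof -
  let ?y = "\<lambda>\<zeta>. \<psi> oo twist \<zeta> 1"
  have "different = poly (pderiv (conjugate_prod N 1 \<psi>)) (?y 1)"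
    using subst_coeffs_eq_conjugate_prod[OF primitive N_pos zero_less_one monic degree_F root]
    by (simp add: different_def on_branch_def subst_coeffs_pderiv N_pos twist_def)
  also have "\<dots> = (\<Prod>j\<in>mu N - {1}. ?y 1 - ?y j)"
    unfolding conjugate_prod_def using N_pos by (intro poly_pderiv_prod_linear) auto
  also have "\<dots> \<noteq> 0"
    using inj_on_conjugates[OF primitive N_pos, of 1] N_pos by (auto simp: inj_on_def)
  finally show ?thesis .
qed

end

text \<open>
  A second curve \<open>(t\<^sup>e\<^sup>N, \<phi>(t))\<close> which has contact of order \<open>b\<close> with one conjugate of the branch,
  and smaller contact with all the others: the conjugates are already distinct modulo \<open>t\<^sup>b\<close>.
\<close>

locale branch_contact = branch N \<psi> F for N \<psi> F +
  fixes e :: nat and \<phi> :: "complex fps" and b :: nat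
  assumes e_pos: "e > 0" and b_pos: "b > 0"
    and contact: "\<phi> \<noteq> \<psi> oo twist 1 e" "subdegree (\<phi> - (\<psi> oo twist 1 e)) = b"
    and separated: "\<And>\<zeta>. \<zeta> \<in> mu N \<Longrightarrow> \<zeta> \<noteq> 1 \<Longrightarrow> \<exists>i. e * i < b \<and> \<psi> $ i \<noteq> 0 \<and> \<zeta> ^ i \<noteq> 1"
begin

definition conjugate :: "complex \<Rightarrow> complex fps" where
  "conjugate \<zeta> = \<psi> oo twist \<zeta> e"

definition gap :: "complex \<Rightarrow> nat" where
  "gap \<zeta> = subdegree (conjugate 1 - conjugate \<zeta>)"

definition gap_coeff :: "complex \<Rightarrow> complex" where
  "gap_coeff \<zeta> = (conjugate 1 - conjugate \<zeta>) $ gap \<zeta>"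

definition contact_coeff :: complex where
  "contact_coeff = (\<phi> - conjugate 1) $ b"

definition basis :: "complex \<Rightarrow> complex fls" where
  "basis \<zeta> = (\<Prod>j\<in>mu N - {\<zeta>}.
     (fps_to_fls \<phi> - fps_to_fls (conjugate j)) / (fps_to_fls (conjugate \<zeta>) - fps_to_fls (conjugate j)))"

lemma inj_conjugate: "inj_on conjugate (mu N)"
  using inj_on_conjugates[OF primitive N_pos e_pos] by (simp add: conjugate_def[abs_def])

lemma conjugate_nth: "conjugate \<zeta> $ l = (if e dvd l then \<zeta> ^ (l div e) * \<psi> $ (l div e) else 0)"
  by (simp add: conjugate_def nth_compose_twist e_pos)

text \<open>
  Distinct conjugates differ first at an exponent of \<open>\<psi>\<close> which does not kill the root of unity. In
  particular the \<open>\<zeta>\<close> with \<open>gap \<zeta> \<ge> j\<close>, together with \<open>1\<close>, form a group.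
\<close>

lemma le_gap_iff:
  assumes "\<zeta> \<in> mu N" "\<zeta> \<noteq> 1"
  shows "j \<le> gap \<zeta> \<longleftrightarrow> (\<forall>i. e * i < j \<longrightarrow> \<psi> $ i \<noteq> 0 \<longrightarrow> \<zeta> ^ i = 1)"
proof -
  have ne: "conjugate 1 - conjugate \<zeta> \<noteq> 0" using inj_conjugate assms by (auto simp: inj_on_def)
  have "j \<le> gap \<zeta> \<longleftrightarrow> (\<forall>l<j. (conjugate 1 - conjugate \<zeta>) $ l = 0)"
    unfolding gap_def using subdegree_geI[OF ne] nth_less_subdegree_zero by (metis less_le_trans)
  also have "\<dots> \<longleftrightarrow> (\<forall>i. e * i < j \<longrightarrow> \<psi> $ i \<noteq> 0 \<longrightarrow> \<zeta> ^ i = 1)"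
  proof safe
    fix i assume *: "\<forall>l<j. (conjugate 1 - conjugate \<zeta>) $ l = 0" "e * i < j" "\<psi> $ i \<noteq> 0"
    hence "(conjugate 1 - conjugate \<zeta>) $ (e * i) = 0" by blast
    thus "\<zeta> ^ i = 1" using * e_pos by (simp add: conjugate_nth)
  next
    fix l assume *: "\<forall>i. e * i < j \<longrightarrow> \<psi> $ i \<noteq> 0 \<longrightarrow> \<zeta> ^ i = 1" "l < j"
    show "(conjugate 1 - conjugate \<zeta>) $ l = 0"
    proof (cases "e dvd l")
      case True
      then obtain i where "l = e * i" by blast
      thus ?thesis using * e_pos by (cases "\<psi> $ i = 0") (auto simp: conjugate_nth)
    qed (simp add: conjugate_nth)
  qed
  finally show ?thesis .
qed

lemma gap_less: "\<zeta> \<in> mu N \<Longrightarrow> \<zeta> \<noteq> 1 \<Longrightarrow> gap \<zeta> < b"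
  using le_gap_iff[of \<zeta> b] separated[of \<zeta>] by (auto simp: not_le[symmetric])

lemma gap_coeff_ne_0: "\<zeta> \<in> mu N \<Longrightarrow> \<zeta> \<noteq> 1 \<Longrightarrow> gap_coeff \<zeta> \<noteq> 0"
proof -
  assume "\<zeta> \<in> mu N" "\<zeta> \<noteq> 1"
  hence "conjugate 1 - conjugate \<zeta> \<noteq> 0" using inj_conjugate by (auto simp: inj_on_def)
  thus ?thesis unfolding gap_coeff_def gap_def by (rule nth_subdegree_nonzero)
qed

lemma contact_coeff_ne_0: "contact_coeff \<noteq> 0"
  using contact unfolding contact_coeff_def conjugate_def
  by (metis nth_subdegree_nonzero right_minus_eq)

lemma lead_contact: "lead (fps_to_fls (\<phi> - conjugate 1)) (int b) contact_coeff"
  using lead_fps[of "\<phi> - conjugate 1"] unfolding contact_coeff_def conjugate_def contact(2) .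

lemma lead_gap: "lead (fps_to_fls (conjugate 1 - conjugate \<zeta>)) (int (gap \<zeta>)) (gap_coeff \<zeta>)"
  using lead_fps[of "conjugate 1 - conjugate \<zeta>"] unfolding gap_coeff_def gap_def .

lemma lead_diff:
  assumes "\<zeta> \<in> mu N" "\<zeta> \<noteq> 1"
  shows "lead (fps_to_fls (\<phi> - conjugate \<zeta>)) (int (gap \<zeta>)) (gap_coeff \<zeta>)"
proof -
  have "lead (fps_to_fls (\<phi> - conjugate 1)) (int (gap \<zeta>)) 0"
    using gap_less[OF assms] by (intro lead_weaken[OF lead_contact]) simp
  from lead_add[OF this lead_gap[of \<zeta>]] show ?thesis
    by (simp flip: fps_to_fls_plus fps_to_fls_minus)
qed

lemma different_conjugate:
  assumes "\<zeta> \<in> mu N"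
  shows "different oo twist \<zeta> e = (\<Prod>j\<in>mu N - {\<zeta>}. conjugate \<zeta> - conjugate j)"
proof -
  have "different oo twist \<zeta> e = poly (pderiv (conjugate_prod N e \<psi>)) (conjugate \<zeta>)"
    unfolding different_def on_branch_compose_twist[OF e_pos N_pos assms]
    by (simp add: on_branch_def subst_coeffs_pderiv conjugate_def e_pos N_pos
        flip: subst_coeffs_eq_conjugate_prod[OF primitive N_pos e_pos monic degree_F root])
  also have "\<dots> = (\<Prod>j\<in>mu N - {\<zeta>}. conjugate \<zeta> - conjugate j)"
    unfolding conjugate_prod_def conjugate_def[symmetric]
    using assms N_pos by (intro poly_pderiv_prod_linear) auto
  finally show ?thesis .
qed

lemma lead_different: 
  assumes "\<zeta> \<in> mu N"
  shows "lead (\<Prod>j\<in>mu N - {\<zeta>}. fps_to_fls (conjugate \<zeta>) - fps_to_fls (conjugate j)) (int (e * subdegree different))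
      (\<zeta> ^ subdegree different * different $ subdegree different)"
proof -
  have "(\<Prod>j\<in>S. fps_to_fls (g j)) = fps_to_fls (\<Prod>j\<in>S. g j)" for g :: "complex \<Rightarrow> complex fps" and S
    by (induction S rule: infinite_finite_induct) (simp_all add: fls_times_fps_to_fls)
  thus ?thesis
    using lead_compose_twist[OF e_pos mu_ne_0[OF assms], of different]
    by (simp add: different_conjugate[OF assms] flip: fps_to_fls_minus del: of_nat_mult)
qed

lemma gap_sum:
  "(\<Sum>\<zeta>\<in>mu N - {1}. gap \<zeta>) = e * subdegree different"
  "(\<Prod>\<zeta>\<in>mu N - {1}. gap_coeff \<zeta>) = different $ subdegree different"
proof -
  have nz: "(\<Prod>\<zeta>\<in>mu N - {1}. gap_coeff \<zeta>) \<noteq> 0"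
    using gap_coeff_ne_0 N_pos by auto
  have 1: "lead (\<Prod>j\<in>mu N - {1}. fps_to_fls (conjugate 1 - conjugate j)) (\<Sum>\<zeta>\<in>mu N - {1}. int (gap \<zeta>))
      (\<Prod>\<zeta>\<in>mu N - {1}. gap_coeff \<zeta>)"
    by (intro lead_prod lead_gap)
  have 2: "lead (\<Prod>j\<in>mu N - {1}. fps_to_fls (conjugate 1 - conjugate j)) (int (e * subdegree different))
      (different $ subdegree different)"
    using lead_different[of 1] by simp
  \<comment> \<open>Two descriptions of one leading term agree once both coefficients are known to be nonzero.\<close>
  have uniq: "d = d'" "c = c'" if "lead x d c" "lead x d' c'" "c \<noteq> 0" "c' \<noteq> 0" for x d c d' c'
    using that unfolding lead_def by (metis linorder_neqE)+
  from uniq[OF 1 2 nz] different_ne_0 have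
    "(\<Sum>\<zeta>\<in>mu N - {1}. int (gap \<zeta>)) = int (e * subdegree different)"
    "(\<Prod>\<zeta>\<in>mu N - {1}. gap_coeff \<zeta>) = different $ subdegree different" by simp_all
  thus "(\<Sum>\<zeta>\<in>mu N - {1}. gap \<zeta>) = e * subdegree different"
    "(\<Prod>\<zeta>\<in>mu N - {1}. gap_coeff \<zeta>) = different $ subdegree different"
    by (simp_all only: of_nat_sum[symmetric] of_nat_eq_iff)
qed

lemma lead_others:
  "lead (\<Prod>j\<in>mu N - {1}. fps_to_fls (\<phi> - conjugate j)) (int (e * subdegree different)) (different $ subdegree different)"
proof -
  have "lead (\<Prod>j\<in>mu N - {1}. fps_to_fls (\<phi> - conjugate j)) (\<Sum>\<zeta>\<in>mu N - {1}. int (gap \<zeta>))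
      (\<Prod>\<zeta>\<in>mu N - {1}. gap_coeff \<zeta>)"
    by (intro lead_prod lead_diff) auto
  thus ?thesis unfolding gap_sum(2) gap_sum(1)[symmetric] of_nat_sum .
qed

text \<open>
  On the second curve \<open>F\<close> is the product of the differences \<open>\<phi> - \<psi>(\<zeta>t\<^sup>e)\<close>. The factor for \<open>\<zeta> = 1\<close>
  has order \<open>b\<close>; the others have the same leading terms as the factors of \<open>\<partial>F/\<partial>y\<close> at that
  conjugate.
\<close>

lemma value_of_root_poly:
  "on_branch (e * N) \<phi> F \<noteq> 0" "subdegree (on_branch (e * N) \<phi> F) = b + e * subdegree different"
proof -
  have "on_branch (e * N) \<phi> F = (\<Prod>\<zeta>\<in>mu N. \<phi> - conjugate \<zeta>)"
    by (simp add: on_branch_def subst_coeffs_eq_conjugate_prod[OF primitive N_pos e_pos monic degree_F root]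
        conjugate_prod_def poly_prod conjugate_def)
  also have "fps_to_fls \<dots> = (\<Prod>\<zeta>\<in>mu N. fps_to_fls (\<phi> - conjugate \<zeta>))"
  proof -
    have "fps_to_fls (\<Prod>j\<in>S. g j) = (\<Prod>j\<in>S. fps_to_fls (g j))" for g :: "complex \<Rightarrow> complex fps" and S
      by (induction S rule: infinite_finite_induct) (simp_all add: fls_times_fps_to_fls)
    thus ?thesis .
  qed
  also have "\<dots> = fps_to_fls (\<phi> - conjugate 1) * (\<Prod>\<zeta>\<in>mu N - {1}. fps_to_fls (\<phi> - conjugate \<zeta>))"
    using N_pos by (intro prod.remove) auto
  finally have "lead (fps_to_fls (on_branch (e * N) \<phi> F)) (int (b + e * subdegree different))
     (contact_coeff * different $ subdegree different)"
    using lead_mult[OF lead_contact lead_others] by simp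
  from lead_fps_subdegree[OF this] show "on_branch (e * N) \<phi> F \<noteq> 0"
    "subdegree (on_branch (e * N) \<phi> F) = b + e * subdegree different"
    using contact_coeff_ne_0 different_ne_0 by auto
qed

lemma lead_basis_1: "lead (basis 1) 0 1"
proof -
  have "lead (\<Prod>j\<in>mu N - {1}. (fps_to_fls \<phi> - fps_to_fls (conjugate j)) / (fps_to_fls (conjugate 1) - fps_to_fls (conjugate j)))
    (\<Sum>j\<in>mu N - {1}. int (gap j) - int (gap j)) (\<Prod>j\<in>mu N - {1}. gap_coeff j / gap_coeff j)"
    using lead_diff lead_gap gap_coeff_ne_0 by (intro lead_prod lead_divide) auto
  moreover have "(\<Prod>j\<in>mu N - {1}. gap_coeff j / gap_coeff j) = 1"
    using gap_coeff_ne_0 by (intro prod.neutral) auto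
  ultimately show ?thesis by (simp add: basis_def)
qed

text \<open>
  Up to the factor \<open>(\<phi> - \<psi>(t\<^sup>e))/(\<phi> - \<psi>(\<zeta>t\<^sup>e))\<close> the numerator is the product over the indices other
  than \<open>1\<close>, whose leading term is that of \<open>\<partial>F/\<partial>y\<close>; the denominator is the conjugate of \<open>\<partial>F/\<partial>y\<close>
  belonging to \<open>\<zeta>\<close>.
\<close>

lemma lead_basis:
  assumes "\<zeta> \<in> mu N" "\<zeta> \<noteq> 1"
  shows "lead (basis \<zeta>) (int b - int (gap \<zeta>)) (contact_coeff / (gap_coeff \<zeta> * \<zeta> ^ subdegree different))"
proof -
  let ?f = "\<lambda>j. fps_to_fls (\<phi> - conjugate j)"
  have ne: "?f \<zeta> \<noteq> 0"
    using lead_fps_subdegree[OF lead_diff[OF assms] gap_coeff_ne_0[OF assms]] by simp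
  have "?f \<zeta> * (\<Prod>j\<in>mu N - {\<zeta>}. ?f j) = ?f 1 * (\<Prod>j\<in>mu N - {1}. ?f j)"
    using N_pos assms prod.remove[of "mu N" \<zeta> ?f] prod.remove[of "mu N" 1 ?f] by simp
  hence eq: "(\<Prod>j\<in>mu N - {\<zeta>}. ?f j) = ?f 1 * (\<Prod>j\<in>mu N - {1}. ?f j) / ?f \<zeta>"
    using ne by (simp add: nonzero_eq_divide_eq mult.commute)
  have "lead (\<Prod>j\<in>mu N - {\<zeta>}. ?f j) (int b + int (e * subdegree different) - int (gap \<zeta>))
     (contact_coeff * different $ subdegree different / gap_coeff \<zeta>)"
    unfolding eq
    by (intro lead_divide lead_mult lead_contact lead_others lead_diff gap_coeff_ne_0 assms)
  moreover have nz: "\<zeta> ^ subdegree different * different $ subdegree different \<noteq> 0"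
    using mu_ne_0[OF assms(1)] different_ne_0 by simp
  ultimately have "lead (basis \<zeta>) 
     (int b + int (e * subdegree different) - int (gap \<zeta>) - int (e * subdegree different))
     (contact_coeff * different $ subdegree different / gap_coeff \<zeta> / (\<zeta> ^ subdegree different * different $ subdegree different))"
    unfolding basis_def prod_dividef fps_to_fls_minus
    by (rule lead_divide[OF _ lead_different[OF assms(1)]])
  thus ?thesis using different_ne_0 by (simp add: field_simps)
qed

lemma lead_basis_0:
  assumes "\<zeta> \<in> mu N"
  shows "lead (basis \<zeta>) 0 (if \<zeta> = 1 then 1 else 0)"
proof (cases "\<zeta> = 1")
  case False
  show ?thesis
    using gap_less[OF assms False] lead_weaken[OF lead_basis[OF assms False], of 0] False by simp
qed (simp add: lead_basis_1)

lemma interpolation: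
  assumes "degree p < N"
  shows "fps_to_fls (on_branch (e * N) \<phi> p) = (\<Sum>\<zeta>\<in>mu N. fps_to_fls (on_branch (e * N) (conjugate \<zeta>) p) * basis \<zeta>)"
proof -
  let ?q = "map_poly fps_to_fls (subst_coeffs (fps_X ^ (e * N)) p)"
  have "degree ?q \<le> degree p"
    using degree_subst_coeffs_le[of "fps_X ^ (e * N)" p] by (intro degree_le) (simp add: coeff_map_poly coeff_eq_0)
  hence "poly ?q (fps_to_fls \<phi>) = (\<Sum>\<zeta>\<in>mu N. poly ?q (fps_to_fls (conjugate \<zeta>)) * basis \<zeta>)"
    unfolding basis_def using N_pos assms inj_conjugate
    by (intro lagrange_interpolation) (auto simp: inj_on_def)
  thus ?thesis unfolding poly_map_fps_to_fls on_branch_def .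
qed

lemma on_branch_conjugate: "\<zeta> \<in> mu N \<Longrightarrow> on_branch (e * N) (conjugate \<zeta>) p = on_branch N \<psi> p oo twist \<zeta> e"
  by (simp add: conjugate_def on_branch_compose_twist e_pos N_pos)

text \<open>
  Conjugate data of order \<open>d\<close> interpolate to order \<open>e d\<close>, without cancellation: the basis function
  of the close conjugate is \<open>1 + \<dots>\<close> and all the others have positive order.
\<close>

lemma lead_interpolation:
  "lead (\<Sum>\<zeta>\<in>mu N. fps_to_fls (fps_const c * (h oo twist \<zeta> e)) * basis \<zeta>)
    (int (e * subdegree h)) (c * h $ subdegree h)"
proof -
  have "lead (fps_to_fls (fps_const c * (h oo twist \<zeta> e)) * basis \<zeta>) (int (e * subdegree h) + 0)
      ((c * (\<zeta> ^ subdegree h * h $ subdegree h)) * (if \<zeta> = 1 then 1 else 0))" if "\<zeta> \<in> mu N" for \<zeta>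
  proof (intro lead_mult lead_basis_0 that)
    have "lead (fls_const c * fps_to_fls (h oo twist \<zeta> e)) (0 + int (e * subdegree h))
        (c * (\<zeta> ^ subdegree h * h $ subdegree h))"
      by (intro lead_mult lead_compose_twist e_pos mu_ne_0 that) (simp add: lead_def)
    thus "lead (fps_to_fls (fps_const c * (h oo twist \<zeta> e))) (int (e * subdegree h))
        (c * (\<zeta> ^ subdegree h * h $ subdegree h))" by (simp add: fls_times_fps_to_fls)
  qed
  hence "lead (\<Sum>\<zeta>\<in>mu N. fps_to_fls (fps_const c * (h oo twist \<zeta> e)) * basis \<zeta>)
      (int (e * subdegree h) + 0)
      (\<Sum>\<zeta>\<in>mu N. (c * (\<zeta> ^ subdegree h * h $ subdegree h)) * (if \<zeta> = 1 then 1 else 0))"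
    by (rule lead_sum)
  thus ?thesis
    using N_pos by (simp add: if_distrib[of "(*) _"] sum.delta cong: if_cong)
qed

lemma value_of_low_degree:
  assumes "degree p < N" "on_branch N \<psi> p \<noteq> 0"
  shows "on_branch (e * N) \<phi> p \<noteq> 0" "subdegree (on_branch (e * N) \<phi> p) = e * subdegree (on_branch N \<psi> p)"
proof -
  have "lead (fps_to_fls (on_branch (e * N) \<phi> p)) (int (e * subdegree (on_branch N \<psi> p)))
     (on_branch N \<psi> p $ subdegree (on_branch N \<psi> p))"
    using lead_interpolation[of 1 "on_branch N \<psi> p"]
    unfolding interpolation[OF assms(1)] by (simp add: on_branch_conjugate cong: sum.cong)
  from lead_fps_subdegree[OF this] assms(2)
  show "on_branch (e * N) \<phi> p \<noteq> 0" "subdegree (on_branch (e * N) \<phi> p) = e * subdegree (on_branch N \<psi> p)" by auto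
qed

text \<open>
  Write \<open>gap \<zeta>\<close> as the number of \<open>j\<close> in \<open>{1..b-1}\<close> with \<open>j \<le> gap \<zeta>\<close> and exchange the sums. For
  each \<open>j\<close> the roots of unity that occur, completed by \<open>1\<close>, form a group, on which the sum of a
  character is a natural number; the summand \<open>b - 1\<close> accounts for the \<open>b - 1\<close> added units.
\<close>

lemma weighted_gap_sum:
  "\<exists>m::nat. (\<Sum>\<zeta>\<in>mu N - {1}. of_nat (gap \<zeta>) * (\<zeta> ^ s / \<zeta> ^ d)) + of_nat (b - 1) = (of_nat m :: complex)"
proof -
  define \<chi> where "\<chi> = (\<lambda>\<zeta>::complex. \<zeta> ^ s / \<zeta> ^ d)"
  define G where "G = (\<lambda>j. {\<zeta>\<in>mu N. \<zeta> = 1 \<or> j \<le> gap \<zeta>})"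
  have G_iff: "\<zeta> \<in> G j \<longleftrightarrow> \<zeta> \<in> mu N \<and> (\<forall>i. e * i < j \<longrightarrow> \<psi> $ i \<noteq> 0 \<longrightarrow> \<zeta> ^ i = 1)" for \<zeta> j
    using le_gap_iff[of \<zeta> j] by (cases "\<zeta> = 1") (auto simp: G_def)
  have "(\<Sum>\<zeta>\<in>G j. \<chi> \<zeta>) = (if \<forall>g\<in>G j. \<chi> g = 1 then of_nat (card (G j)) else 0)" for j
  proof (rule character_sum)
    show "finite (G j)" using N_pos by (simp add: G_def)
    show "0 \<notin> G j" using mu_ne_0 by (auto simp: G_def)
    show "x * y \<in> G j" if "x \<in> G j" "y \<in> G j" for x y
      using that unfolding G_iff by (auto simp: mu_def power_mult_distrib)
  qed (simp add: \<chi>_def power_mult_distrib)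
  hence "\<exists>m::nat. (\<Sum>\<zeta>\<in>G j. \<chi> \<zeta>) = of_nat m" for j
    by (metis of_nat_0)
  then obtain m where m: "\<And>j. (\<Sum>\<zeta>\<in>G j. \<chi> \<zeta>) = of_nat (m j)" by metis
  have "(\<Sum>\<zeta>\<in>G j. \<chi> \<zeta>) = 1 + (\<Sum>\<zeta>\<in>mu N - {1}. if j \<le> gap \<zeta> then \<chi> \<zeta> else 0)" for j
  proof -
    have "G j = insert 1 {\<zeta>\<in>mu N - {1}. j \<le> gap \<zeta>}" by (auto simp: G_def)
    hence "(\<Sum>\<zeta>\<in>G j. \<chi> \<zeta>) = \<chi> 1 + (\<Sum>\<zeta>\<in>{\<zeta>\<in>mu N - {1}. j \<le> gap \<zeta>}. \<chi> \<zeta>)"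
      using N_pos by (simp only: sum.insert finite_mu finite_Diff finite_Collect_conjI) simp
    also have "(\<Sum>\<zeta>\<in>{\<zeta>\<in>mu N - {1}. j \<le> gap \<zeta>}. \<chi> \<zeta>) = (\<Sum>\<zeta>\<in>mu N - {1}. if j \<le> gap \<zeta> then \<chi> \<zeta> else 0)"
      using N_pos by (intro sum.inter_filter) simp
    finally show ?thesis by (simp add: \<chi>_def)
  qed
  hence "(\<Sum>j\<in>{1..b-1}. (of_nat (m j) :: complex))
      = (\<Sum>j\<in>{1..b-1}. 1 + (\<Sum>\<zeta>\<in>mu N - {1}. if j \<le> gap \<zeta> then \<chi> \<zeta> else 0))"
    by (simp flip: m)
  also have "\<dots> = of_nat (b - 1) + (\<Sum>\<zeta>\<in>mu N - {1}. \<Sum>j\<in>{1..b-1}. if j \<le> gap \<zeta> then \<chi> \<zeta> else 0)"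
    by (subst sum.distrib, subst sum.swap) simp
  also have "(\<Sum>\<zeta>\<in>mu N - {1}. \<Sum>j\<in>{1..b-1}. if j \<le> gap \<zeta> then \<chi> \<zeta> else 0)
     = (\<Sum>\<zeta>\<in>mu N - {1}. of_nat (gap \<zeta>) * \<chi> \<zeta>)"
  proof (intro sum.cong refl)
    fix \<zeta> assume \<zeta>: "\<zeta> \<in> mu N - {1}"
    have "{j\<in>{1..b-1}. j \<le> gap \<zeta>} = {1..gap \<zeta>}" using gap_less[of \<zeta>] \<zeta> by auto
    thus "(\<Sum>j\<in>{1..b-1}. if j \<le> gap \<zeta> then \<chi> \<zeta> else 0) = of_nat (gap \<zeta>) * \<chi> \<zeta>"
      by (simp flip: sum.inter_filter)
  qed
  finally show ?thesis
    by (intro exI[of _ "\<Sum>j\<in>{1..b-1}. m j"]) (simp add: \<chi>_def add.commute)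
qed

text \<open>
  This is the key nonvanishing. Let \<open>s\<close> and \<open>d\<close> be the orders of \<open>q\<close> and of the different. Every
  summand starts at order \<open>b + e s\<close> or later, and the coefficient of the sum at this order is a
  nonzero multiple of \<open>b + \<Sum> gap \<zeta> \<cdot> \<zeta>\<^sup>s/\<zeta>\<^sup>d\<close>, which is a positive integer by the preceding lemma.
\<close>

lemma lead_correction:
  assumes "q \<noteq> 0"
  shows "\<exists>c. c \<noteq> 0 \<and> lead (\<Sum>\<zeta>\<in>mu N. fps_to_fls (q oo twist \<zeta> e) *
      fps_to_fls (fps_X * fps_deriv (\<phi> - conjugate \<zeta>)) * basis \<zeta>) (int (b + e * subdegree q)) c"
proof -
  define s d where "s = subdegree q" and "d = subdegree different"
  define \<kappa> where "\<kappa> = (\<lambda>\<zeta>. if \<zeta> = 1 then of_nat b else of_nat (gap \<zeta>) / \<zeta> ^ d)"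
  have "lead (fps_to_fls (q oo twist \<zeta> e) * (fps_to_fls (fps_X * fps_deriv (\<phi> - conjugate \<zeta>)) * basis \<zeta>))
     (int (e * s) + int b) ((\<zeta> ^ s * q $ s) * (contact_coeff * \<kappa> \<zeta>))" if \<zeta>: "\<zeta> \<in> mu N" for \<zeta>
    unfolding s_def
  proof (rule lead_mult[OF lead_compose_twist[OF e_pos mu_ne_0[OF \<zeta>]]])
    show "lead (fps_to_fls (fps_X * fps_deriv (\<phi> - conjugate \<zeta>)) * basis \<zeta>) (int b) (contact_coeff * \<kappa> \<zeta>)"
    proof (cases "\<zeta> = 1")
      case True
      thus ?thesis using lead_mult[OF lead_euler[OF lead_contact] lead_basis_1]
        by (simp add: \<kappa>_def mult.commute)
    next
      case False
      show ?thesis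
        using lead_mult[OF lead_euler[OF lead_diff[OF \<zeta> False]] lead_basis[OF \<zeta> False]]
          gap_coeff_ne_0[OF \<zeta> False] False
        by (simp add: \<kappa>_def d_def mult.commute)
    qed
  qed
  hence *: "lead (\<Sum>\<zeta>\<in>mu N. fps_to_fls (q oo twist \<zeta> e) *
      fps_to_fls (fps_X * fps_deriv (\<phi> - conjugate \<zeta>)) * basis \<zeta>) (int (e * s) + int b)
      (\<Sum>\<zeta>\<in>mu N. (\<zeta> ^ s * q $ s) * (contact_coeff * \<kappa> \<zeta>))"
    unfolding mult.assoc by (rule lead_sum)
  obtain m :: nat where m: "(\<Sum>\<zeta>\<in>mu N - {1}. of_nat (gap \<zeta>) * (\<zeta> ^ s / \<zeta> ^ d)) + of_nat (b - 1) = (of_nat m :: complex)"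
    using weighted_gap_sum by blast
  have "(\<Sum>\<zeta>\<in>mu N. \<zeta> ^ s * \<kappa> \<zeta>) = of_nat b + (\<Sum>\<zeta>\<in>mu N - {1}. \<zeta> ^ s * \<kappa> \<zeta>)"
    using N_pos by (subst sum.remove[of _ 1]) (simp_all add: \<kappa>_def)
  also have "(\<Sum>\<zeta>\<in>mu N - {1}. \<zeta> ^ s * \<kappa> \<zeta>) = (\<Sum>\<zeta>\<in>mu N - {1}. of_nat (gap \<zeta>) * (\<zeta> ^ s / \<zeta> ^ d))"
    by (intro sum.cong) (simp_all add: \<kappa>_def)
  also have "of_nat b + \<dots> = of_nat (Suc m)"
    using m b_pos by (cases b) (simp_all add: algebra_simps)
  finally have "(\<Sum>\<zeta>\<in>mu N. \<zeta> ^ s * \<kappa> \<zeta>) \<noteq> 0" by (simp only: of_nat_eq_0_iff)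
  moreover have "(\<Sum>\<zeta>\<in>mu N. (\<zeta> ^ s * q $ s) * (contact_coeff * \<kappa> \<zeta>))
     = q $ s * contact_coeff * (\<Sum>\<zeta>\<in>mu N. \<zeta> ^ s * \<kappa> \<zeta>)"
    by (simp add: sum_distrib_left mult_ac)
  moreover have "q $ s \<noteq> 0" using assms by (simp add: s_def)
  ultimately have "(\<Sum>\<zeta>\<in>mu N. (\<zeta> ^ s * q $ s) * (contact_coeff * \<kappa> \<zeta>)) \<noteq> 0"
    using contact_coeff_ne_0 by simp
  thus ?thesis using * by (auto simp: s_def add.commute)
qed

text \<open>
  Interpolate \<open>A\<close> and \<open>B\<close> separately. The value of the form at the conjugate of \<open>\<zeta>\<close> would need the
  derivative of that conjugate in place of \<open>\<phi>'\<close>; the second sum is the correction.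
\<close>

lemma euler_form_expansion:
  assumes "degree P < N" "degree Q < N"
  shows "fps_to_fls (euler_form (e * N) \<phi> P Q) =
     (\<Sum>\<zeta>\<in>mu N. fps_to_fls (fps_const (of_nat e) * (euler_form N \<psi> P Q oo twist \<zeta> e)) * basis \<zeta>) -
     (\<Sum>\<zeta>\<in>mu N. fps_to_fls (on_branch N \<psi> Q oo twist \<zeta> e) *
        fps_to_fls (fps_X * fps_deriv (\<phi> - conjugate \<zeta>)) * basis \<zeta>)"
proof -
  let ?n = "fps_to_fls (fps_const (of_nat (e * N)) * fps_X ^ (e * N)) :: complex fls"
  let ?E = "\<lambda>a. fps_to_fls (fps_X * fps_deriv a) :: complex fls"
  have "fps_to_fls (euler_form (e * N) \<phi> P Q) =
     ?n * fps_to_fls (on_branch (e * N) \<phi> P) - fps_to_fls (on_branch (e * N) \<phi> Q) * ?E \<phi>"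
    by (simp add: euler_form_def fls_times_fps_to_fls)
  also have "\<dots> = (\<Sum>\<zeta>\<in>mu N. (?n * fps_to_fls (on_branch (e * N) (conjugate \<zeta>) P)
       - fps_to_fls (on_branch (e * N) (conjugate \<zeta>) Q) * ?E \<phi>) * basis \<zeta>)"
    unfolding interpolation[OF assms(1)] interpolation[OF assms(2)]
    by (simp add: sum_distrib_left sum_distrib_right sum_subtractf[symmetric] algebra_simps)
  also have "\<dots> = (\<Sum>\<zeta>\<in>mu N. fps_to_fls (euler_form (e * N) (conjugate \<zeta>) P Q) * basis \<zeta> -
       fps_to_fls (on_branch (e * N) (conjugate \<zeta>) Q) * ?E (\<phi> - conjugate \<zeta>) * basis \<zeta>)"
    by (intro sum.cong refl)
       (simp add: euler_form_def fls_times_fps_to_fls algebra_simps)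
  also have "\<dots> = (\<Sum>\<zeta>\<in>mu N. fps_to_fls (fps_const (of_nat e) * (euler_form N \<psi> P Q oo twist \<zeta> e)) * basis \<zeta> -
     fps_to_fls (on_branch N \<psi> Q oo twist \<zeta> e) * ?E (\<phi> - conjugate \<zeta>) * basis \<zeta>)"
    by (intro sum.cong refl)
       (simp only: on_branch_conjugate, simp only: conjugate_def euler_form_compose_twist[OF e_pos N_pos])
  finally show ?thesis by (simp only: sum_subtractf)
qed

lemma form_value_small:
  assumes "degree P < N" "degree Q < N" "euler_form N \<psi> P Q \<noteq> 0"
    and "on_branch N \<psi> Q \<noteq> 0 \<Longrightarrow> e * subdegree (euler_form N \<psi> P Q) < b + e * subdegree (on_branch N \<psi> Q)"
  shows "euler_form (e * N) \<phi> P Q \<noteq> 0"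
    "subdegree (euler_form (e * N) \<phi> P Q) = e * subdegree (euler_form N \<psi> P Q)"
proof -
  let ?w = "euler_form N \<psi> P Q"
  let ?S = "\<Sum>\<zeta>\<in>mu N. fps_to_fls (on_branch N \<psi> Q oo twist \<zeta> e) *
        fps_to_fls (fps_X * fps_deriv (\<phi> - conjugate \<zeta>)) * basis \<zeta>"
  have "lead ?S (int (e * subdegree ?w)) 0"
  proof (cases "on_branch N \<psi> Q = 0")
    case True
    thus ?thesis by (simp add: lead_def)
  next
    case False
    from lead_correction[OF this] obtain c where
      "lead ?S (int (b + e * subdegree (on_branch N \<psi> Q))) c" by blast
    thus ?thesis
      by (rule lead_weaken) (use assms(4)[OF False] in \<open>simp only: of_nat_less_iff\<close>)
  qed
  from lead_add[OF lead_interpolation[of "of_nat e" ?w] lead_uminus[OF this]]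
  have "lead (fps_to_fls (euler_form (e * N) \<phi> P Q)) (int (e * subdegree ?w)) (of_nat e * ?w $ subdegree ?w)"
    unfolding euler_form_expansion[OF assms(1,2)] by simp
  from lead_fps_subdegree[OF this] assms(3) e_pos
  show "euler_form (e * N) \<phi> P Q \<noteq> 0"
    "subdegree (euler_form (e * N) \<phi> P Q) = e * subdegree (euler_form N \<psi> P Q)" by simp_all
qed

lemma form_value_large:
  assumes "degree P < N" "degree Q < N" "on_branch N \<psi> Q \<noteq> 0"
    and "euler_form N \<psi> P Q \<noteq> 0 \<Longrightarrow> b + e * subdegree (on_branch N \<psi> Q) < e * subdegree (euler_form N \<psi> P Q)"
  shows "euler_form (e * N) \<phi> P Q \<noteq> 0"
    "subdegree (euler_form (e * N) \<phi> P Q) = b + e * subdegree (on_branch N \<psi> Q)"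
proof -
  let ?w = "euler_form N \<psi> P Q" and ?d = "b + e * subdegree (on_branch N \<psi> Q)"
  let ?S = "\<Sum>\<zeta>\<in>mu N. fps_to_fls (fps_const (of_nat e) * (?w oo twist \<zeta> e)) * basis \<zeta>"
  have "lead ?S (int ?d) 0"
  proof (cases "?w = 0")
    case True
    thus ?thesis by (simp add: lead_def)
  next
    case False
    show ?thesis
      by (rule lead_weaken[OF lead_interpolation])
         (use assms(4)[OF False] in \<open>simp only: of_nat_less_iff\<close>)
  qed
  moreover from lead_correction[OF assms(3)] obtain c where c: "c \<noteq> 0" and
    "lead (\<Sum>\<zeta>\<in>mu N. fps_to_fls (on_branch N \<psi> Q oo twist \<zeta> e) *
        fps_to_fls (fps_X * fps_deriv (\<phi> - conjugate \<zeta>)) * basis \<zeta>) (int ?d) c" by blast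
  ultimately have "lead (fps_to_fls (euler_form (e * N) \<phi> P Q)) (int ?d) (- c)"
    unfolding euler_form_expansion[OF assms(1,2)] diff_conv_add_uminus
    using lead_add[OF _ lead_uminus] by fastforce
  from lead_fps_subdegree[OF this] c
  show "euler_form (e * N) \<phi> P Q \<noteq> 0" "subdegree (euler_form (e * N) \<phi> P Q) = ?d" by simp_all
qed

end

section \<open>Duality for differentials on a branch\<close>

text \<open>
  If no element of a linear space \<open>M\<close> of power series has order \<open>\<alpha>\<close>, then the coefficient
  functional of \<open>t\<^sup>\<alpha>\<close> can be corrected by lower coefficients so as to vanish on \<open>M\<close>. The
  corrections are found by elimination, for \<open>i = \<alpha> - 1, \<alpha> - 2, \<dots>\<close>: an element \<open>p\<close> of \<open>M\<close> of order
  \<open>i\<close> prescribes the weight of the \<open>i\<close>-th coefficient, and without such a \<open>p\<close> there is no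
  condition.
\<close>

lemma separating_functional:
  fixes M :: "complex fps set"
  assumes closed: "\<And>m m' c. m \<in> M \<Longrightarrow> m' \<in> M \<Longrightarrow> m - fps_const c * m' \<in> M"
    and no_order: "\<And>m. m \<in> M \<Longrightarrow> (\<And>i. i < \<alpha> \<Longrightarrow> m $ i = 0) \<Longrightarrow> m $ \<alpha> = 0"
  obtains l :: "nat \<Rightarrow> complex" where "l \<alpha> = 1" "\<And>m. m \<in> M \<Longrightarrow> (\<Sum>j\<le>\<alpha>. l j * m $ j) = 0"
proof -
  have "\<exists>l. l \<alpha> = 1 \<and> (\<forall>m\<in>M. (\<forall>j<\<alpha> - d. m $ j = 0) \<longrightarrow> (\<Sum>j\<le>\<alpha>. l j * m $ j) = 0)"
    if "d \<le> \<alpha>" for d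
    using that
  proof (induction d)
    case 0
    have "(\<Sum>j\<le>\<alpha>. 1 * m $ j) = 0" if "m \<in> M" "\<forall>j<\<alpha>. m $ j = 0" for m
      using that no_order[of m] by (intro sum.neutral) (auto simp: le_less)
    thus ?case by (intro exI[of _ "\<lambda>_. 1"]) simp
  next
    case (Suc d)
    define i where "i = \<alpha> - Suc d"
    have i: "\<alpha> - d = Suc i" "i < \<alpha>" using Suc.prems by (auto simp: i_def)
    from Suc obtain l where l: "l \<alpha> = 1"
      "\<And>m. m \<in> M \<Longrightarrow> (\<And>j. j < Suc i \<Longrightarrow> m $ j = 0) \<Longrightarrow> (\<Sum>j\<le>\<alpha>. l j * m $ j) = 0"
      unfolding i by auto
    show ?case
    proof (cases "\<exists>m\<in>M. (\<forall>j<i. m $ j = 0) \<and> m $ i \<noteq> 0")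
      case False
      hence "(\<Sum>j\<le>\<alpha>. l j * m $ j) = 0" if "m \<in> M" "\<forall>j<i. m $ j = 0" for m
        using that l(2)[of m] by (auto simp: less_Suc_eq)
      thus ?thesis using l(1) unfolding i_def by blast
    next
      case True
      then obtain p where p: "p \<in> M" "\<And>j. j < i \<Longrightarrow> p $ j = 0" "p $ i \<noteq> 0" by blast
      define S where "S = (\<Sum>j\<in>{..\<alpha>} - {i}. l j * p $ j)"
      \<comment> \<open>The weight of index \<open>i\<close> that makes the functional vanish on \<open>p\<close>.\<close>
      define l' where "l' = l(i := - S / p $ i)"
      have split: "(\<Sum>j\<le>\<alpha>. h j * m $ j) = h i * m $ i + (\<Sum>j\<in>{..\<alpha>} - {i}. h j * m $ j)"
        for h :: "nat \<Rightarrow> complex" and m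
        using i(2) by (intro sum.remove) auto
      have "(\<Sum>j\<le>\<alpha>. l' j * m $ j) = 0" if m: "m \<in> M" "\<forall>j<i. m $ j = 0" for m
      proof -
        \<comment> \<open>Subtracting \<open>c p\<close> removes the coefficient of index \<open>i\<close>, so that the weights found so far apply.\<close>
        define c where "c = m $ i / p $ i"
        define r where "r = m - fps_const c * p"
        have r: "r \<in> M" "r $ i = 0" "\<And>j. j < Suc i \<Longrightarrow> r $ j = 0"
          using m p closed by (auto simp: r_def c_def less_Suc_eq)
        have m_eq: "m $ j = r $ j + c * p $ j" for j by (simp add: r_def)
        have "(\<Sum>j\<in>{..\<alpha>} - {i}. l' j * m $ j) = (\<Sum>j\<in>{..\<alpha>} - {i}. l j * r $ j) + c * S"
          unfolding S_def sum_distrib_left sum.distrib[symmetric]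
          by (intro sum.cong) (auto simp: l'_def m_eq algebra_simps)
        also have "(\<Sum>j\<in>{..\<alpha>} - {i}. l j * r $ j) = 0"
          using l(2)[OF r(1) r(3)] split[of l r] r(2) by simp
        finally show ?thesis using split[of l' m] p(3) by (simp add: l'_def c_def)
      qed
      moreover have "l' \<alpha> = 1" using l(1) i(2) by (simp add: l'_def)
      ultimately show ?thesis unfolding i_def by blast
    qed
  qed
  from this[of \<alpha>] that show ?thesis by auto
qed

lemma sum_mu:
  assumes "N > 0"
  shows "(\<Sum>\<zeta>\<in>mu N. \<zeta> ^ i / \<zeta> ^ a) = (if i mod N = a mod N then of_nat N else 0)"
proof -
  have pw: "\<zeta> ^ k = \<zeta> ^ (k mod N)" if "\<zeta> \<in> mu N" for \<zeta> k
  proof -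
    have "\<zeta> ^ k = (\<zeta> ^ N) ^ (k div N) * \<zeta> ^ (k mod N)" by (simp flip: power_mult power_add)
    thus ?thesis using that by (simp add: mu_def)
  qed
  have "(\<forall>\<zeta>\<in>mu N. \<zeta> ^ i / \<zeta> ^ a = 1) \<longleftrightarrow> i mod N = a mod N"
  proof
    assume "i mod N = a mod N"
    hence "\<zeta> ^ i = \<zeta> ^ a" if "\<zeta> \<in> mu N" for \<zeta> using pw[OF that] by metis
    thus "\<forall>\<zeta>\<in>mu N. \<zeta> ^ i / \<zeta> ^ a = 1" using mu_nonzero[OF _ assms] by auto
  next
    assume *: "\<forall>\<zeta>\<in>mu N. \<zeta> ^ i / \<zeta> ^ a = 1"
    define x y where "x = max i a" and "y = min i a"
    have "\<zeta> ^ (x - y) = 1" if "\<zeta> \<in> mu N" for \<zeta>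
    proof -
      have nz: "\<zeta> \<noteq> 0" using that assms by (rule mu_nonzero)
      hence "\<zeta> ^ x = \<zeta> ^ y" using * that by (auto simp: x_def y_def max_def min_def)
      moreover have "\<zeta> ^ x = \<zeta> ^ (x - y) * \<zeta> ^ y"
        by (simp add: x_def y_def flip: power_add)
      ultimately show ?thesis using nz by simp
    qed
    hence "mu N \<subseteq> mu (gcd N (x - y))"
      using power_Gcd_eq_1_iff[OF assms, of _ "{x - y}"] by (auto simp: mu_def)
    hence "card (mu N) \<le> card (mu (gcd N (x - y)))" using assms by (intro card_mono) auto
    hence "N \<le> gcd N (x - y)" using assms by simp
    hence "gcd N (x - y) = N" using assms by (metis dvd_imp_le gcd_dvd1 le_antisym)
    hence "N dvd x - y" by (metis gcd_dvd2)
    hence "x mod N = y mod N" by (simp add: mod_eq_dvd_iff_nat x_def y_def)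
    thus "i mod N = a mod N" by (auto simp: x_def y_def max_def min_def split: if_splits)
  qed
  moreover have "(\<Sum>\<zeta>\<in>mu N. \<zeta> ^ i / \<zeta> ^ a) =
      (if \<forall>\<zeta>\<in>mu N. \<zeta> ^ i / \<zeta> ^ a = 1 then of_nat (card (mu N)) else 0)"
    using assms mu_nonzero[of 0 N]
    by (intro character_sum) (auto simp: mu_def power_mult_distrib)
  ultimately show ?thesis using assms by simp
qed

text \<open>
  The trace of \<open>t\<^sup>-\<^sup>a g\<close> from \<open>\<complex>((t))\<close> to \<open>\<complex>((t\<^sup>N))\<close>, multiplied by \<open>t\<^sup>a\<close> to stay with power series.
\<close>

lemma trace_coefficient:
  assumes "N > 0"
  shows "(\<Sum>\<zeta>\<in>mu N. fps_const (1 / \<zeta> ^ a) * (g oo twist \<zeta> 1)) $ i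
    = (if i mod N = a mod N then of_nat N * g $ i else 0)"
proof -
  have "(\<Sum>\<zeta>\<in>mu N. fps_const (1 / \<zeta> ^ a) * (g oo twist \<zeta> 1)) $ i = (\<Sum>\<zeta>\<in>mu N. \<zeta> ^ i / \<zeta> ^ a) * g $ i"
    by (simp add: fps_sum_nth nth_compose_twist sum_distrib_right)
  thus ?thesis by (simp add: sum_mu[OF assms])
qed

text \<open>
  The coefficients of \<open>p(Y)/(Y - c)\<close>, for a root \<open>c\<close>, are polynomials in \<open>c\<close> with the coefficients
  of \<open>p\<close>.
\<close>

lemma coeff_synthetic_div: "coeff (synthetic_div p c) j = poly (poly_shift (Suc j) p) c"
proof (induction p arbitrary: j)
  case (pCons a p)
  have "poly_shift (Suc i) (pCons a p) = poly_shift i p" for i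
    by (simp add: poly_eq_iff coeff_poly_shift)
  thus ?case using pCons.IH by (cases j) simp_all
qed simp

lemma poly_synthetic_div_other_root:
  fixes p :: "'a::idom poly"
  assumes "poly p a = 0" "poly p b = 0" "a \<noteq> b"
  shows "poly (synthetic_div p a) b = 0"
  using arg_cong[OF synthetic_div_correct'[of a p], of "\<lambda>q. poly q b"] assms by simp

lemma poly_synthetic_div_root:
  fixes p :: "'a::idom poly"
  assumes "poly p a = 0"
  shows "poly (synthetic_div p a) a = poly (pderiv p) a"
proof -
  have "pderiv p = pderiv ([:- a, 1:] * synthetic_div p a)"
    using synthetic_div_correct'[of a p] assms by simp
  thus ?thesis by (simp add: pderiv_mult pderiv_pCons del: mult_pCons_left)
qed

context branch
begin

text \<open>
  The hypothesis says that \<open>t\<^sup>-\<^sup>\<alpha> q \<cdot> dt/t\<close> has residue zero against \<open>x\<close> times the ring of the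
  branch. It implies that \<open>t\<^sup>-\<^sup>\<alpha> q \<cdot> \<partial>F/\<partial>y\<close> belongs to the ring: interpolate it as
  \<open>\<Sum> (t\<^sup>-\<^sup>\<alpha> q)(\<zeta>t) \<cdot> F(Y)/(Y - \<psi>(\<zeta>t))\<close>. The coefficients are traces of elements of the ring times
  \<open>t\<^sup>-\<^sup>\<alpha> q\<close>, and the hypothesis removes their polar parts, so they are power series in \<open>x\<close>.
\<close>

lemma dual_element:
  assumes orth: "\<And>G. (q * fps_X ^ N * on_branch N \<psi> G) $ \<alpha> = 0"
  obtains B where "degree B < N"
    "fps_const (of_nat N) * fps_X ^ \<alpha> * on_branch N \<psi> B = q * different"
proof -
  define g where "g = (\<lambda>j. on_branch N \<psi> (poly_shift (Suc j) F))"
  define C where "C = (\<lambda>j. Abs_fps (\<lambda>l. (q * g j) $ (\<alpha> + N * l)))"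
  define B where "B = (\<Sum>j<N. monom (C j) j)"
  define Fh where "Fh = subst_coeffs (fps_X ^ N) F"
  define y where "y = (\<lambda>\<zeta>. \<psi> oo twist \<zeta> 1)"
  \<comment> \<open>The polar parts of all traces vanish: multiply by powers of \<open>x\<close> to reach every index below \<open>\<alpha>\<close> in its residue class.\<close>
  have vanish: "(q * on_branch N \<psi> G) $ i = 0" if "i < \<alpha>" "i mod N = \<alpha> mod N" for i G
  proof -
    have "N dvd \<alpha> - i" using that mod_eq_dvd_iff_nat[of i \<alpha> N] by simp
    then obtain l where "\<alpha> - i = N * l" by blast
    hence l: "\<alpha> = i + N * l" "l > 0" using that by (auto intro: gr0I)
    have "on_branch N \<psi> (smult (fps_X ^ (l - 1)) G) = fps_X ^ (N * (l - 1)) * on_branch N \<psi> G"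
      using N_pos by (simp add: on_branch_smult fps_compose_power[symmetric] power_mult)
    hence "q * fps_X ^ N * on_branch N \<psi> (smult (fps_X ^ (l - 1)) G)
        = fps_X ^ (N * l) * (q * on_branch N \<psi> G)"
      using l(2) by (cases l) (simp_all add: power_add mult_ac)
    hence "(fps_X ^ (N * l) * (q * on_branch N \<psi> G)) $ (i + N * l) = 0"
      using orth[of "smult (fps_X ^ (l - 1)) G"] unfolding l(1) by metis
    thus ?thesis by (simp add: fps_X_power_mult_nth)
  qed
  have coeff_B: "coeff B j = C j" for j
  proof (cases "j < N")
    case False
    hence "poly_shift (Suc j) F = 0" using degree_F by (simp add: poly_eq_iff coeff_poly_shift coeff_eq_0)
    hence "C j = 0" by (simp add: C_def g_def fps_eq_iff)
    thus ?thesis using False by (simp add: B_def coeff_sum)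
  qed (simp add: B_def coeff_sum sum.delta)
  have rootF: "poly Fh (y \<zeta>) = 0" if "\<zeta> \<in> mu N" for \<zeta>
    using on_branch_compose_twist[of 1 N \<zeta> \<psi> F] that root N_pos by (simp add: on_branch_def Fh_def y_def)
  have sd: "coeff (synthetic_div Fh (y \<zeta>)) j = g j oo twist \<zeta> 1" if "\<zeta> \<in> mu N" for \<zeta> j
  proof -
    have "poly_shift (Suc j) Fh = subst_coeffs (fps_X ^ N) (poly_shift (Suc j) F)"
      by (simp add: Fh_def poly_eq_iff coeff_poly_shift)
    thus ?thesis
      using on_branch_compose_twist[of 1 N \<zeta> \<psi> "poly_shift (Suc j) F"] that N_pos
      by (simp add: coeff_synthetic_div on_branch_def y_def g_def)
  qed
  \<comment> \<open>Both sides are \<open>N t\<^sup>\<alpha>\<close> times the interpolating polynomial; compare coefficients of \<open>Y\<^sup>j t\<^sup>i\<close>.\<close>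
  have eq: "smult (fps_const (of_nat N) * fps_X ^ \<alpha>) (subst_coeffs (fps_X ^ N) B) =
      (\<Sum>\<zeta>\<in>mu N. smult (fps_const (1 / \<zeta> ^ \<alpha>) * (q oo twist \<zeta> 1)) (synthetic_div Fh (y \<zeta>)))"
    (is "?L = ?R")
  proof (rule poly_eqI, rule fps_ext)
    fix j i
    have "coeff ?R j = (\<Sum>\<zeta>\<in>mu N. fps_const (1 / \<zeta> ^ \<alpha>) * ((q * g j) oo twist \<zeta> 1))"
      by (simp add: coeff_sum sd fps_compose_mult_distrib mult.assoc cong: sum.cong)
    hence R: "coeff ?R j $ i = (if i mod N = \<alpha> mod N then of_nat N * (q * g j) $ i else 0)"
      by (simp only: trace_coefficient[OF N_pos])
    have L: "coeff ?L j $ i = of_nat N * (if i < \<alpha> then 0 else (C j oo fps_X ^ N) $ (i - \<alpha>))"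
      by (simp add: coeff_B mult.assoc fps_X_power_mult_nth)
    show "coeff ?L j $ i = coeff ?R j $ i"
    proof (cases "i < \<alpha>")
      case True
      thus ?thesis unfolding L R using vanish[of i "poly_shift (Suc j) F"] by (simp add: g_def)
    next
      case False
      hence "i mod N = \<alpha> mod N \<longleftrightarrow> N dvd i - \<alpha>" by (simp add: mod_eq_dvd_iff_nat)
      moreover have "\<alpha> + N * ((i - \<alpha>) div N) = i" if "N dvd i - \<alpha>" using that False by simp
      ultimately show ?thesis unfolding L R using False
        by (auto simp: fps_nth_compose_X_power C_def)
    qed
  qed
  have "fps_const (of_nat N) * fps_X ^ \<alpha> * on_branch N \<psi> B = poly ?L \<psi>" by (simp add: on_branch_def)
  hence "fps_const (of_nat N) * fps_X ^ \<alpha> * on_branch N \<psi> B =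
     (\<Sum>\<zeta>\<in>mu N. fps_const (1 / \<zeta> ^ \<alpha>) * (q oo twist \<zeta> 1) * poly (synthetic_div Fh (y \<zeta>)) \<psi>)"
    unfolding eq by (simp add: poly_sum)
  also have "\<dots> = (\<Sum>\<zeta>\<in>mu N. if \<zeta> = 1 then q * different else 0)"
  proof (intro sum.cong refl)
    fix \<zeta> assume \<zeta>: "\<zeta> \<in> mu N"
    have y1: "y 1 = \<psi>" "q oo twist 1 1 = q" by (simp_all add: y_def twist_def)
    have "poly (synthetic_div Fh (y \<zeta>)) \<psi> = (if \<zeta> = 1 then different else 0)"
    proof (cases "\<zeta> = 1")
      case True
      have "poly (synthetic_div Fh (y 1)) (y 1) = different"
        using poly_synthetic_div_root[OF rootF[of 1]] N_pos
        by (simp add: different_def on_branch_def subst_coeffs_pderiv Fh_def y1)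
      thus ?thesis using True y1 by simp
    next
      case False
      hence "y \<zeta> \<noteq> y 1"
        using inj_on_conjugates[OF primitive N_pos, of 1] \<zeta> by (auto simp: inj_on_def y_def)
      thus ?thesis using poly_synthetic_div_other_root[OF rootF rootF, of \<zeta> 1] \<zeta> False y1 by simp
    qed
    thus "fps_const (1 / \<zeta> ^ \<alpha>) * (q oo twist \<zeta> 1) * poly (synthetic_div Fh (y \<zeta>)) \<psi> =
       (if \<zeta> = 1 then q * different else 0)" using y1 by simp
  qed
  also have "\<dots> = q * different" using N_pos by simp
  finally have "fps_const (of_nat N) * fps_X ^ \<alpha> * on_branch N \<psi> B = q * different" .
  moreover have "degree B < N"
    unfolding B_def using N_pos
    by (intro degree_sum_less) (auto intro: le_less_trans[OF degree_monom_le])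
  ultimately show ?thesis using that by blast
qed

text \<open>
  Apply the preceding lemma to \<open>q\<close> and to \<open>q t\<psi>'/x\<close>; the two elements of the ring are the
  coefficients of a form that vanishes on the branch. The division by \<open>x = t\<^sup>N\<close> shifts \<open>\<alpha>\<close> to
  \<open>\<alpha> + N\<close>.
\<close>

lemma annihilating_form:
  assumes "q \<noteq> 0" and orth: "\<And>P Q. (q * euler_form N \<psi> P Q) $ \<alpha> = 0"
  obtains A B where "degree A < N" "degree B < N" "euler_form N \<psi> A B = 0" "on_branch N \<psi> B \<noteq> 0"
    "\<alpha> + subdegree (on_branch N \<psi> B) = subdegree q + subdegree different"
proof -
  let ?n = "fps_const (of_nat N) :: complex fps" and ?E = "fps_X * fps_deriv \<psi>"
  have 1: "(q * fps_X ^ N * on_branch N \<psi> G) $ \<alpha> = 0" for G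
  proof -
    have "q * euler_form N \<psi> G 0 = ?n * (q * fps_X ^ N * on_branch N \<psi> G)"
      by (simp add: euler_form_def mult_ac)
    thus ?thesis using orth[of G 0] N_pos by (simp only: fps_mult_left_const_nth mult_eq_0_iff of_nat_eq_0_iff) simp
  qed
  have 2: "((q * ?E) * fps_X ^ N * on_branch N \<psi> G) $ (\<alpha> + N) = 0" for G
  proof -
    have "(q * ?E) * fps_X ^ N * on_branch N \<psi> G = - (fps_X ^ N * (q * euler_form N \<psi> 0 G))"
      by (simp add: euler_form_def mult_ac)
    thus ?thesis using orth[of 0 G] by (simp add: fps_X_power_mult_nth)
  qed
  obtain B where B: "degree B < N" "?n * fps_X ^ \<alpha> * on_branch N \<psi> B = q * different"
    using dual_element[OF 1] by blast
  obtain A where A: "degree A < N" "?n * fps_X ^ (\<alpha> + N) * on_branch N \<psi> A = q * ?E * different"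
    using dual_element[OF 2] by blast
  have "?n * fps_X ^ \<alpha> * (fps_X ^ N * on_branch N \<psi> A) = ?n * fps_X ^ \<alpha> * (on_branch N \<psi> B * ?E)"
    using A(2) B(2) by (simp add: power_add mult_ac)
  hence AB: "fps_X ^ N * on_branch N \<psi> A = on_branch N \<psi> B * ?E"
    using N_pos by simp
  \<comment> \<open>The factor \<open>N\<close> comes from \<open>dx = N t\<^sup>N\<^sup>-\<^sup>1 dt\<close>.\<close>
  define A' where "A' = smult (fps_const (1 / of_nat N)) A"
  have "?n * on_branch N \<psi> A' = on_branch N \<psi> A"
    using N_pos by (simp add: A'_def on_branch_smult mult.assoc[symmetric])
  hence "?n * fps_X ^ N * on_branch N \<psi> A' = fps_X ^ N * on_branch N \<psi> A"
    by (metis mult.assoc mult.commute)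
  hence E0: "euler_form N \<psi> A' B = 0"
    by (simp add: euler_form_def AB)
  have qd: "q * different \<noteq> 0" using assms(1) different_ne_0 by simp
  hence B0: "on_branch N \<psi> B \<noteq> 0" using B(2) by auto
  have "subdegree (?n * fps_X ^ \<alpha> * on_branch N \<psi> B) = \<alpha> + subdegree (on_branch N \<psi> B)"
    using B0 N_pos by (simp add: mult.assoc)
  hence "\<alpha> + subdegree (on_branch N \<psi> B) = subdegree q + subdegree different"
    unfolding B(2) using assms(1) different_ne_0 by simp
  moreover have "degree A' < N" using A(1) by (simp add: A'_def le_less_trans[OF degree_smult_le])
  ultimately show ?thesis using that[of A' B] B(1) E0 B0 by blast
qed

lemma euler_form_diff_smult:
  "euler_form N \<psi> (P - smult (fps_const c) P') (Q - smult (fps_const c) Q')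
    = euler_form N \<psi> P Q - fps_const c * euler_form N \<psi> P' Q'"
  using N_pos by (simp add: euler_form_def on_branch_diff on_branch_smult algebra_simps)

lemma euler_form_nth_0: "euler_form N \<psi> P Q $ 0 = 0"
  using N_pos by (simp add: euler_form_def)

text \<open>
  For \<open>\<delta> \<le> 0\<close> the series \<open>t\<^sup>-\<^sup>\<delta>\<close> is orthogonal to all forms for reasons of order. For positive \<open>\<delta>\<close>
  the weights of a functional that vanishes on all forms and is nonzero on \<open>t\<^sup>\<delta>\<close> are the
  coefficients of a suitable \<open>q\<close>.
\<close>

lemma dual_form:
  assumes "\<And>P Q. euler_form N \<psi> P Q \<noteq> 0 \<Longrightarrow> int (subdegree (euler_form N \<psi> P Q)) \<noteq> \<delta>"
  obtains A B where "degree A < N" "degree B < N" "euler_form N \<psi> A B = 0" "on_branch N \<psi> B \<noteq> 0"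
    "int (subdegree (on_branch N \<psi> B)) = int (subdegree different) - \<delta>"
proof (cases "\<delta> \<le> 0")
  case True
  have "(fps_X ^ nat (- \<delta>) * euler_form N \<psi> P Q) $ 0 = 0" for P Q
    by (simp add: euler_form_nth_0)
  from annihilating_form[OF _ this] obtain A B where
    "degree A < N" "degree B < N" "euler_form N \<psi> A B = 0" "on_branch N \<psi> B \<noteq> 0"
    "subdegree (on_branch N \<psi> B) = nat (- \<delta>) + subdegree different" by auto
  thus ?thesis using that[of A B] True by simp
next
  case False
  define \<alpha> where "\<alpha> = nat \<delta>"
  have \<delta>: "\<delta> = int \<alpha>" using False by (simp add: \<alpha>_def)
  define M where "M = {euler_form N \<psi> P Q | P Q. True}"
  have "m - fps_const c * m' \<in> M" if "m \<in> M" "m' \<in> M" for m m' c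
    using that unfolding M_def mem_Collect_eq by (metis euler_form_diff_smult)
  moreover have "m $ \<alpha> = 0" if "m \<in> M" "\<And>i. i < \<alpha> \<Longrightarrow> m $ i = 0" for m
  proof (rule ccontr)
    assume "m $ \<alpha> \<noteq> 0"
    hence "m \<noteq> 0" "subdegree m = \<alpha>" using that(2) by (auto intro: subdegreeI)
    thus False using that(1) assms unfolding M_def \<delta> by auto
  qed
  ultimately obtain l where l: "l \<alpha> = 1" "\<And>m. m \<in> M \<Longrightarrow> (\<Sum>j\<le>\<alpha>. l j * m $ j) = 0"
    using separating_functional[of M \<alpha>] by blast
  \<comment> \<open>Reversed weights: the coefficient of \<open>q m\<close> at \<open>\<alpha>\<close> is the weighted sum of the coefficients of \<open>m\<close>.\<close>
  define q where "q = Abs_fps (\<lambda>i. l (\<alpha> - i))"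
  have q0: "q $ 0 = 1" by (simp add: q_def l(1))
  have "(q * m) $ \<alpha> = (\<Sum>j\<le>\<alpha>. l j * m $ j)" for m
  proof -
    have "(m * q) $ \<alpha> = (\<Sum>j\<le>\<alpha>. m $ j * l j)"
      unfolding fps_mult_nth atMost_atLeast0 by (intro sum.cong) (auto simp: q_def)
    thus ?thesis by (simp add: mult.commute)
  qed
  hence orth: "(q * euler_form N \<psi> P Q) $ \<alpha> = 0" for P Q
    using l(2)[of "euler_form N \<psi> P Q"] by (auto simp: M_def)
  have q: "q \<noteq> 0" "subdegree q = 0" using q0 by auto
  from annihilating_form[OF q(1) orth] obtain A B where
    "degree A < N" "degree B < N" "euler_form N \<psi> A B = 0" "on_branch N \<psi> B \<noteq> 0"
    "\<alpha> + subdegree (on_branch N \<psi> B) = subdegree different" using q(2) by auto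
  thus ?thesis using that[of A B] by (simp add: \<delta>)
qed

end

section \<open>Characteristic exponents and generators of the semigroup\<close>

locale characteristic =
  fixes f :: "complex fps poly" and \<phi> :: "complex fps"
  assumes n_pos: "degree f > 0" and primitive: "primitive_series (degree f) \<phi>"
begin

text \<open>
  The letters of the theory of plane branches; \<open>ee\<close> and \<open>nn\<close> stand for \<open>e\<^sub>i\<close> and \<open>n\<^sub>i\<close>.
\<close>

abbreviation "n \<equiv> degree f"
abbreviation "ee \<equiv> char_e f \<phi>"
abbreviation "\<beta> \<equiv> char_beta f \<phi>"
abbreviation "nn \<equiv> char_n f \<phi>"
abbreviation "v \<equiv> gen_v f \<phi>"
abbreviation "g \<equiv> genus f \<phi>"

text \<open>
  This is \<open>e\<^sub>i\<close> on the interval from \<open>\<beta>\<^sub>i\<close> (exclusive) to \<open>\<beta>\<^sub>i\<^sub>+\<^sub>1\<close> (inclusive). As the number of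
  \<open>n\<close>-th roots of unity that fix \<open>\<phi>\<close> modulo \<open>t\<^sup>j\<close>, it is the form in which the exponents enter
  orders of contact.
\<close>

definition gcd_below :: "nat \<Rightarrow> nat" where
  "gcd_below j = Gcd (insert n {i. i < j \<and> \<phi> $ i \<noteq> 0})"

lemma ee_Suc_dvd: "ee (Suc i) dvd ee i"
  by simp

lemma ee_dvd: "i \<le> j \<Longrightarrow> ee j dvd ee i"
  by (induction rule: dec_induct) (auto intro: dvd_trans[OF ee_Suc_dvd] simp del: char_e.simps)

lemma ee_pos: "ee i > 0"
  using ee_dvd[of 0 i] n_pos by (auto intro: gr0I)

lemma ee_dvd_n: "ee i dvd n"
  using ee_dvd[of 0 i] by simp

lemma beta_exists: "ee i \<noteq> 1 \<Longrightarrow> \<exists>l. \<phi> $ l \<noteq> 0 \<and> \<not> ee i dvd l"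
proof (rule ccontr)
  assume *: "ee i \<noteq> 1" "\<not> (\<exists>l. \<phi> $ l \<noteq> 0 \<and> \<not> ee i dvd l)"
  hence "ee i dvd Gcd (insert n {i. \<phi> $ i \<noteq> 0})"
    using ee_dvd_n by (intro Gcd_greatest) auto
  thus False using primitive *(1) unfolding primitive_series_def by (simp only: nat_dvd_1_iff_1)
qed

lemma beta_Suc:
  assumes "ee i \<noteq> 1"
  shows "\<phi> $ \<beta> (Suc i) \<noteq> 0" "\<not> ee i dvd \<beta> (Suc i)"
    "\<And>l. l < \<beta> (Suc i) \<Longrightarrow> \<phi> $ l \<noteq> 0 \<Longrightarrow> ee i dvd l"
  using LeastI_ex[OF beta_exists[OF assms]] not_less_Least[of _ "\<lambda>l. \<phi> $ l \<noteq> 0 \<and> \<not> ee i dvd l"]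
  by auto

lemma ee_decreasing: "ee i \<noteq> 1 \<Longrightarrow> ee (Suc i) < ee i"
proof -
  assume "ee i \<noteq> 1"
  from beta_Suc(2)[OF this] have "ee (Suc i) \<noteq> ee i"
    by (metis char_e.simps(2) gcd_dvd2)
  thus ?thesis using dvd_imp_le[OF ee_Suc_dvd ee_pos, of i] by linarith
qed

lemma ee_genus: "ee g = 1" and ee_less_genus: "i < g \<Longrightarrow> ee i \<noteq> 1"
proof -
  have "\<exists>i. ee i = 1"
  proof (rule ccontr)
    assume *: "\<nexists>i. ee i = 1"
    have "ee i + i \<le> ee 0" for i
    proof (induction i)
      case (Suc i)
      thus ?case using ee_decreasing[of i] * by (simp del: char_e.simps)
    qed simp
    from this[of "Suc (ee 0)"] show False by simp
  qed
  from LeastI_ex[OF this] show "ee g = 1" unfolding genus_def .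
  show "ee i \<noteq> 1" if "i < g" using not_less_Least[of i "\<lambda>i. ee i = 1"] that unfolding genus_def by blast
qed

lemma ee_dvd_beta: "ee i dvd \<beta> i"
  by (cases i) auto

lemma beta_less:
  assumes "0 < i" "i < g"
  shows "\<beta> i < \<beta> (Suc i)"
proof (rule ccontr)
  assume nless: "\<not> \<beta> i < \<beta> (Suc i)"
  obtain h where h: "i = Suc h" using assms by (cases i) auto
  note b = beta_Suc[OF ee_less_genus[OF assms(2)]]
  have "\<beta> (Suc i) \<noteq> \<beta> i" using b(2) ee_dvd_beta[of i] by metis
  hence "\<beta> (Suc i) < \<beta> (Suc h)" using nless unfolding h by linarith
  moreover have "ee h \<noteq> 1" using assms h by (intro ee_less_genus) simp
  ultimately have "ee h dvd \<beta> (Suc i)" using beta_Suc(3)[of h] b(1) by blast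
  hence "ee i dvd \<beta> (Suc i)" using ee_dvd[of h i] h dvd_trans by auto
  thus False using b(2) by blast
qed

lemma beta_mono:
  assumes "0 < i" "i \<le> j" "j \<le> g"
  shows "\<beta> i \<le> \<beta> j"
  using assms(2,3)
proof (induction rule: dec_induct)
  case (step m)
  thus ?case using beta_less[of m] assms(1) by (simp del: char_beta.simps)
qed simp

lemma gcd_below_eq:
  assumes "i < g" "i = 0 \<or> \<beta> i < j" "j \<le> \<beta> (Suc i)"
  shows "gcd_below j = ee i"
proof (rule dvd_antisym)
  show "ee i dvd gcd_below j" unfolding gcd_below_def
    using ee_dvd_n beta_Suc(3)[OF ee_less_genus[OF assms(1)]] assms(3) by (intro Gcd_greatest) auto
  have "gcd_below j dvd ee m" if "m \<le> i" for m
    using that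
  proof (induction m)
    case 0
    thus ?case unfolding gcd_below_def by (simp add: Gcd_dvd_nat)
  next
    case (Suc m)
    have "\<beta> (Suc m) \<le> \<beta> i" using Suc.prems assms(1) by (intro beta_mono) auto
    hence "\<beta> (Suc m) < j" using assms(2) Suc.prems by auto
    moreover have "\<phi> $ \<beta> (Suc m) \<noteq> 0"
      using Suc.prems assms(1) by (intro beta_Suc ee_less_genus) simp
    ultimately have "gcd_below j dvd \<beta> (Suc m)"
      unfolding gcd_below_def by (intro Gcd_dvd_nat) (simp del: char_beta.simps)
    thus ?case using Suc by simp
  qed
  thus "gcd_below j dvd ee i" by simp
qed

lemma gcd_below_pos: "gcd_below j > 0"
proof -
  have "gcd_below j dvd n" unfolding gcd_below_def by (simp add: Gcd_dvd_nat)
  thus ?thesis using n_pos by (auto intro: gr0I)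
qed

lemma ee_Suc_nn: "ee (Suc i) * nn (Suc i) = ee i"
  unfolding char_n_def using ee_Suc_dvd[of i] by (simp del: char_e.simps)

lemma prod_nn: "ee k * (\<Prod>i\<le>k. nn i) = n"
proof (induction k)
  case (Suc k)
  have "ee (Suc k) * (\<Prod>i\<le>Suc k. nn i) = (ee (Suc k) * nn (Suc k)) * (\<Prod>i\<le>k. nn i)"
    by (simp del: char_e.simps add: mult_ac)
  thus ?case using Suc by (simp only: ee_Suc_nn)
qed (simp add: char_n_def)

lemma v_Suc:
  assumes "i < g"
  shows "v (Suc i) + \<beta> i = nn i * v i + \<beta> (Suc i)"
proof (cases "i = 0")
  case False
  thus ?thesis using beta_less[OF _ assms] by simp
qed (simp add: char_n_def)

text \<open>
  The recursion for \<open>v\<^sub>i\<close> multiplied by \<open>e\<^sub>i\<close> adds \<open>e\<^sub>i\<close> for each integer between \<open>\<beta>\<^sub>i\<close> and \<open>\<beta>\<^sub>i\<^sub>+\<^sub>1\<close>.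
\<close>

lemma ee_mult_v: 
  assumes "i < g"
  shows "ee i * v (Suc i) = (\<Sum>j=1..\<beta> (Suc i). gcd_below j)"
  using assms
proof (induction i)
  case 0
  have "(\<Sum>j=1..\<beta> (Suc 0). gcd_below j) = (\<Sum>j=1..\<beta> (Suc 0). ee 0)"
    using 0 by (intro sum.cong refl gcd_below_eq) auto
  thus ?case by (simp add: char_n_def)
next
  case (Suc i)
  have lt: "\<beta> (Suc i) < \<beta> (Suc (Suc i))" using Suc.prems by (intro beta_less) auto
  have "(\<Sum>j=1..\<beta> (Suc (Suc i)). gcd_below j) =
     (\<Sum>j=1..\<beta> (Suc i). gcd_below j) + (\<Sum>j=Suc (\<beta> (Suc i))..\<beta> (Suc (Suc i)). gcd_below j)"
    using sum.ub_add_nat[of 1 "\<beta> (Suc i)" gcd_below "\<beta> (Suc (Suc i)) - \<beta> (Suc i)"] lt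
    by (simp del: char_beta.simps)
  also have "(\<Sum>j=Suc (\<beta> (Suc i))..\<beta> (Suc (Suc i)). gcd_below j) = (\<Sum>j=Suc (\<beta> (Suc i))..\<beta> (Suc (Suc i)). ee (Suc i))"
    using Suc.prems by (intro sum.cong) (auto intro!: gcd_below_eq simp del: char_beta.simps char_e.simps)
  also have "\<dots> = (\<beta> (Suc (Suc i)) - \<beta> (Suc i)) * ee (Suc i)"
    by (simp del: char_beta.simps char_e.simps)
  also have "(\<Sum>j=1..\<beta> (Suc i). gcd_below j) = ee (Suc i) * (nn (Suc i) * v (Suc i))"
    using Suc ee_Suc_nn[of i] by (simp del: gen_v.simps char_e.simps char_beta.simps add: mult.assoc[symmetric])
  finally have *: "(\<Sum>j=1..\<beta> (Suc (Suc i)). gcd_below j) =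
      ee (Suc i) * (nn (Suc i) * v (Suc i) + (\<beta> (Suc (Suc i)) - \<beta> (Suc i)))"
    by (simp only: distrib_left mult.commute)
  have "v (Suc (Suc i)) = nn (Suc i) * v (Suc i) + (\<beta> (Suc (Suc i)) - \<beta> (Suc i))"
    using v_Suc[OF Suc.prems] lt by linarith
  thus ?case unfolding * by (simp only:)
qed

lemma ee_dvd_v: "i \<le> g \<Longrightarrow> ee i dvd v i"
proof (induction i)
  case (Suc i)
  have "ee (Suc i) dvd nn i * v i + \<beta> (Suc i)"
    using Suc ee_Suc_dvd[of i] ee_dvd_beta[of "Suc i"] by (intro dvd_add dvd_mult) (auto intro: dvd_trans simp del: char_e.simps char_beta.simps)
  moreover have "ee (Suc i) dvd \<beta> i" using ee_Suc_dvd ee_dvd_beta dvd_trans by blast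
  ultimately show ?case using v_Suc[of i] Suc.prems
    by (metis Suc_le_lessD dvd_add_left_iff)
qed simp

text \<open>
  Modulo \<open>e\<^sub>i\<close> the generator \<open>v\<^sub>i\<^sub>+\<^sub>1\<close> is \<open>\<beta>\<^sub>i\<^sub>+\<^sub>1\<close>.
\<close>

lemma gcd_ee_v:
  assumes "i < g"
  shows "gcd (ee i) (v (Suc i)) = ee (Suc i)"
proof -
  have "ee i dvd nn i * v i" using ee_dvd_v[of i] assms by simp
  then obtain a where a: "nn i * v i = ee i * a" by blast
  obtain c where c: "\<beta> i = ee i * c" using ee_dvd_beta by blast
  have "gcd (ee i) (v (Suc i)) = gcd (ee i) (c * ee i + v (Suc i))"
    by (simp only: gcd_add_mult)
  also have "c * ee i + v (Suc i) = a * ee i + \<beta> (Suc i)"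
    using v_Suc[OF assms] unfolding a c by (simp only: mult.commute add.commute)
  also have "gcd (ee i) (a * ee i + \<beta> (Suc i)) = ee (Suc i)"
    by (simp only: gcd_add_mult char_e.simps)
  finally show ?thesis .
qed

lemma dvd_mult_v_imp:
  assumes "i < g" "int (ee i) dvd a * int (v (Suc i))"
  shows "int (nn (Suc i)) dvd a"
proof -
  let ?d = "ee (Suc i)"
  obtain w where w: "v (Suc i) = ?d * w"
    using gcd_dvd2[of "ee i" "v (Suc i)"] unfolding gcd_ee_v[OF assms(1)] by blast
  have d: "?d > 0" by (rule ee_pos)
  have "?d * gcd (nn (Suc i)) w = ?d"
    using gcd_ee_v[OF assms(1)] unfolding ee_Suc_nn[of i, symmetric] w
    by (simp only: gcd_mult_distrib_nat[symmetric] ee_Suc_nn) (metis ee_Suc_nn gcd_mult_distrib_nat)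
  hence "coprime (nn (Suc i)) w" using d by (simp add: coprime_iff_gcd_eq_1 del: char_e.simps)
  hence cop: "coprime (int (nn (Suc i))) (int w)" by simp
  have "int ?d * int (nn (Suc i)) dvd int ?d * (a * int w)"
    using assms(2) unfolding ee_Suc_nn[of i, symmetric] w by (simp only: of_nat_mult mult_ac)
  hence "int (nn (Suc i)) dvd a * int w" using d by (subst (asm) dvd_mult_cancel_left) (simp del: char_e.simps)
  thus ?thesis using cop coprime_dvd_mult_left_iff by blast
qed

lemma ee_dvd_v_le: "i \<le> j \<Longrightarrow> j \<le> g \<Longrightarrow> ee j dvd v i"
  using ee_dvd_v[of i] ee_dvd[of i j] dvd_trans by auto

text \<open>
  All terms but the last are divisible by \<open>e\<^sub>G\<close>, and \<open>v\<^sub>G\<^sub>+\<^sub>1\<close> has order \<open>n\<^sub>G\<^sub>+\<^sub>1\<close> modulo \<open>e\<^sub>G\<close>. So the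
  last coefficient is determined.
\<close>

lemma representation_unique:
  assumes "k \<le> G" "G \<le> g"
    and "\<And>i. i \<in> {k+1..G} \<Longrightarrow> 0 \<le> s i \<and> s i < int (nn i)"
    and "\<And>i. i \<in> {k+1..G} \<Longrightarrow> 0 \<le> s' i \<and> s' i < int (nn i)"
    and "(\<Sum>i=k+1..G. s i * int (v i)) + int (ee k) * z = (\<Sum>i=k+1..G. s' i * int (v i)) + int (ee k) * z'"
  shows "z = z' \<and> (\<forall>i\<in>{k+1..G}. s i = s' i)"
  using assms
proof (induction G rule: dec_induct)
  case base
  thus ?case using ee_pos[of k] by simp
next
  case (step G)
  have dvd: "int (ee G) dvd (\<Sum>i=k+1..G. t i * int (v i)) + int (ee k) * y" for t y
  proof (rule dvd_add)
    show "int (ee G) dvd (\<Sum>i=k+1..G. t i * int (v i))"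
    proof (intro dvd_sum dvd_mult)
      fix i assume "i \<in> {k+1..G}"
      hence "ee G dvd v i" using step.prems(1) by (intro ee_dvd_v_le) auto
      thus "int (ee G) dvd int (v i)" by (simp only: int_dvd_int_iff)
    qed
    show "int (ee G) dvd int (ee k) * y"
      using ee_dvd[OF step.hyps(1)] by (intro dvd_mult2) (simp only: int_dvd_int_iff)
  qed
  have sum_Suc: "(\<Sum>i=k+1..Suc G. t i * int (v i)) = (\<Sum>i=k+1..G. t i * int (v i)) + t (Suc G) * int (v (Suc G))" for t
    using step.hyps by (simp del: gen_v.simps)
  have diff: "(s (Suc G) - s' (Suc G)) * int (v (Suc G)) =
     ((\<Sum>i=k+1..G. s' i * int (v i)) + int (ee k) * z') - ((\<Sum>i=k+1..G. s i * int (v i)) + int (ee k) * z)"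
    using step.prems(4) unfolding sum_Suc by (simp add: algebra_simps del: gen_v.simps char_e.simps)
  have "int (ee G) dvd (s (Suc G) - s' (Suc G)) * int (v (Suc G))"
    unfolding diff by (intro dvd_diff dvd)
  hence "int (nn (Suc G)) dvd s (Suc G) - s' (Suc G)"
    using step.prems(1) by (intro dvd_mult_v_imp) simp_all
  moreover have "\<bar>s (Suc G) - s' (Suc G)\<bar> < int (nn (Suc G))"
    using step.prems(2,3)[of "Suc G"] step.hyps by auto
  ultimately have eq: "s (Suc G) = s' (Suc G)"
    using zdvd_not_zless[of "\<bar>s (Suc G) - s' (Suc G)\<bar>" "int (nn (Suc G))"] by (cases "s (Suc G) = s' (Suc G)") auto
  have "z = z' \<and> (\<forall>i\<in>{k+1..G}. s i = s' i)"
  proof (rule step.IH)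
    show "(\<Sum>i=k+1..G. s i * int (v i)) + int (ee k) * z = (\<Sum>i=k+1..G. s' i * int (v i)) + int (ee k) * z'"
      using step.prems(4) eq unfolding sum_Suc by simp
  qed (use step.prems in auto)
  thus ?case using eq by (auto simp: le_Suc_eq)
qed

end

section \<open>Contact of semiroots\<close>

lemma subdegree_prod_fps:
  fixes h :: "'i \<Rightarrow> complex fps"
  assumes "\<And>i. i \<in> S \<Longrightarrow> h i \<noteq> 0"
  shows "subdegree (\<Prod>i\<in>S. h i) = (\<Sum>i\<in>S. subdegree (h i))"
proof (cases "finite S")
  case True
  thus ?thesis using assms by (induction S) auto
qed simp

lemma le_subdegree_iff:
  fixes h :: "complex fps"
  assumes "h \<noteq> 0"
  shows "j \<le> subdegree h \<longleftrightarrow> (\<forall>l<j. h $ l = 0)"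
  using subdegree_geI[OF assms, of j] nth_less_subdegree_zero[of _ h] by (metis less_le_trans)

lemma Gcd_exponents_scale:
  assumes "e > 0" "\<And>l. l < j \<Longrightarrow> \<phi> $ l = (\<theta> oo twist 1 e) $ l"
  shows "e * Gcd (insert N {i. e * i < j \<and> \<theta> $ i \<noteq> 0}) = Gcd (insert (e * N) {i. i < j \<and> \<phi> $ i \<noteq> 0})"
proof -
  have "(*) e ` {i. e * i < j \<and> \<theta> $ i \<noteq> 0} = {i. i < j \<and> \<phi> $ i \<noteq> 0}"
    using assms by (auto simp: nth_compose_twist image_iff elim!: dvdE split: if_splits)
  hence "Gcd (insert (e * N) {i. i < j \<and> \<phi> $ i \<noteq> 0}) = Gcd ((*) e ` insert N {i. e * i < j \<and> \<theta> $ i \<noteq> 0})"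
    by (simp only: image_insert)
  thus ?thesis by (simp only: Gcd_mult normalize_nat_def id_apply)
qed

text \<open>
  Count the conjugates by level sets. Up to the maximal order of contact \<open>c\<close>, which is attained by
  \<open>\<theta>(t\<^sup>e)\<close>, the conjugates that agree with \<open>\<phi>\<close> modulo \<open>t\<^sup>j\<close> correspond to the roots of unity killed
  by the exponents below \<open>j\<close>, and these exponents are the same for \<open>\<phi>\<close> and for \<open>\<theta>(t\<^sup>e)\<close>.
\<close>

lemma contact_sum:
  assumes "e > 0" "N > 0"
    and ne: "\<And>\<zeta>. \<zeta> \<in> mu N \<Longrightarrow> \<phi> - (\<theta> oo twist \<zeta> e) \<noteq> 0"
    and le: "\<And>\<zeta>. \<zeta> \<in> mu N \<Longrightarrow> subdegree (\<phi> - (\<theta> oo twist \<zeta> e)) \<le> c"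
    and c: "c = subdegree (\<phi> - (\<theta> oo twist 1 e))"
  shows "e * (\<Sum>\<zeta>\<in>mu N. subdegree (\<phi> - (\<theta> oo twist \<zeta> e)))
    = (\<Sum>j=1..c. Gcd (insert (e * N) {i. i < j \<and> \<phi> $ i \<noteq> 0}))"
proof -
  define o' where "o' = (\<lambda>\<zeta>. subdegree (\<phi> - (\<theta> oo twist \<zeta> e)))"
  have agree: "\<phi> $ l = (\<theta> oo twist 1 e) $ l" if "l < c" for l
    using nth_less_subdegree_zero[of l "\<phi> - (\<theta> oo twist 1 e)"] that by (simp add: c)
  have level: "{\<zeta>\<in>mu N. j \<le> o' \<zeta>} = mu (Gcd (insert N {i. e * i < j \<and> \<theta> $ i \<noteq> 0}))" if "j \<le> c" for j
  proof -
    have "j \<le> o' \<zeta> \<longleftrightarrow> (\<forall>i. e * i < j \<and> \<theta> $ i \<noteq> 0 \<longrightarrow> \<zeta> ^ i = 1)" if \<zeta>: "\<zeta> \<in> mu N" for \<zeta>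
    proof -
      have "j \<le> o' \<zeta> \<longleftrightarrow> (\<forall>l<j. (\<theta> oo twist 1 e) $ l = (\<theta> oo twist \<zeta> e) $ l)"
        unfolding o'_def le_subdegree_iff[OF ne[OF \<zeta>]] using agree \<open>j \<le> c\<close> by simp
      also have "\<dots> \<longleftrightarrow> (\<forall>i. e * i < j \<and> \<theta> $ i \<noteq> 0 \<longrightarrow> \<zeta> ^ i = 1)"
      proof safe
        fix i assume *: "\<forall>l<j. (\<theta> oo twist 1 e) $ l = (\<theta> oo twist \<zeta> e) $ l" "e * i < j" "\<theta> $ i \<noteq> 0"
        from *(1)[rule_format, OF *(2)] *(3) assms(1) show "\<zeta> ^ i = 1" by (simp add: nth_compose_twist)
      next
        fix l assume *: "\<forall>i. e * i < j \<and> \<theta> $ i \<noteq> 0 \<longrightarrow> \<zeta> ^ i = 1" "l < j"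
        show "(\<theta> oo twist 1 e) $ l = (\<theta> oo twist \<zeta> e) $ l"
        proof (cases "e dvd l")
          case True
          then obtain i where "l = e * i" by blast
          thus ?thesis using * assms(1) by (cases "\<theta> $ i = 0") (auto simp: nth_compose_twist)
        qed (simp add: nth_compose_twist assms(1))
      qed
      finally show ?thesis .
    qed
    thus ?thesis using power_Gcd_eq_1_iff[OF assms(2), of _ "{i. e * i < j \<and> \<theta> $ i \<noteq> 0}"]
      by (auto simp: mu_def)
  qed
  have "(\<Sum>\<zeta>\<in>mu N. o' \<zeta>) = (\<Sum>\<zeta>\<in>mu N. \<Sum>j=1..c. if j \<le> o' \<zeta> then 1 else 0)"
  proof (intro sum.cong refl)
    fix \<zeta> assume "\<zeta> \<in> mu N"
    hence "{j\<in>{1..c}. j \<le> o' \<zeta>} = {1..o' \<zeta>}" using le[of \<zeta>] by (auto simp: o'_def)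
    thus "o' \<zeta> = (\<Sum>j=1..c. if j \<le> o' \<zeta> then 1 else 0)"
      by (simp flip: sum.inter_filter)
  qed
  also have "\<dots> = (\<Sum>j=1..c. card {\<zeta>\<in>mu N. j \<le> o' \<zeta>})"
    using assms(2) by (subst sum.swap) (simp flip: sum.inter_filter)
  also have "\<dots> = (\<Sum>j=1..c. Gcd (insert N {i. e * i < j \<and> \<theta> $ i \<noteq> 0}))"
  proof (intro sum.cong refl)
    fix j assume "j \<in> {1..c}"
    have "Gcd (insert N {i. e * i < j \<and> \<theta> $ i \<noteq> 0}) dvd N" by (simp add: Gcd_dvd_nat)
    hence "Gcd (insert N {i. e * i < j \<and> \<theta> $ i \<noteq> 0}) > 0" using assms(2) by (auto intro: gr0I)
    thus "card {\<zeta>\<in>mu N. j \<le> o' \<zeta>} = Gcd (insert N {i. e * i < j \<and> \<theta> $ i \<noteq> 0})"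
      using level[of j] \<open>j \<in> {1..c}\<close> by (simp only: atLeastAtMost_iff card_mu)
  qed
  finally have "e * (\<Sum>\<zeta>\<in>mu N. o' \<zeta>) = (\<Sum>j=1..c. e * Gcd (insert N {i. e * i < j \<and> \<theta> $ i \<noteq> 0}))"
    by (simp only: sum_distrib_left)
  also have "\<dots> = (\<Sum>j=1..c. Gcd (insert (e * N) {i. i < j \<and> \<phi> $ i \<noteq> 0}))"
    by (intro sum.cong refl Gcd_exponents_scale assms agree) auto
  finally show ?thesis by (simp only: o'_def)
qed

lemma subst_coeffs_prod:
  "\<sigma> $ 0 = 0 \<Longrightarrow> subst_coeffs \<sigma> (\<Prod>i\<in>S. p i) = (\<Prod>i\<in>S. subst_coeffs \<sigma> (p i))"
  by (induction S rule: infinite_finite_induct) (simp_all add: subst_coeffs_mult)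

lemma subst_coeffs_conjugate_prod:
  assumes "e > 0"
  shows "subst_coeffs (twist \<omega> e) (conjugate_prod N 1 \<theta>) = (\<Prod>\<zeta>\<in>mu N. [:- (\<theta> oo twist (\<zeta> * \<omega>) e), 1:])"
  unfolding conjugate_prod_def
  by (simp add: subst_coeffs_prod assms fps_compose_uminus compose_twist_mult[OF assms, unfolded One_nat_def])

text \<open>
  The coefficients of the product of all conjugates are invariant under \<open>t \<mapsto> \<omega>t\<close> for \<open>\<omega>\<^sup>N = 1\<close>,
  hence they are power series in \<open>x = t\<^sup>N\<close>.
\<close>

lemma conjugate_prod_descends:
  assumes "N > 0"
  obtains F where "subst_coeffs (fps_X ^ N) F = conjugate_prod N 1 \<theta>" "lead_coeff F = 1" "degree F = N"
proof -
  let ?P = "conjugate_prod N 1 \<theta>"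
  have inv: "subst_coeffs (twist \<omega> 1) ?P = ?P" if \<omega>: "\<omega> \<in> mu N" for \<omega>
  proof -
    have "\<omega> \<noteq> 0" using \<omega> assms by (rule mu_nonzero)
    hence inj: "inj_on (\<lambda>\<zeta>. \<zeta> * \<omega>) (mu N)" by (auto simp: inj_on_def)
    have im: "(\<lambda>\<zeta>. \<zeta> * \<omega>) ` mu N = mu N"
      using \<omega> assms inj by (intro card_subset_eq) (auto simp: card_image mu_def[of N] power_mult_distrib finite_roots_unity)
    have "subst_coeffs (twist \<omega> 1) ?P = (\<Prod>\<zeta>\<in>mu N. [:- (\<theta> oo twist (\<zeta> * \<omega>) 1), 1:])"
      by (rule subst_coeffs_conjugate_prod) simp
    also have "\<dots> = ?P"
      using prod.reindex[OF inj, of "\<lambda>\<zeta>. [:- (\<theta> oo twist \<zeta> 1), 1:]"]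
      unfolding conjugate_prod_def im by (simp only: o_def)
    finally show ?thesis .
  qed
  have zero: "coeff ?P j $ i = 0" if "\<not> N dvd i" for i j
  proof -
    have "\<exists>\<omega>\<in>mu N. \<omega> ^ i \<noteq> 1"
    proof (rule ccontr)
      assume *: "\<not> (\<exists>\<omega>\<in>mu N. \<omega> ^ i \<noteq> 1)"
      have "(\<Sum>\<zeta>\<in>mu N. \<zeta> ^ i / \<zeta> ^ 0) = (\<Sum>\<zeta>\<in>mu N. 1)"
        using * by (intro sum.cong) auto
      moreover have "i mod N \<noteq> 0 mod N" using that by (simp add: mod_eq_0_iff_dvd)
      ultimately show False using sum_mu[OF assms, of i 0] assms by simp
    qed
    then obtain \<omega> where \<omega>: "\<omega> \<in> mu N" "\<omega> ^ i \<noteq> 1" by blast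
    have "coeff ?P j oo twist \<omega> 1 = coeff ?P j"
      using inv[OF \<omega>(1)] by (metis coeff_subst_coeffs)
    hence "(coeff ?P j oo twist \<omega> 1) $ i = coeff ?P j $ i" by simp
    thus ?thesis using \<omega>(2) by (simp add: nth_compose_twist)
  qed
  define F where "F = map_poly (\<lambda>c. Abs_fps (\<lambda>l. c $ (N * l))) ?P"
  have cF: "coeff F j = Abs_fps (\<lambda>l. coeff ?P j $ (N * l))" for j
    unfolding F_def by (subst coeff_map_poly) (simp_all add: fps_eq_iff)
  have F: "subst_coeffs (fps_X ^ N) F = ?P"
  proof (rule poly_eqI, rule fps_ext)
    fix j i
    show "coeff (subst_coeffs (fps_X ^ N) F) j $ i = coeff ?P j $ i"
      using zero[of i j] by (auto simp: cF fps_nth_compose_X_power)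
  qed
  have degP: "degree ?P = N"
    unfolding conjugate_prod_def using assms by (simp add: degree_prod_eq_sum_degree)
  have "lead_coeff ?P = 1" unfolding conjugate_prod_def lead_coeff_prod by simp
  note degP = degP this[unfolded degP]
  have "coeff F j = (if j = N then 1 else 0)" if "j \<ge> N" for j
    using that degP assms by (auto simp: cF coeff_eq_0 fps_eq_iff)
  hence 1: "coeff F N = 1" "degree F \<le> N" by (auto intro: degree_le)
  hence "degree F = N" by (metis le_antisym le_degree one_neq_zero)
  thus ?thesis using that F 1 by simp
qed

lemma on_branch_descended:
  assumes "e > 0" "N > 0" "subst_coeffs (fps_X ^ N) F = conjugate_prod N 1 \<theta>"
  shows "on_branch (e * N) \<phi> F = (\<Prod>\<zeta>\<in>mu N. \<phi> - (\<theta> oo twist \<zeta> e))"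
proof -
  have "fps_X ^ N oo twist 1 e = fps_X ^ (e * N)" using assms by (intro X_power_compose_twist) simp_all
  hence "c oo fps_X ^ (e * N) = c oo fps_X ^ N oo twist 1 e" for c
    using assms fps_compose_assoc[of "twist 1 e" "fps_X ^ N" c] by simp
  hence "subst_coeffs (fps_X ^ (e * N)) F = subst_coeffs (twist 1 e) (subst_coeffs (fps_X ^ N) F)"
    by (intro poly_eqI) (simp only: coeff_subst_coeffs)
  also have "\<dots> = conjugate_prod N e \<theta>"
    unfolding assms(3) subst_coeffs_conjugate_prod[OF assms(1)] by (simp add: conjugate_prod_def)
  finally show ?thesis by (simp add: on_branch_def conjugate_prod_def poly_prod)
qed

lemma branch_rotate:
  assumes "branch N \<theta> F" "\<omega> \<in> mu N"
  shows "branch N (\<theta> oo twist \<omega> 1) F"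
proof -
  interpret branch N \<theta> F by fact
  have "{i. (\<theta> oo twist \<omega> 1) $ i \<noteq> 0} = {i. \<theta> $ i \<noteq> 0}"
    using mu_ne_0[OF assms(2)] by (simp add: nth_compose_twist)
  hence "primitive_series N (\<theta> oo twist \<omega> 1)" using primitive by (simp only: primitive_series_def)
  moreover have "on_branch N (\<theta> oo twist \<omega> 1) F = 0"
    using on_branch_compose_twist[OF zero_less_one N_pos assms(2), of \<theta> F] root by simp
  ultimately show ?thesis using N_pos monic degree_F by unfold_locales
qed

context characteristic
begin

text \<open>
  A power series in \<open>t\<^sup>e\<close> with \<open>e = e\<^sub>k\<close> cannot match the coefficient of \<open>\<phi>\<close> at \<open>\<beta>\<^sub>k\<^sub>+\<^sub>1\<close>.
\<close>

lemma contact_bound: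
  assumes "k < g"
  shows "\<phi> - (\<theta> oo twist \<zeta> (ee k)) \<noteq> 0" "subdegree (\<phi> - (\<theta> oo twist \<zeta> (ee k))) \<le> \<beta> (Suc k)"
proof -
  note b = beta_Suc[OF ee_less_genus[OF assms]]
  have "(\<phi> - (\<theta> oo twist \<zeta> (ee k))) $ \<beta> (Suc k) \<noteq> 0"
    using b ee_pos by (simp add: nth_compose_twist del: char_beta.simps)
  thus "\<phi> - (\<theta> oo twist \<zeta> (ee k)) \<noteq> 0" "subdegree (\<phi> - (\<theta> oo twist \<zeta> (ee k))) \<le> \<beta> (Suc k)"
    by (auto intro: subdegree_leI fps_nonzeroI simp del: char_beta.simps)
qed

lemma gcd_below_beta: "k < g \<Longrightarrow> gcd_below (\<beta> (Suc k)) = ee k"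
  using beta_less[of k] by (intro gcd_below_eq) auto

lemma contact_sum_eq_iff:
  assumes "k < g" "c \<le> \<beta> (Suc k)" "ee k * v (Suc k) = (\<Sum>j=1..c. gcd_below j)"
  shows "c = \<beta> (Suc k)"
proof (rule ccontr)
  assume "c \<noteq> \<beta> (Suc k)"
  hence "c < \<beta> (Suc k)" using assms(2) by linarith
  hence "(\<Sum>j=1..c. gcd_below j) < (\<Sum>j=1..\<beta> (Suc k). gcd_below j)"
    using gcd_below_pos by (intro sum_strict_mono2[where b = "\<beta> (Suc k)"]) (auto simp del: char_beta.simps)
  thus False using assms ee_mult_v[OF assms(1)] by simp
qed

text \<open>
  By the count of contacts the value of \<open>F\<close> is strictly increasing in the maximal order of
  contact, and the value \<open>v\<^sub>k\<^sub>+\<^sub>1\<close> corresponds to the order \<open>\<beta>\<^sub>k\<^sub>+\<^sub>1\<close>. The rotation \<open>\<omega>\<close> brings the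
  closest conjugate to the index \<open>1\<close>.
\<close>

lemma contact_of_semiroot:
  assumes "k < g" "branch N \<theta> F" "ee k * N = n"
    and "on_branch n \<phi> F \<noteq> 0" "subdegree (on_branch n \<phi> F) = v (Suc k)"
  obtains \<omega> where "\<omega> \<in> mu N" "branch_contact N (\<theta> oo twist \<omega> 1) F (ee k) \<phi> (\<beta> (Suc k))"
proof -
  interpret branch N \<theta> F by fact
  define S where "S = (\<lambda>\<zeta>. subdegree (\<phi> - (\<theta> oo twist \<zeta> (ee k)))) ` mu N"
  have "mu N \<noteq> {}" using one_in_mu by blast
  hence "Max S \<in> S" using N_pos unfolding S_def by (intro Max_in) auto
  then obtain \<omega> where \<omega>: "\<omega> \<in> mu N" "Max S = subdegree (\<phi> - (\<theta> oo twist \<omega> (ee k)))"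
    by (auto simp: S_def)
  define \<psi> where "\<psi> = \<theta> oo twist \<omega> 1"
  interpret rot: branch N \<psi> F unfolding \<psi>_def using assms(2) \<omega>(1) by (rule branch_rotate)
  have conj: "\<psi> oo twist \<zeta> (ee k) = \<theta> oo twist (\<omega> * \<zeta>) (ee k)" for \<zeta>
    unfolding \<psi>_def by (intro compose_twist_mult ee_pos)
  define c where "c = subdegree (\<phi> - (\<psi> oo twist 1 (ee k)))"
  have le: "subdegree (\<phi> - (\<psi> oo twist \<zeta> (ee k))) \<le> c" if "\<zeta> \<in> mu N" for \<zeta>
  proof -
    have "\<omega> * \<zeta> \<in> mu N" using that \<omega>(1) by (simp add: mu_def power_mult_distrib)
    hence "subdegree (\<phi> - (\<theta> oo twist (\<omega> * \<zeta>) (ee k))) \<le> Max S"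
      using N_pos unfolding S_def by (intro Max_ge) auto
    thus ?thesis unfolding c_def conj \<omega>(2) by simp
  qed
  have "on_branch n \<phi> F = (\<Prod>\<zeta>\<in>mu N. \<phi> - (\<psi> oo twist \<zeta> (ee k)))"
    unfolding assms(3)[symmetric] on_branch_def
    by (simp add: subst_coeffs_eq_conjugate_prod[OF rot.primitive N_pos ee_pos monic degree_F rot.root]
        conjugate_prod_def poly_prod)
  moreover have "subdegree (\<Prod>\<zeta>\<in>mu N. \<phi> - (\<psi> oo twist \<zeta> (ee k)))
      = (\<Sum>\<zeta>\<in>mu N. subdegree (\<phi> - (\<psi> oo twist \<zeta> (ee k))))"
    by (intro subdegree_prod_fps contact_bound assms)
  ultimately have "v (Suc k) = (\<Sum>\<zeta>\<in>mu N. subdegree (\<phi> - (\<psi> oo twist \<zeta> (ee k))))"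
    using assms(5) by (simp only:)
  hence "ee k * v (Suc k) = (\<Sum>j=1..c. gcd_below j)"
    using contact_sum[OF ee_pos N_pos contact_bound(1)[OF assms(1)] le c_def]
    unfolding gcd_below_def assms(3) by (simp only:)
  hence c: "c = \<beta> (Suc k)"
    using contact_bound(2)[OF assms(1)] assms(1) by (intro contact_sum_eq_iff) (simp_all only: c_def)
  have "branch_contact N \<psi> F (ee k) \<phi> (\<beta> (Suc k))"
  proof unfold_locales
    show "ee k > 0" by (rule ee_pos)
    show "\<beta> (Suc k) > 0" using beta_Suc(2)[OF ee_less_genus[OF assms(1)]] by (metis dvd_0_right gr0I)
    show "\<phi> \<noteq> \<psi> oo twist 1 (ee k)" using contact_bound(1)[OF assms(1), of \<psi> 1] by auto
    show "subdegree (\<phi> - (\<psi> oo twist 1 (ee k))) = \<beta> (Suc k)" using c c_def by (simp only:)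
    fix \<zeta> assume \<zeta>: "\<zeta> \<in> mu N" "\<zeta> \<noteq> 1"
    show "\<exists>i. ee k * i < \<beta> (Suc k) \<and> \<psi> $ i \<noteq> 0 \<and> \<zeta> ^ i \<noteq> 1"
    proof (rule ccontr)
      assume *: "\<not> ?thesis"
      let ?G = "Gcd (insert N {i. ee k * i < \<beta> (Suc k) \<and> \<psi> $ i \<noteq> 0})"
      have "\<phi> $ l = (\<psi> oo twist 1 (ee k)) $ l" if "l < \<beta> (Suc k)" for l
        using nth_less_subdegree_zero[of l "\<phi> - (\<psi> oo twist 1 (ee k))"] that c c_def by simp
      from Gcd_exponents_scale[OF ee_pos this, of "\<beta> (Suc k)" N] have "ee k * ?G = gcd_below (\<beta> (Suc k))"
        unfolding gcd_below_def assms(3) .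
      hence "ee k * ?G = ee k" unfolding gcd_below_beta[OF assms(1)] .
      hence "ee k * ?G = ee k * 1" by (simp only: mult_1_right)
      hence "?G = 1 \<or> ee k = 0" by (simp only: mult_cancel1)
      hence G: "?G = 1" using ee_pos[of k] by (metis less_irrefl)
      moreover have "\<zeta> ^ ?G = 1"
        unfolding power_Gcd_eq_1_iff[OF N_pos] using \<zeta>(1) * by (auto simp: mu_def)
      ultimately show False using \<zeta>(2) unfolding G by (simp only: power_one_right)
    qed
  qed
  thus ?thesis using that \<omega>(1) by (simp only: \<psi>_def)
qed

text \<open>
  Take the product of the conjugates of \<open>\<phi>\<close> truncated below \<open>\<beta>\<^sub>k\<^sub>+\<^sub>1\<close>.
\<close>

lemma semiroot_exists:
  assumes "k < g"
  obtains F where "lead_coeff F = 1" "degree F = n div ee k" "on_branch n \<phi> F \<noteq> 0" "subdegree (on_branch n \<phi> F) = v (Suc k)"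
proof -
  define N where "N = n div ee k"
  have N: "ee k * N = n" using ee_dvd_n by (simp add: N_def)
  hence N_pos: "N > 0" using n_pos by (auto intro: gr0I)
  define \<theta> where "\<theta> = Abs_fps (\<lambda>i. if ee k * i < \<beta> (Suc k) then \<phi> $ (ee k * i) else 0)"
  obtain F where F: "subst_coeffs (fps_X ^ N) F = conjugate_prod N 1 \<theta>" "lead_coeff F = 1" "degree F = N"
    using conjugate_prod_descends[OF N_pos] by blast
  note b = beta_Suc[OF ee_less_genus[OF assms]]
  have "(\<phi> - (\<theta> oo twist 1 (ee k))) $ l = 0" if "l < \<beta> (Suc k)" for l
  proof (cases "ee k dvd l")
    case True
    then obtain i where i: "l = ee k * i" by blast
    have "\<theta> $ i = \<phi> $ l" unfolding \<theta>_def using that unfolding i by (simp only: fps_nth_Abs_fps if_True)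
    thus ?thesis using ee_pos[of k] unfolding i by (simp add: nth_compose_twist)
  next
    case False
    hence "\<phi> $ l = 0" using b(3)[OF that] by blast
    thus ?thesis using False ee_pos[of k] by (simp add: nth_compose_twist)
  qed
  hence "subdegree (\<phi> - (\<theta> oo twist 1 (ee k))) \<ge> \<beta> (Suc k)"
    by (rule subdegree_geI[OF contact_bound(1)[OF assms]])
  hence c: "\<beta> (Suc k) = subdegree (\<phi> - (\<theta> oo twist 1 (ee k)))"
    using contact_bound(2)[OF assms, of \<theta> 1] by linarith
  have on_branch: "on_branch n \<phi> F = (\<Prod>\<zeta>\<in>mu N. \<phi> - (\<theta> oo twist \<zeta> (ee k)))"
    using on_branch_descended[OF ee_pos[of k] N_pos F(1), of \<phi>] unfolding N .
  have "ee k * subdegree (on_branch n \<phi> F) = (\<Sum>j=1..\<beta> (Suc k). gcd_below j)"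
    unfolding on_branch subdegree_prod_fps[OF contact_bound(1)[OF assms]] gcd_below_def
    using contact_sum[OF ee_pos[of k] N_pos contact_bound[OF assms] c] unfolding N .
  hence "ee k * subdegree (on_branch n \<phi> F) = ee k * v (Suc k)" by (simp only: ee_mult_v[OF assms])
  hence "subdegree (on_branch n \<phi> F) = v (Suc k) \<or> ee k = 0" by (simp only: mult_cancel1)
  hence "subdegree (on_branch n \<phi> F) = v (Suc k)" using ee_pos[of k] by (metis less_irrefl)
  moreover have "on_branch n \<phi> F \<noteq> 0" unfolding on_branch using contact_bound(1)[OF assms] N_pos by simp
  ultimately show ?thesis using that[of F] F N_def by blast
qed

text \<open>
  Division by the semiroot \<open>F\<close> lowers the degree. The summands of the resulting expansion in
  powers of \<open>F\<close> have values that are distinct modulo \<open>e\<^sub>j\<close>, so nothing cancels and the value of \<open>p\<close>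
  is the least among them.
\<close>

lemma value_expansion_step:
  assumes "j < g" and F: "lead_coeff F = 1" "degree F = n div ee j" "on_branch n \<phi> F \<noteq> 0" 
      "subdegree (on_branch n \<phi> F) = v (Suc j)"
    and low: "\<And>p. degree p < n div ee j \<Longrightarrow> on_branch n \<phi> p \<noteq> 0 \<Longrightarrow> subdegree (on_branch n \<phi> p) \<in> W"
    and W: "\<And>w. w \<in> W \<Longrightarrow> ee j dvd w"
    and "t \<le> nn (Suc j)" "degree p < t * (n div ee j)" "on_branch n \<phi> p \<noteq> 0"
  shows "\<exists>i w. i < t \<and> w \<in> W \<and> subdegree (on_branch n \<phi> p) = w + i * v (Suc j)"
  using assms(8-10)
proof (induction t arbitrary: p)
  case (Suc t)
  have d: "n div ee j > 0" using ee_dvd_n n_pos ee_pos by (metis dvd_div_eq_0_iff gr0I neq0_conv)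
  obtain q r where qr: "p = q * F + r" "degree r < degree F"
    using division_by_monic[OF F(1)] d F(2) by metis
  have on_branch: "on_branch n \<phi> p = on_branch n \<phi> q * on_branch n \<phi> F + on_branch n \<phi> r"
    using n_pos by (simp add: qr on_branch_add on_branch_mult)
  have r: "subdegree (on_branch n \<phi> r) \<in> W" if "on_branch n \<phi> r \<noteq> 0"
    using low[of r] that qr(2) F(2) by simp
  show ?case
  proof (cases "on_branch n \<phi> q = 0")
    case True
    hence "on_branch n \<phi> p = on_branch n \<phi> r" by (simp add: on_branch)
    thus ?thesis using r Suc.prems(3) by auto
  next
    case False
    hence "q \<noteq> 0" by auto
    moreover have "F \<noteq> 0" using F(3) by auto
    ultimately have deg_mult: "degree (q * F) = degree q + degree F" by (rule degree_mult_eq)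
    have "degree q < t * (n div ee j)"
    proof (rule ccontr)
      assume nlt: "\<not> degree q < t * (n div ee j)"
      have "degree r < degree (q * F)" "degree (q * F) = degree q + degree F"
        using qr(2) deg_mult by simp_all
      hence "degree p = degree q + degree F" unfolding qr(1) by (simp add: degree_add_eq_left)
      thus False using Suc.prems(2) F(2) nlt by simp
    qed
    from Suc.IH[OF _ this False] Suc.prems(1) obtain i w where
      iw: "i < t" "w \<in> W" "subdegree (on_branch n \<phi> q) = w + i * v (Suc j)" by auto
    have s: "subdegree (on_branch n \<phi> q * on_branch n \<phi> F) = w + Suc i * v (Suc j)"
      using False F iw by (simp del: gen_v.simps)
    show ?thesis
    proof (cases "on_branch n \<phi> r = 0")
      case True
      hence "subdegree (on_branch n \<phi> p) = w + Suc i * v (Suc j)" using s by (simp only: on_branch add_0_right)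
      thus ?thesis using iw Suc_mono by blast
    next
      case r0: False
      have ne: "subdegree (on_branch n \<phi> q * on_branch n \<phi> F) \<noteq> subdegree (on_branch n \<phi> r)"
      proof
        assume "subdegree (on_branch n \<phi> q * on_branch n \<phi> F) = subdegree (on_branch n \<phi> r)"
        hence "ee j dvd w + Suc i * v (Suc j)" using W[OF r[OF r0]] s by simp
        \<comment> \<open>Then \<open>n\<^sub>j\<^sub>+\<^sub>1\<close> would divide the exponent of \<open>F\<close>, which is positive and less than \<open>n\<^sub>j\<^sub>+\<^sub>1\<close>.\<close>
        hence "ee j dvd Suc i * v (Suc j)" using W[OF iw(2)] by (metis dvd_add_right_iff)
        hence "int (ee j) dvd int (Suc i) * int (v (Suc j))"
          by (simp only: int_dvd_int_iff of_nat_mult[symmetric])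
        from dvd_mult_v_imp[OF assms(1) this] have "nn (Suc j) dvd Suc i"
          by (simp only: int_dvd_int_iff)
        thus False using dvd_imp_le[of "nn (Suc j)" "Suc i"] iw(1) Suc.prems(1) by simp
      qed
      show ?thesis
      proof (cases "subdegree (on_branch n \<phi> q * on_branch n \<phi> F) < subdegree (on_branch n \<phi> r)")
        case True
        hence "subdegree (on_branch n \<phi> p) = w + Suc i * v (Suc j)"
          unfolding on_branch s[symmetric] using False F(3) by (intro subdegree_add_eq1) auto
        thus ?thesis using iw Suc_mono by blast
      next
        case lt: False
        hence "subdegree (on_branch n \<phi> p) = subdegree (on_branch n \<phi> r)"
          unfolding on_branch using ne r0 by (intro subdegree_add_eq2) auto
        thus ?thesis using r[OF r0] by auto
      qed
    qed
  qed
qed simp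

text \<open>
  Iterated expansion in the semiroots of index \<open>k\<close> to \<open>j - 1\<close>. In degree below \<open>N\<close> the value on
  \<open>C\<^sub>f\<close> is \<open>e\<^sub>k\<close> times the value on \<open>C\<^sub>k\<close>. For \<open>j = g\<close> this describes the semigroup of \<open>f\<close>.
\<close>

lemma value_expansion:
  assumes "k < g" "branch_contact N \<psi> F0 (ee k) \<phi> b" "ee k * N = n"
    and "k \<le> j" "j \<le> g" "degree p < n div ee j" "on_branch n \<phi> p \<noteq> 0"
  shows "\<exists>s h. (\<forall>i\<in>{k+1..j}. s i < nn i) \<and> on_branch N \<psi> h \<noteq> 0 \<and>
    subdegree (on_branch n \<phi> p) = (\<Sum>i=k+1..j. s i * v i) + ee k * subdegree (on_branch N \<psi> h)"
  using assms(4-7)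
proof (induction j arbitrary: p rule: dec_induct)
  case base
  interpret branch_contact N \<psi> F0 "ee k" \<phi> b by fact
  have deg: "degree p < N" using base assms(3) ee_pos[of k] by (metis nonzero_mult_div_cancel_left neq0_conv)
  have "on_branch N \<psi> p \<noteq> 0"
  proof
    assume "on_branch N \<psi> p = 0"
    hence "on_branch (ee k * N) \<phi> p = 0"
      using interpolation[OF deg] by (simp add: on_branch_conjugate)
    thus False using base assms(3) by simp
  qed
  thus ?case using value_of_low_degree[OF deg] unfolding assms(3) by auto
next
  case (step j)
  define W where "W = {(\<Sum>i=k+1..j. s i * v i) + ee k * subdegree (on_branch N \<psi> h) | s h.
     (\<forall>i\<in>{k+1..j}. s i < nn i) \<and> on_branch N \<psi> h \<noteq> 0}"
  have jg: "j < g" using step.prems by simp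
  obtain F where F: "lead_coeff F = 1" "degree F = n div ee j" "on_branch n \<phi> F \<noteq> 0" "subdegree (on_branch n \<phi> F) = v (Suc j)"
    using semiroot_exists[OF jg] by blast
  have "subdegree (on_branch n \<phi> p) \<in> W" if "degree p < n div ee j" "on_branch n \<phi> p \<noteq> 0" for p
    using step.IH[OF less_imp_le[OF jg] that] unfolding W_def by blast
  moreover have "ee j dvd w" if "w \<in> W" for w
  proof -
    have "ee j dvd v i" if "i \<in> {k+1..j}" for i using that jg by (intro ee_dvd_v_le) auto
    thus ?thesis using that ee_dvd[OF step.hyps(1)] unfolding W_def
      by (auto intro!: dvd_add dvd_sum simp del: char_e.simps)
  qed
  moreover have "nn (Suc j) * (n div ee j) = n div ee (Suc j)"
  proof -
    have "n div ee (Suc j) = (ee (Suc j) * nn (Suc j) * (n div ee j)) div ee (Suc j)"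
      unfolding ee_Suc_nn using ee_dvd_n[of j] by simp
    thus ?thesis using ee_pos[of "Suc j"] by (simp only: mult.assoc) simp
  qed
  ultimately obtain i w where iw: "i < nn (Suc j)" "w \<in> W" "subdegree (on_branch n \<phi> p) = w + i * v (Suc j)"
    using value_expansion_step[OF jg F, of W "nn (Suc j)" p] step.prems by auto
  from iw(2) obtain s h where sh: "\<forall>i\<in>{k+1..j}. s i < nn i" "on_branch N \<psi> h \<noteq> 0"
    "w = (\<Sum>i=k+1..j. s i * v i) + ee k * subdegree (on_branch N \<psi> h)" unfolding W_def by blast
  have "(\<Sum>l=k+1..Suc j. (s(Suc j := i)) l * v l) = (\<Sum>l=k+1..j. s l * v l) + i * v (Suc j)"
  proof -
    have "(\<Sum>l=k+1..j. (s(Suc j := i)) l * v l) = (\<Sum>l=k+1..j. s l * v l)"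
      by (intro sum.cong) auto
    thus ?thesis using step.hyps by (simp del: gen_v.simps fun_upd_apply) simp
  qed
  hence "subdegree (on_branch n \<phi> p) = (\<Sum>l=k+1..Suc j. (s(Suc j := i)) l * v l) + ee k * subdegree (on_branch N \<psi> h)"
    using iw(3) sh(3) by simp
  moreover have "\<forall>l\<in>{k+1..Suc j}. (s(Suc j := i)) l < nn l" using sh(1) iw(1) by auto
  ultimately show ?case using sh(2) by blast
qed

end

section \<open>Invariance under rotation of the parameter\<close>

lemma subst2_rotate:
  assumes "\<psi> $ 0 = 0" "N > 0" "\<omega> \<in> mu N"
  shows "subst2 h (fps_X ^ N) (\<psi> oo twist \<omega> 1) = subst2 h (fps_X ^ N) \<psi> oo twist \<omega> 1"
proof (rule fps_ext)
  fix M
  have "subst2 h (fps_X ^ N) (\<psi> oo twist \<omega> 1) $ M = on_branch N (\<psi> oo twist \<omega> 1) (truncate_poly M h) $ M"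
    using assms by (subst subst2_truncate) simp_all
  also have "on_branch N (\<psi> oo twist \<omega> 1) (truncate_poly M h) = on_branch N \<psi> (truncate_poly M h) oo twist \<omega> 1"
    using on_branch_compose_twist[OF zero_less_one assms(2,3), of \<psi> "truncate_poly M h"] by simp
  also have "\<dots> $ M = (subst2 h (fps_X ^ N) \<psi> oo twist \<omega> 1) $ M"
    using subst2_truncate[OF assms(1,2) order_refl, of M h] by (simp add: nth_compose_twist)
  finally show "subst2 h (fps_X ^ N) (\<psi> oo twist \<omega> 1) $ M = (subst2 h (fps_X ^ N) \<psi> oo twist \<omega> 1) $ M" .
qed

lemma ord_t_rotate: "\<omega> \<noteq> 0 \<Longrightarrow> ord_t (a oo twist \<omega> 1) = ord_t a"
  using subdegree_compose_twist[of 1 \<omega> a] compose_twist_eq_0_iff[of 1 \<omega> a] by (simp add: ord_t_def)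

lemma nu_rotate:
  assumes "\<psi> $ 0 = 0" "degree F > 0" "\<omega> \<in> mu (degree F)"
  shows "nu F (\<psi> oo twist \<omega> 1) = nu F \<psi>"
  using mu_nonzero[OF assms(3,2)] by (intro ext) (simp add: nu_def subst2_rotate[OF assms, unfolded One_nat_def] ord_t_rotate[unfolded One_nat_def])

lemma nu_diff_rotate:
  assumes "\<psi> $ 0 = 0" "degree F > 0" "\<omega> \<in> mu (degree F)"
  shows "nu_diff F (\<psi> oo twist \<omega> 1) = nu_diff F \<psi>"
proof (intro ext)
  fix A B
  let ?X = "fps_X ^ degree F :: complex fps" and ?t = "twist \<omega> 1"
  have t0: "?t $ 0 = 0" by simp
  have X: "?X oo ?t = ?X" using X_power_compose_twist[OF zero_less_one assms(3)] by simp
  have euler: "fps_X * fps_deriv (\<psi> oo ?t) = (fps_X * fps_deriv \<psi>) oo ?t"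
    using euler_compose_twist[OF zero_less_one, of \<psi> \<omega>] by simp
  have "fps_const (of_nat (degree F)) * ?X * subst2 A ?X (\<psi> oo ?t) + subst2 B ?X (\<psi> oo ?t) * (fps_X * fps_deriv (\<psi> oo ?t))
    = (fps_const (of_nat (degree F)) * ?X * subst2 A ?X \<psi> + subst2 B ?X \<psi> * (fps_X * fps_deriv \<psi>)) oo ?t"
    unfolding euler subst2_rotate[OF assms] fps_compose_add_distrib fps_compose_mult_distrib[OF t0] X
      fps_const_compose ..
  thus "nu_diff F (\<psi> oo ?t) A B = nu_diff F \<psi> A B"
    unfolding nu_diff_eq[OF assms(2)] using ord_t_rotate[OF mu_nonzero[OF assms(3,2)]] by (simp only:)
qed

text \<open>
  The sets of the theorem see the parametrization of \<open>C\<^sub>k\<close> only through the two value functions.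
\<close>

lemma invariants_cong:
  assumes "nu F \<psi> = nu F \<psi>'" "nu_diff F \<psi> = nu_diff F \<psi>'"
  shows "L1 f \<phi> k F \<psi> = L1 f \<phi> k F \<psi>'" "L2 f \<phi> k F \<psi> = L2 f \<phi> k F \<psi>'"
    "rho f \<phi> k F \<psi> = rho f \<phi> k F \<psi>'" "Tset F \<psi> = Tset F \<psi>'"
proof -
  have eqs: "Gamma_set F \<psi> = Gamma_set F \<psi>'" "Lambda_set F \<psi> = Lambda_set F \<psi>'" "Theta F \<psi> = Theta F \<psi>'"
    using assms by (simp_all add: Gamma_set_def Lambda_set_def Theta_def fun_eq_iff)
  show L: "L1 f \<phi> k F \<psi> = L1 f \<phi> k F \<psi>'" "L2 f \<phi> k F \<psi> = L2 f \<phi> k F \<psi>'"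
    by (simp_all only: L1_def L2_def eqs)
  show "rho f \<phi> k F \<psi> = rho f \<phi> k F \<psi>'" by (intro ext) (simp only: rho_def L eqs)
  show "Tset F \<psi> = Tset F \<psi>'" by (simp only: Tset_def eqs)
qed

section \<open>Maximality of Theta and the gap sets\<close>

context branch
begin

text \<open>
  The maximum in the definition of \<open>\<Theta>\<close> exists. If some admissible \<open>B\<close> has a value above \<open>\<delta>\<close>, then
  \<open>A dx\<close> alone has value \<open>\<delta>\<close> and \<open>B = 0\<close> is admissible; otherwise the admissible values are
  bounded.
\<close>

lemma Theta_properties:
  assumes "\<psi> $ 0 = 0" "\<delta> \<in> Lambda_set F \<psi>"
  shows "\<exists>P Q. degree P < N \<and> degree Q < N \<and> ord_t (euler_form N \<psi> P Q) = enat \<delta> \<and> ord_t (on_branch N \<psi> Q) = Theta F \<psi> \<delta>"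
    and "\<And>P Q. ord_t (euler_form N \<psi> P Q) = enat \<delta> \<Longrightarrow> ord_t (on_branch N \<psi> Q) \<le> Theta F \<psi> \<delta>"
proof -
  define X where "X = (\<lambda>b. \<exists>A \<in> conv2. \<exists>B \<in> conv2. b = nu F \<psi> B \<and> nu_diff F \<psi> A (- B) = enat \<delta>)"
  have N: "degree F > 0" "on_branch (degree F) \<psi> F = 0" using N_pos degree_F root by simp_all
  have to_poly: "\<exists>P Q. degree P < N \<and> degree Q < N \<and> ord_t (euler_form N \<psi> P Q) = enat \<delta> \<and> ord_t (on_branch N \<psi> Q) = b"
    if "X b" for b
    using that unfolding X_def by (metis diff_pair_to_poly[OF monic N assms(1)] degree_F)
  have of_poly: "X (ord_t (on_branch N \<psi> Q))" if "ord_t (euler_form N \<psi> P Q) = enat \<delta>" for P Q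
    using that unfolding X_def by (metis diff_pair_of_poly[OF N(1) assms(1)] degree_F)
  have nonempty: "\<exists>b. X b"
  proof -
    obtain A B where "A \<in> conv2" "B \<in> conv2" "nu_diff F \<psi> A B = enat \<delta>"
      using assms(2) by (auto simp: Lambda_set_def)
    moreover have "- B \<in> conv2" using \<open>B \<in> conv2\<close> by (simp add: conv2_def)
    ultimately show ?thesis unfolding X_def by (metis minus_minus)
  qed
  have "\<exists>x. X x \<and> (\<forall>y. X y \<longrightarrow> y \<le> x)"
  proof (cases "X \<infinity>")
    case True
    thus ?thesis by (intro exI[of _ \<infinity>]) simp
  next
    case False
    have "y \<le> enat \<delta>" if "X y" for y
    proof (rule ccontr)
      assume gt: "\<not> y \<le> enat \<delta>"
      obtain P Q where PQ: "ord_t (euler_form N \<psi> P Q) = enat \<delta>" "ord_t (on_branch N \<psi> Q) = y"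
        using to_poly[OF \<open>X y\<close>] by blast
      \<comment> \<open>The term of \<open>B\<close> does not reach the order \<open>\<delta>\<close>, so it may be dropped.\<close>
      have small: "on_branch N \<psi> Q $ i = 0" if "i \<le> \<delta>" for i
      proof (cases "on_branch N \<psi> Q = 0")
        case False
        hence "\<delta> < subdegree (on_branch N \<psi> Q)" using gt PQ(2) by (auto simp: ord_t_def)
        thus ?thesis using that by (intro nth_less_subdegree_zero) simp
      qed simp
      have "(on_branch N \<psi> Q * (fps_X * fps_deriv \<psi>)) $ i = 0" if "i \<le> \<delta>" for i
        unfolding fps_mult_nth[of "on_branch N \<psi> Q"] using small that by (intro sum.neutral) simp
      hence "ord_t (euler_form N \<psi> P 0) = enat \<delta>"
        by (intro ord_t_cong_upto[OF PQ(1)]) (simp add: euler_form_def)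
      from of_poly[OF this] False show False by (simp add: ord_t_def)
    qed
    hence sub: "Collect X \<subseteq> enat ` {..\<delta>}"
    proof (intro subsetI)
      fix y assume *: "\<And>y. X y \<Longrightarrow> y \<le> enat \<delta>" "y \<in> Collect X"
      hence "y \<le> enat \<delta>" by blast
      thus "y \<in> enat ` {..\<delta>}" by (cases y) auto
    qed
    hence "finite (Collect X)" by (rule finite_subset) simp
    thus ?thesis using nonempty Max_in[of "Collect X"] Max_ge[of "Collect X"] by blast
  qed
  then obtain x where x: "X x" "\<And>y. X y \<Longrightarrow> y \<le> x" by blast
  have T: "Theta F \<psi> \<delta> = x"
    unfolding Theta_def X_def[symmetric] using x by (intro Greatest_equality) auto
  show "\<exists>P Q. degree P < N \<and> degree Q < N \<and> ord_t (euler_form N \<psi> P Q) = enat \<delta> \<and> ord_t (on_branch N \<psi> Q) = Theta F \<psi> \<delta>"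
    using to_poly[OF x(1)] unfolding T .
  show "ord_t (on_branch N \<psi> Q) \<le> Theta F \<psi> \<delta>" if "ord_t (euler_form N \<psi> P Q) = enat \<delta>" for P Q
    unfolding T using of_poly[OF that] by (rule x(2))
qed

text \<open>
  Subtracting a suitable multiple of a form that vanishes on the branch keeps the value \<open>\<delta>\<close> and
  cancels the leading term of \<open>B\<close>, against the maximality of \<open>\<Theta>\<close>.
\<close>

lemma Theta_not_annihilating:
  assumes "\<psi> $ 0 = 0" "\<delta> \<in> Lambda_set F \<psi>" "Theta F \<psi> \<delta> = enat \<theta>"
    and "euler_form N \<psi> A B = 0" "on_branch N \<psi> B \<noteq> 0"
  shows "subdegree (on_branch N \<psi> B) \<noteq> \<theta>"
proof
  assume sB: "subdegree (on_branch N \<psi> B) = \<theta>"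
  obtain P Q where PQ: "ord_t (euler_form N \<psi> P Q) = enat \<delta>" "ord_t (on_branch N \<psi> Q) = enat \<theta>"
    using Theta_properties(1)[OF assms(1,2)] assms(3) by auto
  define c where "c = on_branch N \<psi> Q $ \<theta> / on_branch N \<psi> B $ \<theta>"
  define P' Q' where "P' = P - smult (fps_const c) A" and "Q' = Q - smult (fps_const c) B"
  have "ord_t (euler_form N \<psi> P' Q') = enat \<delta>"
    using PQ(1) assms(4) by (simp add: P'_def Q'_def euler_form_diff_smult)
  hence le: "ord_t (on_branch N \<psi> Q') \<le> enat \<theta>" using Theta_properties(2)[OF assms(1,2)] assms(3) by metis
  have eQ': "on_branch N \<psi> Q' = on_branch N \<psi> Q - fps_const c * on_branch N \<psi> B"
    using N_pos by (simp add: Q'_def on_branch_diff on_branch_smult)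
  have Q: "subdegree (on_branch N \<psi> Q) = \<theta>" using PQ(2) by (simp add: ord_t_eq_enat)
  have "on_branch N \<psi> B $ \<theta> \<noteq> 0" using assms(5) sB by auto
  hence vanish: "on_branch N \<psi> Q' $ i = 0" if "i \<le> \<theta>" for i
    using that nth_less_subdegree_zero[of i "on_branch N \<psi> Q"] nth_less_subdegree_zero[of i "on_branch N \<psi> B"]
    unfolding eQ' Q sB by (cases "i = \<theta>") (simp_all add: c_def)
  show False
  proof (cases "on_branch N \<psi> Q' = 0")
    case True
    thus False using le by (simp add: ord_t_def)
  next
    case False
    hence "subdegree (on_branch N \<psi> Q') \<le> \<theta>" using le by (simp add: ord_t_def)
    thus False using vanish[of "subdegree (on_branch N \<psi> Q')"] False by simp
  qed
qed

lemma euler_form_subdegree_pos: "euler_form N \<psi> P Q \<noteq> 0 \<Longrightarrow> subdegree (euler_form N \<psi> P Q) > 0"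
  using euler_form_nth_0 by (metis gr0I nth_subdegree_nonzero)

lemma Tset_not_value:
  assumes "\<psi> $ 0 = 0" "\<delta> \<in> Tset F \<psi>" "euler_form N \<psi> P Q \<noteq> 0"
  shows "int (subdegree (euler_form N \<psi> P Q)) \<noteq> \<delta>"
proof -
  have "subdegree (euler_form N \<psi> P Q) \<in> Lambda_set F \<psi>"
    using Lambda_set_of_poly[of F \<psi> P Q] assms N_pos degree_F by simp
  thus ?thesis using assms(2) euler_form_subdegree_pos[OF assms(3)] unfolding Tset_def by auto
qed

lemma value_in_Gamma:
  assumes "\<psi> $ 0 = 0" "on_branch N \<psi> h \<noteq> 0"
  shows "subdegree (on_branch N \<psi> h) \<in> Gamma_set F \<psi>"
  using Gamma_set_of_poly[of F \<psi> h] assms N_pos degree_F root by simp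

lemma Tset_neg_not_value:
  assumes "\<psi> $ 0 = 0" "\<delta> \<in> Tset F \<psi>" "on_branch N \<psi> h \<noteq> 0"
  shows "int (subdegree (on_branch N \<psi> h)) \<noteq> - \<delta>"
  using value_in_Gamma[OF assms(1,3)] assms(2) unfolding Tset_def by auto

end

context characteristic
begin

text \<open>
  Multiply the form by powers of semiroots.
\<close>

lemma Lambda_set_translate:
  assumes "\<phi> $ 0 = 0" "k < g" "euler_form n \<phi> P Q \<noteq> 0"
  shows "subdegree (euler_form n \<phi> P Q) + (\<Sum>i=k+1..g. s i * v i) \<in> Lambda_set f \<phi>"
proof -
  have "\<exists>G. on_branch n \<phi> G \<noteq> 0 \<and> subdegree (on_branch n \<phi> G) = v i" if i: "i \<in> {k+1..g}" for i
  proof -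
    obtain j where "i = Suc j" "j < g" using i by (cases i) auto
    thus ?thesis using semiroot_exists[of j] by metis
  qed
  then obtain G where G: "\<And>i. i \<in> {k+1..g} \<Longrightarrow> on_branch n \<phi> (G i) \<noteq> 0 \<and> subdegree (on_branch n \<phi> (G i)) = v i"
    by metis
  define M where "M = (\<Prod>i=k+1..g. G i ^ s i)"
  have M: "on_branch n \<phi> M = (\<Prod>i=k+1..g. on_branch n \<phi> (G i) ^ s i)"
    using n_pos by (simp add: M_def on_branch_prod on_branch_power)
  have "subdegree (on_branch n \<phi> M) = (\<Sum>i=k+1..g. subdegree (on_branch n \<phi> (G i) ^ s i))"
    unfolding M using G by (intro subdegree_prod_fps) simp
  also have "\<dots> = (\<Sum>i=k+1..g. s i * v i)"
    using G by (intro sum.cong) (simp_all del: gen_v.simps)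
  finally have sM: "subdegree (on_branch n \<phi> M) = (\<Sum>i=k+1..g. s i * v i)" .
  have M0: "on_branch n \<phi> M \<noteq> 0" unfolding M using G by simp
  have eq: "euler_form n \<phi> (M * P) (M * Q) = on_branch n \<phi> M * euler_form n \<phi> P Q"
    using n_pos by (simp add: euler_form_def on_branch_mult algebra_simps)
  show ?thesis
    using Lambda_set_of_poly[OF n_pos assms(1), of "M * P" "M * Q"] M0 assms(3)
    unfolding eq by (simp add: sM add.commute)
qed

lemma not_in_Gamma:
  assumes "lead_coeff f = 1" "on_branch n \<phi> f = 0" "\<phi> $ 0 = 0" "k < g"
    and contact: "branch_contact N \<psi> F (ee k) \<phi> b" "ee k * N = n"
    and t: "\<And>i. i \<in> {k+1..g} \<Longrightarrow> 0 \<le> t i \<and> t i < int (nn i)"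
    and d: "int d = (\<Sum>i=k+1..g. t i * int (v i)) + int (ee k) * z"
    and z: "\<And>h. on_branch N \<psi> h \<noteq> 0 \<Longrightarrow> int (subdegree (on_branch N \<psi> h)) \<noteq> z"
  shows "d \<notin> Gamma_set f \<phi>"
proof
  assume "d \<in> Gamma_set f \<phi>"
  then obtain p where p: "degree p < n" "on_branch n \<phi> p \<noteq> 0" "subdegree (on_branch n \<phi> p) = d"
    using Gamma_set_to_poly[OF assms(1) n_pos assms(2,3)] by blast
  have deg: "degree p < n div ee g" unfolding ee_genus using p(1) by simp
  obtain s h where sh: "\<forall>i\<in>{k+1..g}. s i < nn i" "on_branch N \<psi> h \<noteq> 0"
    "d = (\<Sum>i=k+1..g. s i * v i) + ee k * subdegree (on_branch N \<psi> h)"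
    using value_expansion[OF assms(4) contact less_imp_le[OF assms(4)] order_refl deg p(2)]
    unfolding p(3) by blast
  have "int d = (\<Sum>i=k+1..g. int (s i) * int (v i)) + int (ee k) * int (subdegree (on_branch N \<psi> h))"
    unfolding sh(3) by (simp only: of_nat_add of_nat_sum of_nat_mult)
  hence eq: "(\<Sum>i=k+1..g. t i * int (v i)) + int (ee k) * z =
      (\<Sum>i=k+1..g. int (s i) * int (v i)) + int (ee k) * int (subdegree (on_branch N \<psi> h))"
    unfolding d[symmetric] .
  have s: "0 \<le> int (s i) \<and> int (s i) < int (nn i)" if "i \<in> {k+1..g}" for i
    using sh(1) that by (simp only: of_nat_less_iff of_nat_0_le_iff)
  have "z = int (subdegree (on_branch N \<psi> h))"
    using representation_unique[OF less_imp_le[OF assms(4)] order_refl t s eq] by blast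
  thus False using z[OF sh(2)] by simp
qed

end

section \<open>The three sets of values\<close>

context characteristic
begin

text \<open>
  The theorem for a parametrization of the semiroot that is already rotated into maximal contact.
\<close>

lemma disjoint_values:
  assumes monic: "lead_coeff f = 1" and root: "on_branch n \<phi> f = 0" and \<phi>0: "\<phi> $ 0 = 0" and kg: "k < g"
    and contact: "branch_contact N \<psi> F (ee k) \<phi> (\<beta> (k + 1))" and eN: "ee k * N = n"
    and \<psi>0: "\<psi> $ 0 = 0" and F: "subdegree (on_branch n \<phi> F) = v (k + 1)"
  shows "let
      S = (\<lambda>s. \<Sum>i = k + 1..g. s i * int (v i));
      M1 = {int (ee k * \<delta>) | \<delta>. \<delta> \<in> L1 f \<phi> k F \<psi>};
      M2 = {S s + int r | s r. s \<in> tuples f \<phi> k \<and> r \<in> rho f \<phi> k F \<psi> ` L2 f \<phi> k F \<psi>};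
      M3 = {S s + int (v (k + 1)) - int (ee k) * \<delta> | s \<delta>.
              s \<in> tuples f \<phi> k \<and> \<delta> \<in> Tset F \<psi>}
    in M1 \<inter> M2 = {} \<and> M1 \<inter> M3 = {} \<and> M2 \<inter> M3 = {} \<and>
       M1 \<union> M2 \<union> M3 \<subseteq> int ` (Lambda_set f \<phi> - Gamma_set f \<phi>)"
proof -
  interpret C: branch_contact N \<psi> F "ee k" \<phi> "\<beta> (k + 1)" by fact
  define D where "D = subdegree C.different"
  define S where "S = (\<lambda>s. \<Sum>i = k + 1..g. s i * int (v i))"
  \<comment> \<open>An integer in the coordinates of the unique representation.\<close>
  define rep where "rep = (\<lambda>t z. (\<Sum>i=k+1..g. t i * int (v i)) + int (ee k) * z)"
  \<comment> \<open>The coordinates of the elements of the second and third set: \<open>\<beta> = v\<^sub>k\<^sub>+\<^sub>1 - e D\<close> contributes one more \<open>v\<^sub>k\<^sub>+\<^sub>1\<close>. The bound \<open>n\<^sub>k\<^sub>+\<^sub>1 - 2\<close> leaves room for it.\<close>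
  define bump where "bump = (\<lambda>s i. s i + (if i = k + 1 then 1 else 0 :: int))"
  define A where "A = int ` (Lambda_set f \<phi> - Gamma_set f \<phi>)"
  have \<beta>_eq: "\<beta> (k + 1) + ee k * D = v (k + 1)"
    using C.value_of_root_poly(2) F unfolding eN D_def by (simp only:)
  have sum_bump: "(\<Sum>i=k+1..g. bump s i * int (v i)) = S s + int (v (k + 1))" for s
  proof -
    have "(\<Sum>i=k+1..g. bump s i * int (v i)) = (\<Sum>i=k+1..g. s i * int (v i) + (if i = k + 1 then int (v i) else 0))"
      by (intro sum.cong) (auto simp: bump_def distrib_right simp del: gen_v.simps)
    also have "\<dots> = S s + (\<Sum>i=k+1..g. if i = k + 1 then int (v i) else 0)"
      by (simp only: sum.distrib S_def)
    also have "(\<Sum>i=k+1..g. if i = k + 1 then int (v i) else 0) = int (v (k + 1))"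
      using kg by (subst sum.delta) auto
    finally show ?thesis .
  qed
  have bump_range: "0 \<le> bump s i \<and> bump s i < int (nn i)" if "s \<in> tuples f \<phi> k" "i \<in> {k+1..g}" for s i
    using that unfolding tuples_def bump_def by (cases "i = k + 1") auto
  have bump_pos: "bump s (k + 1) > 0" if "s \<in> tuples f \<phi> k" for s
    using that unfolding tuples_def bump_def by auto
  have nn_pos: "0 < nn i" if i: "i \<in> {k+1..g}" for i
  proof -
    obtain j where "i = Suc j" using i by (cases i) auto
    thus ?thesis using ee_Suc_nn[of j] ee_pos[of j] by (metis gr0I less_irrefl mult_0_right)
  qed
  have rep_unique: "z = z' \<and> (\<forall>i\<in>{k+1..g}. t i = t' i)"
    if "rep t z = rep t' z'" "\<And>i. i \<in> {k+1..g} \<Longrightarrow> 0 \<le> t i \<and> t i < int (nn i)"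
      "\<And>i. i \<in> {k+1..g} \<Longrightarrow> 0 \<le> t' i \<and> t' i < int (nn i)" for t t' z z'
    using representation_unique[OF less_imp_le[OF kg] order_refl that(2,3)] that(1)
    unfolding rep_def by blast
  \<comment> \<open>A value of a form, translated by generators, that has coordinates \<open>t\<close>, \<open>z\<close> with \<open>z\<close> outside the semigroup of \<open>C\<^sub>k\<close>.\<close>
  have in_A: "rep t z \<in> A"
    if "rep t z = S s + int (subdegree (euler_form n \<phi> P Q))" "euler_form n \<phi> P Q \<noteq> 0"
      "\<And>i. i \<in> {k+1..g} \<Longrightarrow> 0 \<le> s i"
      "\<And>i. i \<in> {k+1..g} \<Longrightarrow> 0 \<le> t i \<and> t i < int (nn i)"
      "\<And>h. on_branch N \<psi> h \<noteq> 0 \<Longrightarrow> int (subdegree (on_branch N \<psi> h)) \<noteq> z" for t z s P Q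
  proof -
    define d where "d = subdegree (euler_form n \<phi> P Q) + (\<Sum>i=k+1..g. nat (s i) * v i)"
    have "S s = int (\<Sum>i=k+1..g. nat (s i) * v i)"
      using that(3) unfolding S_def of_nat_sum of_nat_mult by (intro sum.cong) auto
    hence d: "int d = rep t z" unfolding that(1) d_def by (simp only: of_nat_add add.commute)
    have "d \<in> Lambda_set f \<phi>" unfolding d_def by (rule Lambda_set_translate[OF \<phi>0 kg that(2)])
    moreover have "d \<notin> Gamma_set f \<phi>"
      by (rule not_in_Gamma[OF monic root \<phi>0 kg contact eN that(4) d[unfolded rep_def] that(5)])
    ultimately show ?thesis unfolding A_def d[symmetric] by blast
  qed
  have M1: "int (ee k * \<delta>) = rep (\<lambda>_. 0) (int \<delta>)" "int (ee k * \<delta>) \<in> A" if \<delta>: "\<delta> \<in> L1 f \<phi> k F \<psi>" for \<delta>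
  proof -
    show eq: "int (ee k * \<delta>) = rep (\<lambda>_. 0) (int \<delta>)" by (simp add: rep_def)
    have \<delta>': "\<delta> \<in> Lambda_set F \<psi>" "\<delta> \<notin> Gamma_set F \<psi>"
      "enat (ee k * \<delta>) < enat (\<beta> (k + 1)) + enat (ee k) * Theta F \<psi> \<delta>"
      using \<delta> unfolding L1_def by auto
    obtain P Q where PQ: "degree P < N" "degree Q < N" "ord_t (euler_form N \<psi> P Q) = enat \<delta>"
      "ord_t (on_branch N \<psi> Q) = Theta F \<psi> \<delta>" using C.Theta_properties(1)[OF \<psi>0 \<delta>'(1)] by blast
    have w: "euler_form N \<psi> P Q \<noteq> 0" "subdegree (euler_form N \<psi> P Q) = \<delta>"
      using PQ(3) unfolding ord_t_eq_enat by auto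
    have "ee k * \<delta> < \<beta> (k + 1) + ee k * subdegree (on_branch N \<psi> Q)" if "on_branch N \<psi> Q \<noteq> 0"
      using \<delta>'(3) that unfolding PQ(4)[symmetric] ord_t_def if_not_P[OF that]
      by (simp only: times_enat_simps plus_enat_simps enat_ord_simps)
    from C.form_value_small[OF PQ(1,2) w(1) this[folded w(2)]]
    have *: "euler_form n \<phi> P Q \<noteq> 0" "subdegree (euler_form n \<phi> P Q) = ee k * \<delta>"
      unfolding eN w(2) by auto
    have "rep (\<lambda>_. 0) (int \<delta>) \<in> A"
    proof (rule in_A[OF _ *(1)])
      show "rep (\<lambda>_. 0) (int \<delta>) = S (\<lambda>_. 0) + int (subdegree (euler_form n \<phi> P Q))"
        unfolding *(2) by (simp add: rep_def S_def)
      show "0 \<le> (0 :: int) \<and> 0 < int (nn i)" if "i \<in> {k+1..g}" for i using nn_pos[OF that] by simp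
      show "int (subdegree (on_branch N \<psi> h)) \<noteq> int \<delta>" if "on_branch N \<psi> h \<noteq> 0" for h
        using C.value_in_Gamma[OF \<psi>0 that] \<delta>'(2) by auto
    qed simp
    thus "int (ee k * \<delta>) \<in> A" unfolding eq .
  qed
  have L2_Theta: "\<exists>\<theta> P Q. Theta F \<psi> \<delta> = enat \<theta> \<and> rho f \<phi> k F \<psi> \<delta> = \<beta> (k + 1) + ee k * \<theta> \<and>
      \<delta> \<in> Lambda_set F \<psi> \<and> euler_form n \<phi> P Q \<noteq> 0 \<and>
      subdegree (euler_form n \<phi> P Q) = \<beta> (k + 1) + ee k * \<theta>"
    if \<delta>: "\<delta> \<in> L2 f \<phi> k F \<psi>" for \<delta>
  proof -
    have \<delta>': "\<delta> \<in> Lambda_set F \<psi>"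
      "enat (ee k * \<delta>) > enat (\<beta> (k + 1)) + enat (ee k) * Theta F \<psi> \<delta>"
      using \<delta> unfolding L2_def by auto
    have notL1: "\<delta> \<notin> L1 f \<phi> k F \<psi>" using \<delta>'(2) unfolding L1_def by auto
    obtain \<theta> where \<theta>: "Theta F \<psi> \<delta> = enat \<theta>"
    proof (cases "Theta F \<psi> \<delta>")
      case infinity
      hence "enat (ee k) * Theta F \<psi> \<delta> = \<infinity>" using ee_pos[of k] by (simp add: zero_enat_def)
      thus ?thesis using \<delta>'(2) by simp
    qed
    have lt: "\<beta> (k + 1) + ee k * \<theta> < ee k * \<delta>"
      using \<delta>'(2) unfolding \<theta> by (simp only: times_enat_simps plus_enat_simps enat_ord_simps)
    have rho: "rho f \<phi> k F \<psi> \<delta> = \<beta> (k + 1) + ee k * \<theta>"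
      unfolding rho_def if_not_P[OF notL1] \<theta> by (simp only: the_enat.simps)
    obtain P Q where PQ: "degree P < N" "degree Q < N" "ord_t (euler_form N \<psi> P Q) = enat \<delta>"
      "ord_t (on_branch N \<psi> Q) = enat \<theta>" using C.Theta_properties(1)[OF \<psi>0 \<delta>'(1)] unfolding \<theta> by blast
    have w: "subdegree (euler_form N \<psi> P Q) = \<delta>" "on_branch N \<psi> Q \<noteq> 0" "subdegree (on_branch N \<psi> Q) = \<theta>"
      using PQ(3,4) unfolding ord_t_eq_enat by auto
    have "euler_form n \<phi> P Q \<noteq> 0" "subdegree (euler_form n \<phi> P Q) = \<beta> (k + 1) + ee k * \<theta>"
      using C.form_value_large[OF PQ(1,2) w(2)] lt unfolding w(1,3) eN by blast+
    thus ?thesis using \<theta> rho \<delta>'(1) by blast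
  qed
  \<comment> \<open>The dual form of \<open>z\<close> would contradict the maximality of \<open>\<Theta>\<close>.\<close>
  have not_dual: "int \<theta> \<noteq> int D - z"
    if \<theta>: "Theta F \<psi> \<delta> = enat \<theta>" and \<delta>: "\<delta> \<in> Lambda_set F \<psi>"
      and no_value: "\<And>P Q. euler_form N \<psi> P Q \<noteq> 0 \<Longrightarrow> int (subdegree (euler_form N \<psi> P Q)) \<noteq> z" for \<theta> \<delta> z
  proof -
    obtain A B where AB: "euler_form N \<psi> A B = 0" "on_branch N \<psi> B \<noteq> 0"
      "int (subdegree (on_branch N \<psi> B)) = int D - z" using C.dual_form[OF no_value] unfolding D_def by blast
    have "subdegree (on_branch N \<psi> B) \<noteq> \<theta>"
      by (rule C.Theta_not_annihilating[OF \<psi>0 \<delta> \<theta> AB(1,2)])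
    thus ?thesis using AB(3) by simp
  qed
  have M2: "\<exists>\<theta>. Theta F \<psi> \<delta> = enat \<theta> \<and> \<delta> \<in> Lambda_set F \<psi> \<and>
      S s + int (rho f \<phi> k F \<psi> \<delta>) = rep (bump s) (int \<theta> - int D) \<and> rep (bump s) (int \<theta> - int D) \<in> A"
    if s: "s \<in> tuples f \<phi> k" and \<delta>: "\<delta> \<in> L2 f \<phi> k F \<psi>" for s \<delta>
  proof -
    obtain \<theta> P Q where \<theta>: "Theta F \<psi> \<delta> = enat \<theta>" "rho f \<phi> k F \<psi> \<delta> = \<beta> (k + 1) + ee k * \<theta>"
      "\<delta> \<in> Lambda_set F \<psi>" "euler_form n \<phi> P Q \<noteq> 0"
      "subdegree (euler_form n \<phi> P Q) = \<beta> (k + 1) + ee k * \<theta>" using L2_Theta[OF \<delta>] by blast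
    have eq: "rep (bump s) (int \<theta> - int D) = S s + int (\<beta> (k + 1) + ee k * \<theta>)"
      unfolding rep_def sum_bump \<beta>_eq[symmetric] by (simp add: algebra_simps del: char_beta.simps char_e.simps)
    have "rep (bump s) (int \<theta> - int D) \<in> A"
    proof (rule in_A[OF _ \<theta>(4)])
      show "rep (bump s) (int \<theta> - int D) = S s + int (subdegree (euler_form n \<phi> P Q))"
        unfolding \<theta>(5) by (rule eq)
      show "0 \<le> s i" if "i \<in> {k+1..g}" for i
        using s that unfolding tuples_def by (cases "i = k + 1") auto
      show "int (subdegree (on_branch N \<psi> h)) \<noteq> int \<theta> - int D" if "on_branch N \<psi> h \<noteq> 0" for h
        \<comment> \<open>A nonpositive integer is never the value of a form, so duality applies to \<open>-\<nu>\<^sub>k(h)\<close>.\<close>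
        using not_dual[OF \<theta>(1,3), of "- int (subdegree (on_branch N \<psi> h))"] C.euler_form_subdegree_pos
        by fastforce
    qed (rule bump_range[OF s])
    thus ?thesis using \<theta>(1,3) eq unfolding \<theta>(2) by metis
  qed
  have M3: "S s + int (v (k + 1)) - int (ee k) * \<delta> = rep (bump s) (- \<delta>)" "rep (bump s) (- \<delta>) \<in> A"
    if s: "s \<in> tuples f \<phi> k" and \<delta>: "\<delta> \<in> Tset F \<psi>" for s \<delta>
  proof -
    show eq: "S s + int (v (k + 1)) - int (ee k) * \<delta> = rep (bump s) (- \<delta>)"
      unfolding rep_def sum_bump by simp
    obtain P Q where PQ: "degree P < N" "degree Q < N" "euler_form N \<psi> P Q = 0" "on_branch N \<psi> Q \<noteq> 0"
      "int (subdegree (on_branch N \<psi> Q)) = int D - \<delta>"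
      using C.dual_form[OF C.Tset_not_value[OF \<psi>0 \<delta>]] unfolding D_def by blast
    have *: "euler_form n \<phi> P Q \<noteq> 0"
      "subdegree (euler_form n \<phi> P Q) = \<beta> (k + 1) + ee k * subdegree (on_branch N \<psi> Q)"
      using C.form_value_large[OF PQ(1,2,4)] PQ(3) unfolding eN by blast+
    have "int (subdegree (euler_form n \<phi> P Q)) = int (\<beta> (k + 1)) + int (ee k) * (int D - \<delta>)"
      unfolding *(2) of_nat_add of_nat_mult PQ(5) ..
    also have "\<dots> = int (v (k + 1)) - int (ee k) * \<delta>"
      unfolding \<beta>_eq[symmetric] by (simp add: algebra_simps del: char_beta.simps char_e.simps)
    finally have val: "int (subdegree (euler_form n \<phi> P Q)) = int (v (k + 1)) - int (ee k) * \<delta>" .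
    show "rep (bump s) (- \<delta>) \<in> A"
    proof (rule in_A[OF _ *(1)])
      show "rep (bump s) (- \<delta>) = S s + int (subdegree (euler_form n \<phi> P Q))"
        unfolding val eq[symmetric] by simp
      show "0 \<le> s i" if "i \<in> {k+1..g}" for i
        using s that unfolding tuples_def by (cases "i = k + 1") auto
    qed (use bump_range[OF s] C.Tset_neg_not_value[OF \<psi>0 \<delta>] in blast)+
  qed
  have zero_range: "0 \<le> (0::int) \<and> 0 < int (nn i)" if "i \<in> {k+1..g}" for i using nn_pos[OF that] by simp
  have k1: "k + 1 \<in> {k+1..g}" using kg by simp
  have dist1: "rep (\<lambda>_. 0) z \<noteq> rep (bump s) z'" if "s \<in> tuples f \<phi> k" for s z z'
  proof
    assume "rep (\<lambda>_. 0) z = rep (bump s) z'"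
    from rep_unique[OF this zero_range bump_range[OF that]] k1 have "0 = bump s (k + 1)" by blast
    thus False using bump_pos[OF that] by simp
  qed
  have dist2: "rep (bump s) (int \<theta> - int D) \<noteq> rep (bump s') (- \<delta>')"
    if "s \<in> tuples f \<phi> k" "s' \<in> tuples f \<phi> k" "Theta F \<psi> \<delta> = enat \<theta>" "\<delta> \<in> Lambda_set F \<psi>"
      "\<delta>' \<in> Tset F \<psi>" for s s' \<delta> \<theta> \<delta>'
  proof
    assume "rep (bump s) (int \<theta> - int D) = rep (bump s') (- \<delta>')"
    from rep_unique[OF this bump_range[OF that(1)] bump_range[OF that(2)]]
    have "int \<theta> = int D - \<delta>'" by simp
    thus False using not_dual[OF that(3,4) C.Tset_not_value[OF \<psi>0 that(5)]] by blast
  qed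
  define M1' where "M1' = {int (ee k * \<delta>) | \<delta>. \<delta> \<in> L1 f \<phi> k F \<psi>}"
  define M2' where "M2' = {S s + int r | s r. s \<in> tuples f \<phi> k \<and> r \<in> rho f \<phi> k F \<psi> ` L2 f \<phi> k F \<psi>}"
  define M3' where "M3' = {S s + int (v (k + 1)) - int (ee k) * \<delta> | s \<delta>. s \<in> tuples f \<phi> k \<and> \<delta> \<in> Tset F \<psi>}"
  have m1: "\<exists>z. x = rep (\<lambda>_. 0) z \<and> x \<in> A" if "x \<in> M1'" for x
  proof -
    from that obtain \<delta> where "x = int (ee k * \<delta>)" "\<delta> \<in> L1 f \<phi> k F \<psi>" unfolding M1'_def by blast
    thus ?thesis using M1[of \<delta>] by (intro exI[of _ "int \<delta>"]) simp
  qed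
  have m2: "\<exists>s \<delta> \<theta>. x = rep (bump s) (int \<theta> - int D) \<and> x \<in> A \<and> s \<in> tuples f \<phi> k \<and>
      Theta F \<psi> \<delta> = enat \<theta> \<and> \<delta> \<in> Lambda_set F \<psi>" if "x \<in> M2'" for x
  proof -
    from that obtain s \<delta> where "x = S s + int (rho f \<phi> k F \<psi> \<delta>)" "s \<in> tuples f \<phi> k" "\<delta> \<in> L2 f \<phi> k F \<psi>"
      unfolding M2'_def by blast
    thus ?thesis using M2[of s \<delta>] by metis
  qed
  have m3: "\<exists>s \<delta>. x = rep (bump s) (- \<delta>) \<and> x \<in> A \<and> s \<in> tuples f \<phi> k \<and> \<delta> \<in> Tset F \<psi>" if "x \<in> M3'" for x
  proof -
    from that obtain s \<delta> where "x = S s + int (v (k + 1)) - int (ee k) * \<delta>" "s \<in> tuples f \<phi> k" "\<delta> \<in> Tset F \<psi>"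
      unfolding M3'_def by blast
    thus ?thesis using M3[of s \<delta>] by metis
  qed
  have "M1' \<inter> M2' = {}" using m1 m2 dist1 by (metis disjoint_iff)
  moreover have "M1' \<inter> M3' = {}" using m1 m3 dist1 by (metis disjoint_iff)
  moreover have "M2' \<inter> M3' = {}" using m2 m3 dist2 by (metis disjoint_iff)
  moreover have "M1' \<union> M2' \<union> M3' \<subseteq> A" using m1 m2 m3 by blast
  ultimately have "M1' \<inter> M2' = {} \<and> M1' \<inter> M3' = {} \<and> M2' \<inter> M3' = {} \<and> M1' \<union> M2' \<union> M3' \<subseteq> A"
    by blast
  thus ?thesis unfolding Let_def M1'_def M2'_def M3'_def S_def A_def .
qed

end

theorem theorem4p8:
  fixes f fk :: "complex fps poly" and \<phi> \<phi>k :: "complex fps" and k :: nat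
  assumes "weierstrass_poly f" and "irreducible_in conv1_poly f"
    and "degree f > 1" and "multiplicity2 (fps_of_poly f) = degree f"
    and "\<not> degree f dvd subdegree (coeff f 0)"
    and "puiseux_param f \<phi>" and "\<forall>i < subdegree (coeff f 0). fps_nth \<phi> i = 0"
    and "k < genus f \<phi>"
    and "semiroot f \<phi> k fk" and "puiseux_param fk \<phi>k"
  shows "let
      S = (\<lambda>s. \<Sum>i = k + 1..genus f \<phi>. s i * int (gen_v f \<phi> i));
      M1 = {int (char_e f \<phi> k * \<delta>) | \<delta>. \<delta> \<in> L1 f \<phi> k fk \<phi>k};
      M2 = {S s + int r | s r. s \<in> tuples f \<phi> k \<and> r \<in> rho f \<phi> k fk \<phi>k ` L2 f \<phi> k fk \<phi>k};
      M3 = {S s + int (gen_v f \<phi> (k + 1)) - int (char_e f \<phi> k) * \<delta> | s \<delta>.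
              s \<in> tuples f \<phi> k \<and> \<delta> \<in> Tset fk \<phi>k}
    in M1 \<inter> M2 = {} \<and> M1 \<inter> M3 = {} \<and> M2 \<inter> M3 = {} \<and>
       M1 \<union> M2 \<union> M3 \<subseteq> int ` (Lambda_set f \<phi> - Gamma_set f \<phi>)"
proof -
  let ?N = "degree fk"
  have param: "\<phi> $ 0 = 0" "on_branch (degree f) \<phi> f = 0" "primitive_series (degree f) \<phi>"
    using assms(6) subst2_fps_of_poly[of \<phi> f "degree f"]
    unfolding puiseux_param_def primitive_series_def by auto
  have paramk: "\<phi>k $ 0 = 0" "on_branch ?N \<phi>k fk = 0" "primitive_series ?N \<phi>k"
    using assms(10) subst2_fps_of_poly[of \<phi>k fk ?N]
    unfolding puiseux_param_def primitive_series_def by auto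
  have monic: "lead_coeff f = 1" using assms(1) unfolding weierstrass_poly_def by blast
  interpret characteristic f \<phi> using assms(3) param(3) by unfold_locales auto
  have sr: "lead_coeff fk = 1" "?N = (\<Prod>i\<le>k. nn i)" "nu f \<phi> (fps_of_poly fk) = enat (v (k + 1))"
    using assms(9) unfolding semiroot_def if_P[OF assms(8)] by blast+
  have eN: "ee k * ?N = n" unfolding sr(2) by (rule prod_nn)
  hence N_pos: "?N > 0" using n_pos by (intro gr0I) simp
  have fk: "on_branch n \<phi> fk \<noteq> 0" "subdegree (on_branch n \<phi> fk) = v (k + 1)"
    using sr(3) unfolding nu_fps_of_poly[OF param(1)] ord_t_eq_enat by blast+
  have branch: "branch ?N \<phi>k fk" using N_pos sr(1) paramk(2,3) by unfold_locales auto
  obtain \<omega> where \<omega>: "\<omega> \<in> mu ?N"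
    "branch_contact ?N (\<phi>k oo twist \<omega> 1) fk (ee k) \<phi> (\<beta> (Suc k))"
    using contact_of_semiroot[OF assms(8) branch eN fk(1) fk(2)[folded Suc_eq_plus1]] by blast
  let ?\<psi> = "\<phi>k oo twist \<omega> 1"
  note rotate = nu_rotate[OF paramk(1) N_pos \<omega>(1)] nu_diff_rotate[OF paramk(1) N_pos \<omega>(1)]
  have "?\<psi> $ 0 = 0" using paramk(1) by simp
  from disjoint_values[OF monic param(2,1) assms(8) \<omega>(2)[unfolded Suc_eq_plus1] eN this fk(2)]
  show ?thesis unfolding invariants_cong[OF rotate] .
qed

end
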